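(* Let $\mathbb{F}$ be a field of characteristic zero, let $n\ge 1$, let $B\in\mathbb{F}^{n\times n}$ be symmetric, and let $G=G(\mathbf 1,B)$ be the edge-weighted graph on vertex set $[n]=\{1,\dots,n\}$ in which every vertex has weight $1$ and edge $ij$ has weight $B_{i,j}$. For a graph $F$ define $$h(F,G)=\frac{\hom(F,G)}{n^{c(F)}},\qquad \hom(F,G)=\sum_{\phi:V(F)\to[n]}\ \prod_{uv\in E(F)}B_{\phi(u),\phi(v)}.$$ Then $h(\cdot,G)$ is a cycle matroid invariant (i.e. $h(F,G)=h(F',G)$ whenever the cycle matroids of $F$ and $F'$ are isomorphic) if and only if the automorphism group of $G$ is generously transitive.
   Context: Graphs $F$ are finite multigraphs, possibly with loops and multiple edges; in the product over $E(F)$ edges are taken with multiplicity. $c(F)$ is the number of connected components of $F$. The cycle matroid of $F$ is the matroid on $E(F)$ whose circuits are the edge sets of cycles of $F$ (loops are circuits of size 1, two parallel edges form a circuit of size 2). The automorphism group of $G=G(\mathbf 1,B)$ is the group of permutations $\gamma$ of $[n]$ with $B_{\gamma(i),\gamma(j)}=B_{i,j}$ for all $i,j$. A permutation group $\Gamma$ on $[n]$ is generously transitive if for all $u,v\in[n]$ there is $\gamma\in\Gamma$ with $\gamma(u)=v$ and $\gamma(v)=u$. *)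

theory Defs
  imports Main "HOL-Library.FuncSet"
begin

text \<open>Finite multigraphs with vertices and edge identifiers in nat.
  Each edge e has an (unordered) pair of endpoints, represented by an arbitrary
  orientation ends e; loops are edges with ends e = (v,v); parallel edges are
  distinct edge identifiers with the same endpoints.\<close>

record mgraph =
  verts :: "nat set"
  edges :: "nat set"
  ends :: "nat \<Rightarrow> nat \<times> nat"

definition wf_mgraph :: "mgraph \<Rightarrow> bool" where
  "wf_mgraph F \<longleftrightarrow> finite (verts F) \<and> finite (edges F) \<and>
     (\<forall>e\<in>edges F. fst (ends F e) \<in> verts F \<and> snd (ends F e) \<in> verts F)"

definition joins :: "mgraph \<Rightarrow> nat \<Rightarrow> nat \<Rightarrow> nat \<Rightarrow> bool" where
  "joins F e a b \<longleftrightarrow> ends F e = (a, b) \<or> ends F e = (b, a)"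

definition adj_rel :: "mgraph \<Rightarrow> (nat \<times> nat) set" where
  "adj_rel F = {(a, b). \<exists>e\<in>edges F. joins F e a b}"

definition num_components :: "mgraph \<Rightarrow> nat" where
  "num_components F = card (verts F // ((adj_rel F)\<^sup>* \<inter> (verts F \<times> verts F)))"

text \<open>Circuits of the cycle matroid: edge sets of cycles (loops give size-1 circuits,
  two parallel edges give size-2 circuits).\<close>
definition is_cycle_edgeset :: "mgraph \<Rightarrow> nat set \<Rightarrow> bool" where
  "is_cycle_edgeset F C \<longleftrightarrow>
     (\<exists>vs es. length vs = length es \<and> length es \<ge> 1 \<and> distinct vs \<and> distinct es \<and>
        set es \<subseteq> edges F \<and> set vs \<subseteq> verts F \<and>
        (\<forall>i<length es. joins F (es ! i) (vs ! i) (vs ! ((i + 1) mod length es))) \<and>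
        C = set es)"

definition cycle_matroid_iso :: "mgraph \<Rightarrow> mgraph \<Rightarrow> bool" where
  "cycle_matroid_iso F F' \<longleftrightarrow>
     (\<exists>f. bij_betw f (edges F) (edges F') \<and>
        (\<forall>C. C \<subseteq> edges F \<longrightarrow> (is_cycle_edgeset F C \<longleftrightarrow> is_cycle_edgeset F' (f ` C))))"

definition hom_count :: "mgraph \<Rightarrow> nat \<Rightarrow> (nat \<Rightarrow> nat \<Rightarrow> 'a::field) \<Rightarrow> 'a" where
  "hom_count F n B = (\<Sum>\<phi> \<in> verts F \<rightarrow>\<^sub>E {0..<n}.
      \<Prod>e\<in>edges F. B (\<phi> (fst (ends F e))) (\<phi> (snd (ends F e))))"

definition h_dens :: "mgraph \<Rightarrow> nat \<Rightarrow> (nat \<Rightarrow> nat \<Rightarrow> 'a::field) \<Rightarrow> 'a" where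
  "h_dens F n B = hom_count F n B / of_nat n ^ num_components F"

definition is_automorphism :: "nat \<Rightarrow> (nat \<Rightarrow> nat \<Rightarrow> 'a) \<Rightarrow> (nat \<Rightarrow> nat) \<Rightarrow> bool" where
  "is_automorphism n B \<gamma> \<longleftrightarrow> bij_betw \<gamma> {0..<n} {0..<n} \<and>
     (\<forall>i<n. \<forall>j<n. B (\<gamma> i) (\<gamma> j) = B i j)"

definition generously_transitive_aut :: "nat \<Rightarrow> (nat \<Rightarrow> nat \<Rightarrow> 'a) \<Rightarrow> bool" where
  "generously_transitive_aut n B \<longleftrightarrow>
     (\<forall>u<n. \<forall>v<n. \<exists>\<gamma>. is_automorphism n B \<gamma> \<and> \<gamma> u = v \<and> \<gamma> v = u)"

end

theory Submission
  imports Defs "HOL.Rat"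
begin

text \<open>If the automorphism group is generously transitive, then the invariant matrices are symmetric and
  closed under entrywise and matrix products, and hence they commute. Give every edge its own
  invariant matrix and average over random vertex colourings instead of summing. Two graphs with
  the same cycle space then have the same average, by induction on the number of edges: 1-separations
  factor, parallel and series pairs merge (entrywise and matrix product), 2-separations replace one
  side by a virtual edge, and in the 3-connected case vertex stars are the cuts whose deletion leaves
  a connected matroid, so the graphs are isomorphic. Taking the identity matrix on all edges shows
  that the normalisation by components is a matroid invariant too.

  Conversely, invariance under Whitney twists says that the bilinear form
  \<open>\<Sum>x y. X x y * Y x y\<close> does not change when \<open>Y\<close> is transposed, for all \<open>X\<close>, \<open>Y\<close> in the span of the
  2-labelled graphs. The number \<open>N x y\<close> of automorphisms that map \<open>(u, v)\<close> to \<open>(x, y)\<close> lies in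
  that span up to matrices supported on the diagonal, so \<open>\<Sum>x y. (N x y - N y x)\<^sup>2 = 0\<close> and
  \<open>N v u = N u v > 0\<close>.\<close>

section \<open>Even edge sets and separations\<close>

text \<open>The graphs to be compared share only their even edge sets (the binary cycle space);
  their vertices may be unrelated. So separations are defined by even sets alone, which carries them
  from \<open>p\<close> to \<open>q\<close> at once. The price is that such a separation need not
  show at one or two vertices: its sides may be scattered over many blocks. A minimal side is
  connected, and then the attachment vertices can be recovered in both graphs.

  Edges need individual weights because each reduction leaves an edge with a new matrix: a product,
  or the joint distribution of a whole side at two vertices. All of these stay invariant, so two
  properties survive the induction: symmetry, which makes the orientation of ordinary and virtual
  edges irrelevant, and commutativity, which lets series edges lie far apart.

  For the converse, graphs whose vertices are the colours themselves make automorphisms special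
  colourings. Their indicator is, up to a scalar, a polynomial in the entries
  \<open>B (\<phi> i) (\<phi> j)\<close> and the indicators of \<open>\<phi> i = \<phi> j\<close>.
  Characteristic zero turns the resulting identity in the field into one of natural numbers.\<close>

lemma odd_card_sym_diff:
  assumes "finite A" "finite B"
  shows "odd (card (sym_diff A B)) \<longleftrightarrow> odd (card A) \<noteq> odd (card B)"
proof -
  have "card (sym_diff A B) = card (A - B) + card (B - A)"
    using assms by (intro card_Un_disjoint) auto
  moreover have "card A = card (A - B) + card (A \<inter> B)"
    using assms by (metis Int_Diff_disjoint Int_Diff_Un card_Un_disjoint finite_Diff finite_Int add.commute)
  moreover have "card B = card (B - A) + card (A \<inter> B)"
    using assms by (metis Int_Diff_disjoint Int_Diff_Un card_Un_disjoint finite_Diff finite_Int add.commute inf_commute)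
  ultimately show ?thesis by auto
qed

section \<open>Boundaries modulo 2\<close>

definition inc :: "('e \<Rightarrow> 'v \<times> 'v) \<Rightarrow> 'e \<Rightarrow> 'v set" where
  "inc p e = {v. (v = fst (p e)) \<noteq> (v = snd (p e))}"

text \<open>The mod-2 boundary: the vertices of odd degree. The exclusive or in \<open>inc\<close>
  makes loops invisible here, so a loop is even by itself. The sets with empty boundary form the
  cycle space over GF(2).\<close>

definition bdry :: "('e \<Rightarrow> 'v \<times> 'v) \<Rightarrow> 'e set \<Rightarrow> 'v set" where
  "bdry p Z = {v. odd (card {e \<in> Z. v \<in> inc p e})}"

definition vset :: "('e \<Rightarrow> 'v \<times> 'v) \<Rightarrow> 'e set \<Rightarrow> 'v set" where
  "vset p C = (\<Union>e\<in>C. {fst (p e), snd (p e)})"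

definition reach :: "('e \<Rightarrow> 'v \<times> 'v) \<Rightarrow> 'e set \<Rightarrow> ('v \<times> 'v) set" where
  "reach p C = {(x, y). \<exists>e\<in>C. p e = (x, y) \<or> p e = (y, x)}\<^sup>*"

lemma finite_vset [simp]: "finite C \<Longrightarrow> finite (vset p C)"
  by (auto simp: vset_def)

lemma vset_Un: "vset p (C \<union> D) = vset p C \<union> vset p D"
  by (auto simp: vset_def)

lemma vset_mono: "C \<subseteq> D \<Longrightarrow> vset p C \<subseteq> vset p D"
  by (auto simp: vset_def)

lemma vsetI: "e \<in> C \<Longrightarrow> v = fst (p e) \<or> v = snd (p e) \<Longrightarrow> v \<in> vset p C"
  by (auto simp: vset_def)

lemma vsetE:
  assumes "v \<in> vset p C" obtains e where "e \<in> C" "v = fst (p e) \<or> v = snd (p e)"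
  using assms by (auto simp: vset_def)

lemma inc_subset: "inc p e \<subseteq> {fst (p e), snd (p e)}"
  by (auto simp: inc_def)

lemma inc_altdef: "inc p e = sym_diff {fst (p e)} {snd (p e)}"
  by (auto simp: inc_def)

lemma inc_empty_iff: "inc p e = {} \<longleftrightarrow> fst (p e) = snd (p e)"
  by (auto simp: inc_def)

lemma bdry_empty [simp]: "bdry p {} = {}"
  by (simp add: bdry_def)

lemma bdry_sym_diff:
  assumes "finite A" "finite B"
  shows "bdry p (sym_diff A B) = sym_diff (bdry p A) (bdry p B)"
proof -
  have "{e \<in> sym_diff A B. v \<in> inc p e} = sym_diff {e \<in> A. v \<in> inc p e} {e \<in> B. v \<in> inc p e}" for v
    by blast
  then have "v \<in> bdry p (sym_diff A B) \<longleftrightarrow> v \<in> sym_diff (bdry p A) (bdry p B)" for v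
    using odd_card_sym_diff[of "{e \<in> A. v \<in> inc p e}" "{e \<in> B. v \<in> inc p e}"] assms
    by (auto simp: bdry_def)
  then show ?thesis by blast
qed

lemma bdry_Un_disjoint:
  assumes "finite A" "finite B" "A \<inter> B = {}"
  shows "bdry p (A \<union> B) = sym_diff (bdry p A) (bdry p B)"
proof -
  have "A \<union> B = sym_diff A B" using assms(3) by blast
  with bdry_sym_diff[OF assms(1,2)] show ?thesis by simp
qed

lemma bdry_singleton [simp]: "bdry p {e} = inc p e"
proof -
  have "{e' \<in> {e}. v \<in> inc p e'} = (if v \<in> inc p e then {e} else {})" for v by auto
  then show ?thesis by (auto simp: bdry_def)
qed

lemma bdry_insert:
  assumes "finite A" "e \<notin> A"
  shows "bdry p (insert e A) = sym_diff (bdry p A) (inc p e)"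
  using bdry_Un_disjoint[of A "{e}" p] assms by simp

lemma bdry_subset_vset: "bdry p Z \<subseteq> vset p Z"
proof
  fix v assume "v \<in> bdry p Z"
  then have "{e \<in> Z. v \<in> inc p e} \<noteq> {}"
    unfolding bdry_def by (metis (mono_tags, lifting) card.empty even_zero mem_Collect_eq)
  then show "v \<in> vset p Z" using inc_subset[of p] by (auto simp: vset_def)
qed

lemma bdry_cong:
  assumes "\<And>e. e \<in> Z \<Longrightarrow> p e = p' e"
  shows "bdry p Z = bdry p' Z"
proof -
  have "{e \<in> Z. v \<in> inc p e} = {e \<in> Z. v \<in> inc p' e}" for v
    by (rule Collect_cong) (simp add: inc_def assms cong: conj_cong)
  then show ?thesis by (simp add: bdry_def)
qed

lemma bdry_split:
  assumes "finite Z" "bdry p Z = {}"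
  shows "bdry p (Z \<inter> C) = bdry p (Z - C)"
proof -
  have "Z = sym_diff (Z \<inter> C) (Z - C)" by blast
  then have "{} = sym_diff (bdry p (Z \<inter> C)) (bdry p (Z - C))"
    using bdry_sym_diff[of "Z \<inter> C" "Z - C" p] assms by simp
  then show ?thesis by blast
qed

text \<open>Each edge toggles zero or two vertices of the boundary. Hence a boundary confined to one
  vertex is empty, and one confined to two vertices is empty or both; this is what makes small
  vertex separators visible in the cycle space.\<close>

lemma handshake: "finite Z \<Longrightarrow> even (card (bdry p Z))"
proof (induction Z rule: finite_induct)
  case (insert e Z)
  have "even (card (inc p e))"
  proof (cases "fst (p e) = snd (p e)")
    case True
    then have "inc p e = {}" by (simp add: inc_empty_iff)
    then show ?thesis by simp
  next
    case False
    then have "inc p e = {fst (p e), snd (p e)}" by (auto simp: inc_def)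
    then show ?thesis using False by simp
  qed
  moreover have "finite (bdry p Z)"
    using insert.hyps(1) bdry_subset_vset finite_subset finite_vset by metis
  moreover have "finite (inc p e)" using inc_subset finite_subset by (metis finite.emptyI finite.insertI)
  ultimately show ?case
    using insert odd_card_sym_diff[of "bdry p Z" "inc p e"] by (simp add: bdry_insert)
qed simp

lemma bdry_subset_singleton:
  assumes "finite Z" "bdry p Z \<subseteq> {a}" shows "bdry p Z = {}"
proof (rule ccontr)
  assume "bdry p Z \<noteq> {}"
  then have "bdry p Z = {a}" using assms(2) by blast
  then show False using handshake[OF assms(1), of p] by simp
qed

lemma bdry_subset_pair:
  assumes "finite Z" "bdry p Z \<subseteq> {a, b}" "bdry p Z \<noteq> {}" shows "bdry p Z = {a, b}"
proof (rule ccontr)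
  assume "bdry p Z \<noteq> {a, b}"
  then have "bdry p Z \<subseteq> {a} \<or> bdry p Z \<subseteq> {b}" using assms(2) by blast
  then show False using bdry_subset_singleton assms(1,3) by metis
qed

section \<open>Reachability, components and connected edge sets\<close>

lemma reach_refl [simp]: "(u, u) \<in> reach p C"
  by (simp add: reach_def)

lemma reach_trans: "(u, v) \<in> reach p C \<Longrightarrow> (v, w) \<in> reach p C \<Longrightarrow> (u, w) \<in> reach p C"
  unfolding reach_def by (rule rtrancl_trans)

lemma reach_sym: "(u, v) \<in> reach p C \<Longrightarrow> (v, u) \<in> reach p C"
proof -
  have "sym (reach p C)" unfolding reach_def
    by (rule sym_rtrancl) (auto simp: sym_def)
  then show "(u, v) \<in> reach p C \<Longrightarrow> (v, u) \<in> reach p C" by (rule symD)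
qed

lemma reach_edge: "e \<in> C \<Longrightarrow> (fst (p e), snd (p e)) \<in> reach p C"
  unfolding reach_def by (rule r_into_rtrancl) (auto simp: prod_eq_iff)

text \<open>The edges of a walk, added modulo 2, telescope to its two ends; edges walked twice
  cancel.\<close>

lemma reach_bdry:
  assumes "(u, v) \<in> reach p C"
  shows "\<exists>P\<subseteq>C. finite P \<and> bdry p P = sym_diff {u} {v}"
  using assms unfolding reach_def
proof (induction rule: rtrancl_induct)
  case base
  show ?case by (rule exI[of _ "{}"]) simp
next
  case (step y z)
  then obtain P e where P: "P \<subseteq> C" "finite P" "bdry p P = sym_diff {u} {y}"
    and e: "e \<in> C" "p e = (y, z) \<or> p e = (z, y)" by blast
  have "inc p e = sym_diff {y} {z}" using e(2) by (elim disjE) (auto simp: inc_def)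
  then have "bdry p (sym_diff P {e}) = sym_diff (sym_diff {u} {y}) (sym_diff {y} {z})"
    using bdry_sym_diff[of P "{e}" p] P by simp
  also have "\<dots> = sym_diff {u} {z}" by blast
  finally show ?case using P e by (intro exI[of _ "sym_diff P {e}"]) auto
qed

definition comp_of :: "('e \<Rightarrow> 'v \<times> 'v) \<Rightarrow> 'e set \<Rightarrow> 'v \<Rightarrow> 'e set" where
  "comp_of p C a = {e \<in> C. (a, fst (p e)) \<in> reach p C}"

lemma comp_of_subset: "comp_of p C a \<subseteq> C"
  by (auto simp: comp_of_def)

lemma vset_comp_of: "v \<in> vset p (comp_of p C a) \<Longrightarrow> (a, v) \<in> reach p C"
  by (auto simp: comp_of_def vset_def intro: reach_trans reach_edge)

lemma comp_ofI:
  assumes "e \<in> C" "v = fst (p e) \<or> v = snd (p e)" "(a, v) \<in> reach p C"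
  shows "e \<in> comp_of p C a"
proof -
  have "(v, fst (p e)) \<in> reach p C"
    using assms(2) reach_sym[OF reach_edge[OF assms(1), of p]] by auto
  then show ?thesis using assms(1) reach_trans[OF assms(3)] by (simp add: comp_of_def)
qed

lemma comp_of_disjoint: "vset p (comp_of p C a) \<inter> vset p (C - comp_of p C a) = {}"
proof -
  { fix v assume v: "v \<in> vset p (comp_of p C a)" "v \<in> vset p (C - comp_of p C a)"
    then obtain e where e: "e \<in> C" "e \<notin> comp_of p C a" "v = fst (p e) \<or> v = snd (p e)"
      by (auto elim!: vsetE)
    with comp_ofI[where p = p, OF e(1,3) vset_comp_of[OF v(1)]] have False by blast }
  then show ?thesis by blast
qed

text \<open>Formulated by splittings of the edge set rather than by paths, so that minimality of a
  separation proves it directly.\<close>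

definition edge_connected :: "('e \<Rightarrow> 'v \<times> 'v) \<Rightarrow> 'e set \<Rightarrow> bool" where
  "edge_connected p C \<longleftrightarrow>
     (\<forall>D\<subseteq>C. vset p D \<inter> vset p (C - D) = {} \<longrightarrow> D = {} \<or> D = C)"

lemma edge_connected_reach:
  assumes "edge_connected p C" "a \<in> vset p C" "b \<in> vset p C"
  shows "(a, b) \<in> reach p C"
proof -
  obtain e where e: "e \<in> C" "a = fst (p e) \<or> a = snd (p e)"
    using assms(2) by (rule vsetE)
  have "e \<in> comp_of p C a" by (rule comp_ofI[where p = p, OF e]) simp
  moreover have "comp_of p C a = {} \<or> comp_of p C a = C"
    using assms(1) comp_of_disjoint comp_of_subset unfolding edge_connected_def by metis
  ultimately have "comp_of p C a = C" by blast
  then show ?thesis using vset_comp_of assms(3) by metis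
qed

section \<open>Cuts as the orthogonal complement of the cycle space\<close>

definition is_cut :: "('e \<Rightarrow> 'v \<times> 'v) \<Rightarrow> 'e set \<Rightarrow> 'v set \<Rightarrow> 'e set \<Rightarrow> bool" where
  "is_cut p E S D \<longleftrightarrow> D = {e \<in> E. (fst (p e) \<in> S) \<noteq> (snd (p e) \<in> S)}"

lemma is_cut_Compl: "is_cut p E S D \<Longrightarrow> is_cut p E (- S) D"
  by (auto simp: is_cut_def)

text \<open>The side \<open>S\<close> collects the vertices joined to a fixed root of their component
  by an edge set meeting \<open>D\<close> oddly; orthogonality makes this independent of the choice.\<close>

lemma orthogonal_is_cut:
  assumes "finite E" "D \<subseteq> E"
    and orth: "\<And>Z. Z \<subseteq> E \<Longrightarrow> bdry p Z = {} \<Longrightarrow> even (card (Z \<inter> D))"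
  shows "\<exists>S. is_cut p E S D"
proof -
  define root where "root v = (SOME r. (v, r) \<in> reach p E)" for v
  have root: "(v, root v) \<in> reach p E" for v
    unfolding root_def by (rule someI[of _ v]) simp
  define S where "S = {v. \<exists>P\<subseteq>E. bdry p P = sym_diff {v} {root v} \<and> odd (card (P \<inter> D))}"
  have fin: "finite P" if "P \<subseteq> E" for P using that assms(1) finite_subset by blast
  have S_iff: "v \<in> S \<longleftrightarrow> odd (card (P \<inter> D))" if P: "P \<subseteq> E" "bdry p P = sym_diff {v} {root v}" for v P
  proof
    assume "v \<in> S"
    then obtain Q where Q: "Q \<subseteq> E" "bdry p Q = sym_diff {v} {root v}" "odd (card (Q \<inter> D))"
      unfolding S_def by blast
    have "bdry p (sym_diff P Q) = {}" using bdry_sym_diff[of P Q p] P Q fin by simp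
    then have "even (card (sym_diff P Q \<inter> D))" using P Q by (intro orth) auto
    moreover have "sym_diff P Q \<inter> D = sym_diff (P \<inter> D) (Q \<inter> D)" by blast
    ultimately show "odd (card (P \<inter> D))"
      using Q(3) odd_card_sym_diff[of "P \<inter> D" "Q \<inter> D"] fin P(1) Q(1) by auto
  next
    assume "odd (card (P \<inter> D))" then show "v \<in> S" using P unfolding S_def by blast
  qed
  have "e \<in> D \<longleftrightarrow> (fst (p e) \<in> S) \<noteq> (snd (p e) \<in> S)" if e: "e \<in> E" for e
  proof -
    define u v where "u = fst (p e)" and "v = snd (p e)"
    have uv: "(u, v) \<in> reach p E" using e reach_edge[of e E p] by (simp add: u_def v_def)
    have "(u, r) \<in> reach p E \<longleftrightarrow> (v, r) \<in> reach p E" for r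
      using uv reach_sym reach_trans by metis
    then have r: "root u = root v" by (simp add: root_def)
    obtain P where P: "P \<subseteq> E" "bdry p P = sym_diff {u} {root u}" using reach_bdry root by metis
    obtain Q where Q: "Q \<subseteq> E" "bdry p Q = sym_diff {v} {root v}" using reach_bdry root by metis
    \<comment> \<open>The walks from both ends of \<open>e\<close> to their common root, closed up
      by \<open>e\<close>.\<close>
    let ?Z = "sym_diff (sym_diff P Q) {e}"
    have "bdry p ?Z = sym_diff (sym_diff (sym_diff {u} {root u}) (sym_diff {v} {root v})) (sym_diff {u} {v})"
      using bdry_sym_diff[of "sym_diff P Q" "{e}" p] bdry_sym_diff[of P Q p] fin P Q
      by (simp add: inc_altdef u_def v_def)
    also have "\<dots> = {}" unfolding r by blast
    finally have "even (card (?Z \<inter> D))" using P Q e by (intro orth) auto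
    moreover have "?Z \<inter> D = sym_diff (sym_diff (P \<inter> D) (Q \<inter> D)) ({e} \<inter> D)" by blast
    moreover have "odd (card ({e} \<inter> D)) \<longleftrightarrow> e \<in> D" by (cases "e \<in> D") auto
    ultimately have "e \<in> D \<longleftrightarrow> odd (card (P \<inter> D)) \<noteq> odd (card (Q \<inter> D))"
      using odd_card_sym_diff[of "sym_diff (P \<inter> D) (Q \<inter> D)" "{e} \<inter> D"]
        odd_card_sym_diff[of "P \<inter> D" "Q \<inter> D"] fin P(1) Q(1) by auto
    then show ?thesis using S_iff[OF P] S_iff[OF Q] by (simp add: u_def v_def)
  qed
  then have "is_cut p E S D" unfolding is_cut_def using assms(2) by blast
  then show ?thesis ..
qed

section \<open>1- and 2-separations of the cycle matroid\<close>

definition sep1 :: "('e \<Rightarrow> 'v \<times> 'v) \<Rightarrow> 'e set \<Rightarrow> 'e set \<Rightarrow> bool" where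
  "sep1 p E C \<longleftrightarrow> (\<forall>Z\<subseteq>E. bdry p Z = {} \<longrightarrow> bdry p (Z \<inter> C) = {})"

text \<open>\<open>sep1\<close> says that the cycle space is the direct sum of its parts on
  \<open>C\<close> and on the complement. Here the quotient by that sum has dimension at most one:
  \<open>bdry p (Z \<inter> C)\<close> is linear in the even set \<open>Z\<close>, and its image
  contains at most one nonempty set. Bounds on the sizes of the two sides are stated
  separately.\<close>

definition sep2 :: "('e \<Rightarrow> 'v \<times> 'v) \<Rightarrow> 'e set \<Rightarrow> 'e set \<Rightarrow> bool" where
  "sep2 p E C \<longleftrightarrow> (\<forall>Y\<subseteq>E. \<forall>Z\<subseteq>E. bdry p Y = {} \<longrightarrow> bdry p Z = {} \<longrightarrow>
     bdry p (Y \<inter> C) = {} \<or> bdry p (Z \<inter> C) = {} \<or> bdry p (sym_diff Y Z \<inter> C) = {})"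

definition same_even :: "('e \<Rightarrow> 'v \<times> 'v) \<Rightarrow> ('e \<Rightarrow> 'w \<times> 'w) \<Rightarrow> 'e set \<Rightarrow> bool" where
  "same_even p q E \<longleftrightarrow> (\<forall>Z\<subseteq>E. bdry p Z = {} \<longleftrightarrow> bdry q Z = {})"

lemma same_even_sym: "same_even p q E \<Longrightarrow> same_even q p E"
  by (auto simp: same_even_def)

lemma same_even_mono: "same_even p q E \<Longrightarrow> C \<subseteq> E \<Longrightarrow> same_even p q C"
  by (auto simp: same_even_def)

lemma sep1_mono: "sep1 p E C \<Longrightarrow> F \<subseteq> E \<Longrightarrow> sep1 p F C"
  unfolding sep1_def by blast

lemma sep1_same_even:
  assumes "same_even p q E" "sep1 p E C" shows "sep1 q E C"
  using assms unfolding sep1_def same_even_def by (meson inf.coboundedI1)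

lemma sep2_same_even:
  assumes "same_even p q E" "sep2 p E C" shows "sep2 q E C"
  unfolding sep2_def
proof (intro allI impI)
  fix Y Z assume YZ: "Y \<subseteq> E" "Z \<subseteq> E" "bdry q Y = {}" "bdry q Z = {}"
  have *: "bdry p X = {} \<longleftrightarrow> bdry q X = {}" if "X \<subseteq> E" for X
    using assms(1) that unfolding same_even_def by blast
  have "bdry p (Y \<inter> C) = {} \<or> bdry p (Z \<inter> C) = {} \<or> bdry p (sym_diff Y Z \<inter> C) = {}"
    using assms(2) YZ *[OF YZ(1)] *[OF YZ(2)] unfolding sep2_def by metis
  moreover have "Y \<inter> C \<subseteq> E" "Z \<inter> C \<subseteq> E" "sym_diff Y Z \<inter> C \<subseteq> E" using YZ by auto
  ultimately show "bdry q (Y \<inter> C) = {} \<or> bdry q (Z \<inter> C) = {} \<or> bdry q (sym_diff Y Z \<inter> C) = {}"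
    using * by metis
qed

text \<open>The two traces of an even set have the same boundary, which therefore consists of
  vertices shared by both sides.\<close>

lemma bdry_restrict_subset:
  assumes "finite E" "Z \<subseteq> E" "bdry p Z = {}"
  shows "bdry p (Z \<inter> C) \<subseteq> vset p C \<inter> vset p (E - C)"
proof -
  have "bdry p (Z \<inter> C) \<subseteq> vset p C"
    by (rule order.trans[OF bdry_subset_vset vset_mono]) blast
  moreover have "bdry p (Z - C) \<subseteq> vset p (E - C)"
    by (rule order.trans[OF bdry_subset_vset vset_mono]) (use assms(2) in blast)
  ultimately show ?thesis using bdry_split[of Z p C] assms finite_subset by blast
qed

lemma sep1_vset:
  assumes "finite E" "vset p C \<inter> vset p (E - C) \<subseteq> {a}"
  shows "sep1 p E C"
  unfolding sep1_def
proof (intro allI impI)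
  fix Z assume Z: "Z \<subseteq> E" "bdry p Z = {}"
  show "bdry p (Z \<inter> C) = {}"
    using bdry_restrict_subset[OF assms(1) Z, of C] assms finite_subset[OF Z(1) assms(1)]
    by (intro bdry_subset_singleton[of _ _ a]) auto
qed

lemma sep2_vset:
  assumes "finite E" "vset p C \<inter> vset p (E - C) \<subseteq> {a, b}"
  shows "sep2 p E C"
  unfolding sep2_def
proof (intro allI impI, rule ccontr)
  fix Y Z assume YZ: "Y \<subseteq> E" "Z \<subseteq> E" "bdry p Y = {}" "bdry p Z = {}"
    and neg: "\<not> (bdry p (Y \<inter> C) = {} \<or> bdry p (Z \<inter> C) = {} \<or> bdry p (sym_diff Y Z \<inter> C) = {})"
  have fin: "finite Y" "finite Z" using YZ assms(1) finite_subset by blast+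
  have "bdry p (Y \<inter> C) = {a, b}"
    by (rule bdry_subset_pair) (use bdry_restrict_subset[OF assms(1) YZ(1,3), of C] fin neg assms(2) in auto)
  moreover have "bdry p (Z \<inter> C) = {a, b}"
    by (rule bdry_subset_pair) (use bdry_restrict_subset[OF assms(1) YZ(2,4), of C] fin neg assms(2) in auto)
  moreover have "sym_diff Y Z \<inter> C = sym_diff (Y \<inter> C) (Z \<inter> C)" by blast
  ultimately show False using neg bdry_sym_diff[of "Y \<inter> C" "Z \<inter> C" p] fin by auto
qed

text \<open>A part of \<open>C\<close> sharing no vertex with the rest of \<open>C\<close> is a
  1-separation of \<open>C\<close>, hence of \<open>E\<close>, against minimality.\<close>

lemma edge_connected_if_minimal_sep1:
  assumes "finite E" "C \<subseteq> E" "C \<noteq> E" "sep1 p E C"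
    and min: "\<And>D. D \<subset> C \<Longrightarrow> D \<noteq> {} \<Longrightarrow> \<not> sep1 p E D"
  shows "edge_connected p C"
  unfolding edge_connected_def
proof (intro allI impI, rule ccontr)
  fix D assume D: "D \<subseteq> C" "vset p D \<inter> vset p (C - D) = {}" and neg: "\<not> (D = {} \<or> D = C)"
  have "sep1 p C D" using D sep1_vset[of C p D undefined] assms finite_subset by blast
  then have "sep1 p E D"
    using assms(4) D(1) unfolding sep1_def by (metis inf.absorb_iff2 inf.cobounded2 inf_assoc)
  then show False using min D neg by blast
qed

text \<open>A part of \<open>C\<close> cut off from the rest of \<open>C\<close> inherits
  \<open>sep2\<close>. If \<open>C\<close> has more than two edges, one of two such parts has at
  least two and contradicts minimality; pairs of edges have to be treated apart.\<close>

lemma edge_connected_if_minimal_sep2: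
  assumes "finite E" "C \<subseteq> E" "sep2 p E C" "2 \<le> card (E - C)" "card C > 2"
    and min: "\<And>D. D \<subset> C \<Longrightarrow> 2 \<le> card D \<Longrightarrow> 2 \<le> card (E - D) \<Longrightarrow> \<not> sep2 p E D"
  shows "edge_connected p C"
  unfolding edge_connected_def
proof (intro allI impI, rule ccontr)
  fix D assume D: "D \<subseteq> C" "vset p D \<inter> vset p (C - D) = {}" and neg: "\<not> (D = {} \<or> D = C)"
  have fC: "finite C" using assms finite_subset by blast
  have *: "sep2 p E X" if X: "X \<subseteq> C" "vset p X \<inter> vset p (C - X) = {}" for X
    unfolding sep2_def
  proof (intro allI impI)
    fix Y Z assume YZ: "Y \<subseteq> E" "Z \<subseteq> E" "bdry p Y = {}" "bdry p Z = {}"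
    have s: "sep1 p C X" using X sep1_vset[of C p X undefined] fC by blast
    have r: "bdry p (U \<inter> C) = {} \<Longrightarrow> bdry p (U \<inter> X) = {}" for U
      using s X(1) unfolding sep1_def by (metis inf.absorb_iff2 inf.cobounded2 inf_assoc)
    show "bdry p (Y \<inter> X) = {} \<or> bdry p (Z \<inter> X) = {} \<or> bdry p (sym_diff Y Z \<inter> X) = {}"
      using assms(3)[unfolded sep2_def, rule_format, OF YZ] r by metis
  qed
  have c: "card C = card D + card (C - D)"
    using D(1) fC by (metis card_Diff_subset card_mono finite_subset le_add_diff_inverse)
  have "card D \<ge> 2 \<or> card (C - D) \<ge> 2" using c assms(5) by linarith
  then obtain X where X: "X \<subset> C" "2 \<le> card X" "vset p X \<inter> vset p (C - X) = {}"
  proof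
    assume "2 \<le> card D" then show ?thesis using that[of D] D neg by (simp add: psubset_eq)
  next
    assume "2 \<le> card (C - D)"
    moreover have "C - (C - D) = D" using D(1) by blast
    moreover have "vset p (C - D) \<inter> vset p D = {}" using D(2) by (simp add: inf_commute)
    moreover have "C - D \<subset> C" using D(1) neg by auto
    ultimately show ?thesis using that[of "C - D"] by simp
  qed
  have "card (E - C) \<le> card (E - X)" using X assms(1) by (intro card_mono) auto
  then show False using min[of X] X * assms(4) by auto
qed

text \<open>A component of the complement of \<open>C\<close> with two attachments would close a cycle through \<open>C\<close>.\<close>

lemma sep1_block:
  assumes "finite E" "C \<subseteq> E" "C \<noteq> E" "sep1 p E C" "edge_connected p C"
  shows "\<exists>D a. D \<subseteq> E - C \<and> D \<noteq> {} \<and> vset p D \<inter> vset p (E - D) \<subseteq> {a} \<and>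
           vset p D \<inter> vset p (E - C - D) = {}"
proof -
  obtain e where e: "e \<in> E" "e \<notin> C" using assms(2,3) by blast
  define D where "D = comp_of p (E - C) (fst (p e))"
  have "e \<in> D" using e by (simp add: D_def comp_of_def)
  have D: "D \<subseteq> E - C" using comp_of_subset by (simp add: D_def)
  have disj: "vset p D \<inter> vset p (E - C - D) = {}" using comp_of_disjoint by (simp add: D_def)
  have "E - D = C \<union> (E - C - D)" using D assms(2) by blast
  then have "vset p (E - D) = vset p C \<union> vset p (E - C - D)" by (simp add: vset_Un)
  then have v: "vset p D \<inter> vset p (E - D) = vset p D \<inter> vset p C" using disj by auto
  have "a = b" if ab: "a \<in> vset p D \<inter> vset p C" "b \<in> vset p D \<inter> vset p C" for a b
  proof (rule ccontr)
    assume ne: "a \<noteq> b"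
    have "(a, b) \<in> reach p (E - C)"
      using ab vset_comp_of reach_sym reach_trans unfolding D_def by (metis IntD1)
    then obtain P where P: "P \<subseteq> E - C" "finite P" "bdry p P = sym_diff {a} {b}" using reach_bdry by metis
    obtain Q where Q: "Q \<subseteq> C" "finite Q" "bdry p Q = sym_diff {a} {b}"
      using edge_connected_reach[OF assms(5)] ab reach_bdry by (metis IntD2)
    have "bdry p (Q \<union> P) = {}" using bdry_Un_disjoint[of Q P p] P Q by auto
    moreover have "Q \<union> P \<subseteq> E" "(Q \<union> P) \<inter> C = Q" using P Q assms(2) by auto
    ultimately have "bdry p Q = {}" using assms(4) unfolding sep1_def by metis
    then show False using Q ne by auto
  qed
  then have "\<exists>a. vset p D \<inter> vset p C \<subseteq> {a}" by blast
  then obtain a where "vset p D \<inter> vset p (E - D) \<subseteq> {a}" using v by auto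
  then show ?thesis using D disj \<open>e \<in> D\<close> by (intro exI[of _ D] exI[of _ a]) auto
qed

lemma minimal_subset:
  assumes "finite E" "C \<subseteq> E" "P C"
  obtains D where "D \<subseteq> E" "P D" "\<And>D'. D' \<subset> D \<Longrightarrow> \<not> P D'"
proof -
  have "\<exists>D. P D \<and> D \<subseteq> E \<and> (\<forall>D'. P D' \<and> D' \<subseteq> E \<longrightarrow> card D \<le> card D')"
    using assms(2,3) exists_least_iff[of "\<lambda>k. \<exists>D. P D \<and> D \<subseteq> E \<and> card D = k"]
    by (metis linorder_not_less)
  then obtain D where D: "P D" "D \<subseteq> E" "\<And>D'. P D' \<Longrightarrow> D' \<subseteq> E \<Longrightarrow> card D \<le> card D'" by blast
  have "\<not> P D'" if "D' \<subset> D" for D'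
    using D that psubset_card_mono[of D D'] finite_subset[OF _ assms(1)]
    by (metis linorder_not_less order_trans psubset_imp_subset)
  with D that show thesis by blast
qed

text \<open>In the absence of 1-separations every component of the complement of \<open>C\<close> attaches to \<open>C\<close>
  at two vertices at least, and each such pair is the boundary of the trace on \<open>C\<close> of a cycle.
  As \<open>C\<close> is a 2-separation, there is only one such trace.\<close>

lemma sep2_attachments:
  assumes "finite E" "C \<subseteq> E" "C \<noteq> {}" "C \<noteq> E" "sep2 p E C" "edge_connected p C"
    and no1: "\<And>D. D \<subseteq> E \<Longrightarrow> D \<noteq> {} \<Longrightarrow> D \<noteq> E \<Longrightarrow> \<not> sep1 p E D"
  shows "\<exists>a b P Q. a \<noteq> b \<and> vset p C \<inter> vset p (E - C) = {a, b} \<and>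
    P \<subseteq> C \<and> bdry p P = {a, b} \<and> Q \<subseteq> E - C \<and> bdry p Q = {a, b}"
proof -
  let ?A = "vset p C \<inter> vset p (E - C)"
  define pair where "pair c d P Q \<longleftrightarrow> c \<in> ?A \<and> d \<in> ?A \<and> c \<noteq> d \<and> P \<subseteq> C \<and> bdry p P = {c, d} \<and>
     Q \<subseteq> E - C \<and> bdry p Q = {c, d}" for c d P Q
  have ex: "\<exists>d P Q. pair c d P Q" if c: "c \<in> ?A" for c
  proof -
    let ?D = "comp_of p (E - C) c"
    obtain e where e: "e \<in> E - C" "c = fst (p e) \<or> c = snd (p e)" using c by (auto elim!: vsetE)
    have "e \<in> ?D" by (rule comp_ofI[where p = p, OF e]) simp
    have D: "?D \<subseteq> E - C" by (rule comp_of_subset)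
    have "E - ?D = C \<union> (E - C - ?D)" using D assms(2) by blast
    then have "vset p (E - ?D) = vset p C \<union> vset p (E - C - ?D)" by (simp add: vset_Un)
    then have v: "vset p ?D \<inter> vset p (E - ?D) = vset p ?D \<inter> vset p C"
      using comp_of_disjoint[of p "E - C" c] by auto
    have "\<not> vset p ?D \<inter> vset p C \<subseteq> {c}"
      using no1[of ?D] sep1_vset[OF assms(1), of p ?D c] v D \<open>e \<in> ?D\<close> assms(2,3) by blast
    then obtain d where d: "d \<in> vset p ?D" "d \<in> vset p C" "d \<noteq> c" by blast
    have dA: "d \<in> ?A" using d vset_mono[OF D, of p] by blast
    obtain Q where Q: "Q \<subseteq> E - C" "bdry p Q = sym_diff {c} {d}"
      using reach_bdry[OF vset_comp_of[OF d(1)]] by blast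
    obtain P where P: "P \<subseteq> C" "bdry p P = sym_diff {c} {d}"
      using reach_bdry[OF edge_connected_reach[OF assms(6) _ d(2), of c]] c by auto
    have "sym_diff {c} {d} = {c, d}" using d(3) by blast
    then have "pair c d P Q" using P Q c dA d(3) unfolding pair_def by auto
    then show ?thesis by blast
  qed
  have uniq: "{c, d} = {c', d'}" if pr: "pair c d P Q" "pair c' d' P' Q'" for c d P Q c' d' P' Q'
  proof -
    have P: "P \<subseteq> C" "bdry p P = {c, d}" "Q \<subseteq> E - C" "bdry p Q = {c, d}"
      and P': "P' \<subseteq> C" "bdry p P' = {c', d'}" "Q' \<subseteq> E - C" "bdry p Q' = {c', d'}"
      using pr unfolding pair_def by simp_all
    have fin: "finite P" "finite Q" "finite P'" "finite Q'"
      using P P' assms(1,2) by (meson finite_Diff finite_subset)+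
    have "P \<inter> Q = {}" "P' \<inter> Q' = {}" using P(1,3) P'(1,3) by auto
    then have "bdry p (P \<union> Q) = {}" "bdry p (P' \<union> Q') = {}"
      by (simp_all add: bdry_Un_disjoint fin P(2,4) P'(2,4))
    moreover have "P \<union> Q \<subseteq> E" "P' \<union> Q' \<subseteq> E" using P(1,3) P'(1,3) assms(2) by auto
    moreover have "(P \<union> Q) \<inter> C = P" "(P' \<union> Q') \<inter> C = P'"
      "sym_diff (P \<union> Q) (P' \<union> Q') \<inter> C = sym_diff P P'"
      using P(1,3) P'(1,3) by auto
    ultimately have "bdry p P = {} \<or> bdry p P' = {} \<or> bdry p (sym_diff P P') = {}"
      using assms(5) unfolding sep2_def by metis
    then have "sym_diff {c, d} {c', d'} = {}"
      using bdry_sym_diff[OF fin(1,3), of p] P(2) P'(2) by auto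
    then show ?thesis by blast
  qed
  have "?A \<noteq> {}" using no1[OF assms(2-4)] sep1_vset[OF assms(1), of p C] by blast
  then obtain a b P Q where ab: "pair a b P Q" using ex by blast
  have "?A = {a, b}"
  proof
    show "?A \<subseteq> {a, b}" using ex uniq[OF ab] by blast
    show "{a, b} \<subseteq> ?A" using ab unfolding pair_def by blast
  qed
  with ab show ?thesis unfolding pair_def
    by (intro exI[of _ a] exI[of _ b] exI[of _ P] exI[of _ Q]) simp
qed

section \<open>Contraction and virtual edges\<close>

definition contract :: "('e \<Rightarrow> 'v \<times> 'v) \<Rightarrow> 'e \<Rightarrow> 'e \<Rightarrow> 'v \<times> 'v" where
  "contract p f e = (let m = \<lambda>v. if v = snd (p f) then fst (p f) else v in (m (fst (p e)), m (snd (p e))))"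

lemma mem_bdry_insert:
  "finite Z \<Longrightarrow> e \<notin> Z \<Longrightarrow> v \<in> bdry p (insert e Z) \<longleftrightarrow> (v \<in> bdry p Z) \<noteq> (v \<in> inc p e)"
  by (auto simp: bdry_insert)

text \<open>Merging the ends \<open>s\<close> and \<open>t\<close> of \<open>f\<close> adds their
  degrees, so the new boundary vanishes iff the old one is empty or \<open>{s, t}\<close>; in the
  second case \<open>f\<close> completes the set to an even one.\<close>

lemma bdry_contract:
  assumes "finite Z" "f \<notin> Z" "fst (p f) \<noteq> snd (p f)"
  shows "bdry (contract p f) Z = {} \<longleftrightarrow> bdry p Z = {} \<or> bdry p (insert f Z) = {}"
proof -
  define s t where "s = fst (p f)" and "t = snd (p f)"
  have st: "s \<noteq> t" using assms(3) by (simp add: s_def t_def)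
  have inc_c: "v \<in> inc (contract p f) e \<longleftrightarrow>
      (if v = t then False else if v = s then (s \<in> inc p e) \<noteq> (t \<in> inc p e) else v \<in> inc p e)" for v e
    using st by (auto simp: inc_def contract_def Let_def s_def[symmetric] t_def[symmetric])
  have *: "v \<in> bdry (contract p f) Z \<longleftrightarrow>
      (if v = t then False else if v = s then (s \<in> bdry p Z) \<noteq> (t \<in> bdry p Z) else v \<in> bdry p Z)" for v
    using assms(1)
  proof (induction Z rule: finite_induct)
    case (insert e Z)
    then show ?case using inc_c[of v e] by (simp add: mem_bdry_insert split: if_splits) blast
  qed simp
  have "inc p f = {s, t}" using st by (auto simp: inc_def s_def t_def)
  then have "bdry p (insert f Z) = {} \<longleftrightarrow> bdry p Z = {s, t}"
    using bdry_insert[OF assms(1,2), of p] by auto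
  moreover have "bdry (contract p f) Z = {} \<longleftrightarrow> bdry p Z = {} \<or> bdry p Z = {s, t}"
  proof
    assume "bdry (contract p f) Z = {}"
    then have e: "\<not> (if v = t then False else if v = s then (s \<in> bdry p Z) \<noteq> (t \<in> bdry p Z) else v \<in> bdry p Z)" for v
      using *[of v] by simp
    have "v = s \<or> v = t" if "v \<in> bdry p Z" for v using e[of v] that by metis
    then have "bdry p Z \<subseteq> {s, t}" by blast
    moreover have "s \<in> bdry p Z \<longleftrightarrow> t \<in> bdry p Z" using e[of s] st by simp
    ultimately show "bdry p Z = {} \<or> bdry p Z = {s, t}" by blast
  next
    assume "bdry p Z = {} \<or> bdry p Z = {s, t}"
    then have "v \<notin> bdry (contract p f) Z" for v
      using *[of v] by (elim disjE) (simp_all split: if_splits)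
    then show "bdry (contract p f) Z = {}" by blast
  qed
  ultimately show ?thesis by blast
qed

lemma same_even_contract:
  assumes "finite E" "f \<in> E" "same_even p q E" "fst (p f) \<noteq> snd (p f)" "fst (q f) \<noteq> snd (q f)"
  shows "same_even (contract p f) (contract q f) (E - {f})"
  unfolding same_even_def
proof (intro allI impI)
  fix Z assume Z: "Z \<subseteq> E - {f}"
  then have "finite Z" "f \<notin> Z" "Z \<subseteq> E" "insert f Z \<subseteq> E" using assms(1,2) finite_subset by auto
  then show "bdry (contract p f) Z = {} \<longleftrightarrow> bdry (contract q f) Z = {}"
    using bdry_contract[of Z f p] bdry_contract[of Z f q] assms(3-5) unfolding same_even_def by blast
qed

text \<open>\<open>Q\<close> is half of an even set: \<open>P\<close> on the other side completes
  it, and in \<open>q\<close> the completed set can cross only at \<open>a'\<close> and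
  \<open>b'\<close>. Used in both directions, this shows that virtual edges between the attachments
  close the same sets in \<open>p\<close> and in \<open>q\<close>.\<close>

lemma bdry_half:
  assumes "finite E" "same_even p q E" "C \<subseteq> E" "vset q C \<inter> vset q (E - C) \<subseteq> {a', b'}"
    and P: "P \<subseteq> E - C" "bdry p P = {a, b}" and Q: "Q \<subseteq> C" "bdry p Q = {a, b}"
  shows "bdry q Q = {a', b'}"
proof -
  have fin: "finite P" "finite Q" using P Q assms(1,3) by (meson finite_Diff finite_subset)+
  have PQ: "Q \<union> P \<subseteq> E" "(Q \<union> P) \<inter> C = Q" "Q \<inter> P = {}" using P(1) Q(1) assms(3) by auto
  have "bdry p (Q \<union> P) = {}" by (simp add: bdry_Un_disjoint[OF fin(2,1) PQ(3)] P(2) Q(2))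
  then have "bdry q (Q \<union> P) = {}" using assms(2) PQ(1) by (simp add: same_even_def)
  then have "bdry q Q \<subseteq> {a', b'}"
    using bdry_restrict_subset[OF assms(1) PQ(1), of q C] PQ(2) assms(4) by auto
  moreover have "bdry p Q \<noteq> {}" using Q(2) by simp
  then have "bdry q Q \<noteq> {}" using assms(2,3) Q(1) by (auto simp: same_even_def)
  ultimately show ?thesis using fin(2) by (intro bdry_subset_pair)
qed

lemma bdry_virtual_edge:
  assumes "finite Z" "e \<notin> Z" "a \<noteq> b"
  shows "bdry (p(e := (a, b))) (insert e Z) = {} \<longleftrightarrow> bdry p Z = {a, b}"
proof -
  have "bdry (p(e := (a, b))) Z = bdry p Z" using assms(2) by (intro bdry_cong) auto
  moreover have "inc (p(e := (a, b))) e = {a, b}" using assms(3) by (auto simp: inc_def)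
  ultimately show ?thesis using bdry_insert[OF assms(1,2), of "p(e := (a, b))"] by auto
qed

lemma same_even_virtual_edge:
  assumes "finite C" "same_even p q C" "e \<notin> C" "a \<noteq> b" "a' \<noteq> b'"
    and half: "\<And>Q. Q \<subseteq> C \<Longrightarrow> bdry p Q = {a, b} \<longleftrightarrow> bdry q Q = {a', b'}"
  shows "same_even (p(e := (a, b))) (q(e := (a', b'))) (insert e C)"
  unfolding same_even_def
proof (intro allI impI)
  fix Z assume Z: "Z \<subseteq> insert e C"
  show "bdry (p(e := (a, b))) Z = {} \<longleftrightarrow> bdry (q(e := (a', b'))) Z = {}"
  proof (cases "e \<in> Z")
    case True
    define Q where "Q = Z - {e}"
    have Q: "Z = insert e Q" "e \<notin> Q" "Q \<subseteq> C" using True Z by (auto simp: Q_def)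
    then have "finite Q" using assms(1) finite_subset by blast
    then show ?thesis unfolding Q(1)
      using bdry_virtual_edge[of Q e] Q(2,3) assms(4,5) half by metis
  next
    case False
    then have "Z \<subseteq> C" using Z by blast
    moreover have "bdry (p(e := (a, b))) Z = bdry p Z" "bdry (q(e := (a', b'))) Z = bdry q Z"
      using False by (auto intro!: bdry_cong)
    ultimately show ?thesis using assms(2) by (simp add: same_even_def)
  qed
qed

section \<open>Vertex stars in 3-connected graphs\<close>

definition star :: "('e \<Rightarrow> 'v \<times> 'v) \<Rightarrow> 'e set \<Rightarrow> 'v \<Rightarrow> 'e set" where
  "star p E v = {e \<in> E. v \<in> inc p e}"

lemma star_subset: "star p E v \<subseteq> E"
  by (auto simp: star_def)

lemma star_orthogonal:
  assumes "Z \<subseteq> E" "bdry p Z = {}" shows "even (card (Z \<inter> star p E v))"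
proof -
  have "Z \<inter> star p E v = {e \<in> Z. v \<in> inc p e}" using assms(1) by (auto simp: star_def)
  then show ?thesis using assms(2) by (auto simp: bdry_def)
qed

text \<open>A loop is even by itself, so the trace of any even set on it is even. Being a loop is
  thus a property of the even sets, and it produces a 1-separation.\<close>

lemma inc_nonempty_if_no_sep1:
  assumes "same_even p q E" "e \<in> E" "\<not> sep1 p E {e}"
  shows "inc q e \<noteq> {}"
proof
  assume "inc q e = {}"
  then have "bdry q {e} = {}" by simp
  moreover have "{e} \<subseteq> E" using assms(2) by blast
  ultimately have "bdry p {e} = {}" using assms(1) unfolding same_even_def by blast
  then have "bdry p (Z \<inter> {e}) = {}" for Z by (cases "e \<in> Z") auto
  then show False using assms(3) by (simp add: sep1_def)
qed

locale connected3 =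
  fixes p :: "'e \<Rightarrow> 'v \<times> 'v" and E :: "'e set"
  assumes fin: "finite E" and card_E: "2 \<le> card E"
    and no1: "D \<subseteq> E \<Longrightarrow> D \<noteq> {} \<Longrightarrow> D \<noteq> E \<Longrightarrow> \<not> sep1 p E D"
    and no2: "D \<subseteq> E \<Longrightarrow> 2 \<le> card D \<Longrightarrow> 2 \<le> card (E - D) \<Longrightarrow> \<not> sep2 p E D"
begin

lemma no1_singleton: "e \<in> E \<Longrightarrow> \<not> sep1 p E {e}"
  using no1[of "{e}"] card_E by (cases "E = {e}") auto

lemma no_loop:
  assumes "e \<in> E" shows "fst (p e) \<noteq> snd (p e)"
  using inc_nonempty_if_no_sep1[of p p E e] no1_singleton[OF assms] assms
  by (simp add: same_even_def inc_empty_iff)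

lemma inc_eq: "e \<in> E \<Longrightarrow> inc p e = {fst (p e), snd (p e)}"
  using no_loop[of e] by (auto simp: inc_def)

lemma vset_singleton: "e \<in> E \<Longrightarrow> vset p {e} = inc p e"
  using inc_eq by (simp add: vset_def)

lemma vset_iff_star: "v \<in> vset p C \<longleftrightarrow> star p C v \<noteq> {}" if "C \<subseteq> E"
  using that inc_eq by (force simp: vset_def star_def)

text \<open>A proper nonempty part of the star orthogonal to the cycle space is a cut. The edges
  touching its side away from \<open>v\<close> would meet all other edges only at \<open>v\<close>,
  which is a 1-separation. Orthogonality, rather than being a cut of \<open>p\<close>, is assumed
  because it can be supplied by another graph with the same even sets.\<close>

lemma star_minimal:
  assumes "D \<subseteq> star p E v" "D \<noteq> {}"
    and orth: "\<And>Z. Z \<subseteq> E \<Longrightarrow> bdry p Z = {} \<Longrightarrow> even (card (Z \<inter> D))"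
  shows "D = star p E v"
proof (rule ccontr)
  assume neq: "D \<noteq> star p E v"
  have DE: "D \<subseteq> E" using assms(1) star_subset by (rule order.trans)
  obtain T0 where T0: "is_cut p E T0 D" using orthogonal_is_cut[OF fin DE orth] by blast
  obtain T where T: "is_cut p E T D" "v \<notin> T"
    using T0 is_cut_Compl[OF T0] by (cases "v \<in> T0") auto
  define C where "C = {g \<in> E. fst (p g) \<in> T \<or> snd (p g) \<in> T}"
  have "vset p C \<inter> vset p (E - C) \<subseteq> {v}"
  proof
    fix z assume z: "z \<in> vset p C \<inter> vset p (E - C)"
    then obtain g where g: "g \<in> E" "g \<in> C" "z = fst (p g) \<or> z = snd (p g)" by (auto elim!: vsetE simp: C_def)
    have "z \<notin> T" using z by (auto elim!: vsetE simp: C_def)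
    then have "g \<in> D" using g T(1) by (auto simp: is_cut_def C_def)
    then have "v \<in> inc p g" using assms(1) by (auto simp: star_def)
    then show "z \<in> {v}" using inc_eq[OF g(1)] g \<open>z \<notin> T\<close> T(2) by (auto simp: C_def)
  qed
  then have "sep1 p E C" by (rule sep1_vset[OF fin])
  moreover have "C \<noteq> {}" using assms(2) T(1) by (auto simp: is_cut_def C_def)
  moreover have "C \<noteq> E"
  proof -
    obtain h where h: "h \<in> E" "v \<in> inc p h" "h \<notin> D" using neq assms(1) by (auto simp: star_def)
    then have "h \<notin> C" using T inc_eq[OF h(1)] by (auto simp: is_cut_def C_def)
    then show ?thesis using h(1) by blast
  qed
  ultimately show False using no1[of C] by (auto simp: C_def)
qed

text \<open>An end of \<open>e\<close> on no other edge leaves one attachment vertex at most, so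
  \<open>{e}\<close> would be a 1-separation.\<close>

lemma no_pendant:
  assumes "e \<in> E" "x \<in> inc p e" "x \<notin> vset p (E - {e})" shows False
proof -
  obtain y where "inc p e \<subseteq> {x, y}"
    using that[of "fst (p e)"] that[of "snd (p e)"] inc_eq[OF assms(1)] assms(2) by auto
  then have "vset p {e} \<inter> vset p (E - {e}) \<subseteq> {y}"
    unfolding vset_singleton[OF assms(1)] using assms(3) by blast
  then have "sep1 p E {e}" by (rule sep1_vset[OF fin])
  then show False using no1_singleton[OF assms(1)] by blast
qed

text \<open>A 1-separation of the graph minus a vertex \<open>v\<close> yields a cut vertex \<open>w\<close> there, hence a
  2-separation at \<open>{v, w}\<close>, unless one of the sides is a pendant edge.\<close>

lemma star_deletion_connected:
  assumes "X \<subseteq> E - star p E v" "X \<noteq> {}" "X \<noteq> E - star p E v"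
  shows "\<not> sep1 p (E - star p E v) X"
proof
  define F where "F = E - star p E v"
  assume "sep1 p (E - star p E v) X"
  then have X: "X \<subseteq> F" "X \<noteq> {} \<and> sep1 p F X" using assms by (simp_all add: F_def)
  have finF: "finite F" and FE: "F \<subseteq> E" using fin by (auto simp: F_def)
  obtain C where C: "C \<subseteq> F" "C \<noteq> {} \<and> sep1 p F C" "\<And>D. D \<subset> C \<Longrightarrow> \<not> (D \<noteq> {} \<and> sep1 p F D)"
    by (rule minimal_subset[OF finF X(1), of "\<lambda>X. X \<noteq> {} \<and> sep1 p F X", OF X(2)]) blast
  have "C \<noteq> F" using C(3)[of X] X assms(3) by (auto simp: F_def)
  have conn: "edge_connected p C"
    by (rule edge_connected_if_minimal_sep1[OF finF C(1) \<open>C \<noteq> F\<close>]) (use C in auto)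
  then obtain Y w where Y: "Y \<subseteq> F - C" "Y \<noteq> {}" "vset p Y \<inter> vset p (F - Y) \<subseteq> {w}"
    using sep1_block[OF finF C(1) \<open>C \<noteq> F\<close> conjunct2[OF C(2)] conn] by (elim exE conjE)
  have v_F: "v \<notin> vset p F"
    using vset_iff_star[OF FE, of v] by (auto simp: star_def F_def)
  have YF: "Y \<subseteq> F" using Y(1) by blast
  then have v_Y: "v \<notin> vset p Y" using v_F vset_mono[OF YF, of p] by blast
  \<comment> \<open>Adding to \<open>Y\<close> the edges from \<open>v\<close> to vertices of
    \<open>Y\<close> other than \<open>w\<close> yields a side that meets the remaining edges only
    at \<open>v\<close> and \<open>w\<close>.\<close>
  define H where "H = {g \<in> star p E v. inc p g \<inter> (vset p Y - {w}) \<noteq> {}}"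
  let ?E1 = "Y \<union> H"
  let ?E2 = "E - ?E1"
  have star_end: "inc p g = {v, x}" if "g \<in> star p E v" "x = fst (p g) \<or> x = snd (p g)" "x \<noteq> v" for g x
  proof -
    have "g \<in> E" "v \<in> inc p g" using that(1) by (auto simp: star_def)
    then show ?thesis using inc_eq[of g] that(2,3) by auto
  qed
  have v1: "x \<in> vset p Y" if x: "x \<in> vset p ?E1" "x \<noteq> v" for x
  proof -
    from x(1) obtain g where g: "g \<in> ?E1" "x = fst (p g) \<or> x = snd (p g)" by (rule vsetE)
    show ?thesis
    proof (cases "g \<in> Y")
      case True then show ?thesis using g(2) by (rule vsetI)
    next
      case False
      then have "g \<in> H" using g(1) by blast
      then show ?thesis using star_end[OF _ g(2) x(2)] v_Y by (auto simp: H_def)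
    qed
  qed
  have v2: "x \<notin> vset p Y" if x: "x \<in> vset p ?E2" "x \<noteq> v" "x \<noteq> w" for x
  proof -
    from x(1) obtain g where g: "g \<in> ?E2" "x = fst (p g) \<or> x = snd (p g)" by (rule vsetE)
    show ?thesis
    proof (cases "g \<in> star p E v")
      case True
      then have "inc p g \<inter> (vset p Y - {w}) = {}" using g(1) by (auto simp: H_def)
      then show ?thesis using star_end[OF True g(2) x(2)] x(3) by auto
    next
      case False
      then have "g \<in> F - Y" using g(1) by (auto simp: F_def)
      then have "x \<in> vset p (F - Y)" using g(2) by (rule vsetI)
      then show ?thesis using Y(3) x(3) by blast
    qed
  qed
  have E1: "?E1 \<subseteq> E" using YF FE by (auto simp: H_def star_def)
  have pick: "\<exists>x\<in>inc p e. x \<noteq> w \<and> x \<noteq> v \<and> x \<in> vset p {e}" if "e \<in> F" for e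
  proof -
    have e: "e \<in> E" using that FE by blast
    have "vset p {e} \<subseteq> vset p F" using that by (intro vset_mono) blast
    then have "v \<notin> vset p {e}" using v_F by blast
    moreover have "vset p {e} = inc p e" by (rule vset_singleton[OF e])
    ultimately show ?thesis using inc_eq[OF e] no_loop[OF e] by auto
  qed
  have "vset p ?E1 \<inter> vset p ?E2 \<subseteq> {v, w}" using v1 v2 by blast
  then have "sep2 p E ?E1" by (rule sep2_vset[OF fin])
  then have "\<not> (2 \<le> card ?E1 \<and> 2 \<le> card ?E2)" using no2[OF E1] by blast
  then consider "card ?E1 \<le> 1" | "card ?E2 \<le> 1" by linarith
  then show False
  proof cases
    case 1
    obtain e where e: "e \<in> Y" using Y(2) by blast
    have "finite ?E1" using E1 fin finite_subset by blast
    then have "?E1 = {e}" using 1 e card_le_Suc0_iff_eq[of ?E1] by auto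
    then have Ye: "Y = {e}" "?E2 = E - {e}" using e by auto
    obtain x where x: "x \<in> inc p e" "x \<noteq> w" "x \<noteq> v" "x \<in> vset p {e}" using pick e YF by blast
    have "x \<notin> vset p (E - {e})" using v2[of x] x Ye by auto
    then show False using no_pendant[OF _ x(1)] e YF FE by blast
  next
    case 2
    obtain e where e: "e \<in> F" "e \<notin> Y" using C(1,2) Y(1) by blast
    have eH: "e \<notin> H" "e \<in> E" using e by (auto simp: F_def H_def)
    have "finite ?E2" using fin by blast
    then have "?E2 = {e}" using 2 e eH card_le_Suc0_iff_eq[of ?E2] by auto
    then have E1e: "E - {e} = ?E1" using E1 by blast
    obtain x where x: "x \<in> inc p e" "x \<noteq> w" "x \<noteq> v" "x \<in> vset p {e}" using pick e(1) by blast
    have "vset p {e} \<subseteq> vset p (F - Y)" using e by (intro vset_mono) blast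
    then have "x \<notin> vset p Y" using x Y(3) by blast
    then have "x \<notin> vset p (E - {e})" using v1[of x] x(3) E1e by auto
    then show False using no_pendant[OF eH(2) x(1)] by blast
  qed
qed

text \<open>The star is orthogonal to the even sets, hence a cut of \<open>q\<close>; its complement
  is connected as a matroid, so all other edges lie on one side of that cut. An end \<open>x\<close>
  of a cut edge on the opposite side has its star inside the cut, and \<open>star_minimal\<close>
  gives equality.\<close>

lemma star_corresponds:
  assumes "same_even p q E" "v \<in> vset p E"
  shows "\<exists>v'. star q E v' = star p E v"
proof -
  let ?D = "star p E v"
  have ne: "?D \<noteq> {}" using vset_iff_star assms(2) by blast
  have "even (card (Z \<inter> ?D))" if "Z \<subseteq> E" "bdry q Z = {}" for Z
    using star_orthogonal[OF that(1), of p v] that assms(1) by (auto simp: same_even_def)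
  from orthogonal_is_cut[OF fin star_subset this]
  obtain S where S: "is_cut q E S ?D" by blast
  let ?X = "{g \<in> E - ?D. fst (q g) \<in> S}"
  have side: "fst (q g) \<in> S \<longleftrightarrow> snd (q g) \<in> S" if "g \<in> E - ?D" for g
    using S that by (auto simp: is_cut_def)
  have "vset q ?X \<inter> vset q (E - ?D - ?X) = {}"
    using side by (auto elim!: vsetE)
  then have "sep1 q (E - ?D) ?X" using sep1_vset[of "E - ?D" q ?X undefined] fin by simp
  moreover have "same_even q p (E - ?D)"
    by (rule same_even_mono[OF same_even_sym[OF assms(1)]]) blast
  ultimately have "sep1 p (E - ?D) ?X" by (rule sep1_same_even[rotated])
  then have "?X = {} \<or> ?X = E - ?D" using star_deletion_connected[of ?X v] by blast
  then obtain T where T: "is_cut q E T ?D" "\<And>g. g \<in> E - ?D \<Longrightarrow> fst (q g) \<notin> T \<and> snd (q g) \<notin> T"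
  proof
    assume "?X = {}" then show thesis using that[of S] S side by blast
  next
    assume "?X = E - ?D" then show thesis using that[of "- S"] is_cut_Compl[OF S] side by blast
  qed
  obtain g where g: "g \<in> ?D" using ne by blast
  then have "(fst (q g) \<in> T) \<noteq> (snd (q g) \<in> T)" using T(1) by (simp add: is_cut_def)
  then have "\<exists>x. x \<in> T \<and> x \<in> inc q g"
    by (cases "fst (q g) \<in> T")
      (auto simp: inc_def intro: exI[of _ "fst (q g)"] exI[of _ "snd (q g)"])
  then obtain x where x: "x \<in> T" "x \<in> inc q g" by blast
  have "star q E x \<subseteq> ?D"
    using T(2) x(1) inc_subset[of q] by (fastforce simp: star_def)
  moreover have "star q E x \<noteq> {}" using g x(2) by (auto simp: star_def)
  moreover have "even (card (Z \<inter> star q E x))" if "Z \<subseteq> E" "bdry p Z = {}" for Z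
    using star_orthogonal[OF that(1), of q x] that assms(1) by (auto simp: same_even_def)
  ultimately have "star q E x = ?D" by (rule star_minimal)
  then show ?thesis ..
qed

text \<open>All edges of a star common to two vertices join these two. The star then shares no
  vertex with the rest, so it is all of \<open>E\<close>, and two edges of \<open>E\<close> are
  parallel.\<close>

lemma star_inj:
  assumes "u \<in> vset p E" "star p E u = star p E v"
    and no_parallel: "\<And>e f. e \<in> E \<Longrightarrow> f \<in> E \<Longrightarrow> e \<noteq> f \<Longrightarrow> inc p e \<noteq> inc p f"
  shows "u = v"
proof (rule ccontr)
  assume neq: "u \<noteq> v"
  let ?D = "star p E u"
  have D: "inc p e = {u, v}" if "e \<in> ?D" for e
  proof -
    have "e \<in> E" "u \<in> inc p e" using that by (auto simp: star_def)
    moreover have "v \<in> inc p e" using that assms(2) by (auto simp: star_def)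
    ultimately show ?thesis using neq inc_eq[of e] by auto
  qed
  have "?D \<noteq> {}" using vset_iff_star assms(1) by blast
  have "vset p ?D \<inter> vset p (E - ?D) = {}"
  proof -
    { fix z assume z: "z \<in> vset p ?D" "z \<in> vset p (E - ?D)"
      then obtain g where g: "g \<in> ?D" "z = fst (p g) \<or> z = snd (p g)" by (auto elim!: vsetE)
      have "g \<in> E" using g(1) by (auto simp: star_def)
      then have "z = u \<or> z = v" using D[OF g(1)] g(2) inc_eq[of g] by auto
      then have "star p (E - ?D) z = {}" using assms(2) by (auto simp: star_def)
      then have False using z(2) vset_iff_star[of "E - ?D" z] by auto }
    then show ?thesis by blast
  qed
  then have "sep1 p E ?D" using sep1_vset[OF fin, of p ?D u] by simp
  then have "?D = E" using no1[of ?D] star_subset[of p E u] \<open>?D \<noteq> {}\<close> by blast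
  have "\<exists>e\<in>E. \<exists>f\<in>E. e \<noteq> f"
    using card_E card_le_Suc0_iff_eq[OF fin] by fastforce
  then show False using D no_parallel \<open>?D = E\<close> by metis
qed

text \<open>Whitney's theorem for 3-connected graphs: the vertex stars are determined by the even sets.\<close>

lemma isomorphic_if_same_even:
  assumes "same_even p q E"
    and no_parallel: "\<And>e f. e \<in> E \<Longrightarrow> f \<in> E \<Longrightarrow> e \<noteq> f \<Longrightarrow> inc p e \<noteq> inc p f"
  obtains m where "inj_on m (vset p E)"
    "\<And>e. e \<in> E \<Longrightarrow> q e = (m (fst (p e)), m (snd (p e))) \<or> q e = (m (snd (p e)), m (fst (p e)))"
proof -
  define m where "m v = (SOME v'. star q E v' = star p E v)" for v
  have m: "star q E (m v) = star p E v" if "v \<in> vset p E" for v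
    unfolding m_def by (rule someI_ex[OF star_corresponds[OF assms(1) that]])
  have inj: "inj_on m (vset p E)"
  proof (rule inj_onI)
    fix u v assume uv: "u \<in> vset p E" "v \<in> vset p E" "m u = m v"
    then have "star p E u = star p E v" using m by metis
    then show "u = v" using star_inj[OF uv(1)] no_parallel by blast
  qed
  have "q e = (m (fst (p e)), m (snd (p e))) \<or> q e = (m (snd (p e)), m (fst (p e)))" if e: "e \<in> E" for e
  proof -
    let ?x = "fst (p e)" and ?y = "snd (p e)"
    have xy: "?x \<in> vset p E" "?y \<in> vset p E" using e by (auto intro: vsetI)
    have "e \<in> star p E ?x" "e \<in> star p E ?y" using e inc_eq[OF e] by (auto simp: star_def)
    then have "m ?x \<in> inc q e" "m ?y \<in> inc q e" using m xy by (auto simp: star_def)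
    moreover have "m ?x \<noteq> m ?y" using inj_onD[OF inj _ xy] no_loop[OF e] by blast
    ultimately show ?thesis using inc_subset[of q e] by (cases "q e") auto
  qed
  with inj that show thesis by blast
qed

end

section \<open>Averages over colourings\<close>

definition avg1 :: "'c set \<Rightarrow> 'v \<Rightarrow> (('v \<Rightarrow> 'c) \<Rightarrow> 'a::field_char_0) \<Rightarrow> ('v \<Rightarrow> 'c) \<Rightarrow> 'a" where
  "avg1 K v f \<phi> = (\<Sum>x\<in>K. f (\<phi>(v := x))) / of_nat (card K)"

text \<open>\<open>avg1\<close> integrates out one vertex and returns a function of total colourings
  again. It is commutative and idempotent, so the fold makes sense and averaging twice over a vertex
  is harmless. Averages over a finite nonempty \<open>K\<close>, unlike sums, do not change when
  idle vertices are added, so isolated vertices never matter.\<close>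

definition avg :: "'c set \<Rightarrow> 'v set \<Rightarrow> (('v \<Rightarrow> 'c) \<Rightarrow> 'a::field_char_0) \<Rightarrow> ('v \<Rightarrow> 'c) \<Rightarrow> 'a" where
  "avg K V f = Finite_Set.fold (avg1 K) f V"

definition supported :: "'v set \<Rightarrow> (('v \<Rightarrow> 'c) \<Rightarrow> 'a) \<Rightarrow> bool" where
  "supported S f \<longleftrightarrow> (\<forall>\<phi> \<psi>. (\<forall>v\<in>S. \<phi> v = \<psi> v) \<longrightarrow> f \<phi> = f \<psi>)"

lemma avg1_commute: "avg1 K u (avg1 K v f) = avg1 K v (avg1 K u f)"
proof (cases "u = v")
  case False
  show ?thesis
  proof
    fix \<phi>
    have "(\<Sum>x\<in>K. \<Sum>y\<in>K. f (\<phi>(u := x, v := y))) = (\<Sum>y\<in>K. \<Sum>x\<in>K. f (\<phi>(v := y, u := x)))"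
      using False by (subst sum.swap) (simp add: fun_upd_twist)
    then show "avg1 K u (avg1 K v f) \<phi> = avg1 K v (avg1 K u f) \<phi>"
      by (simp add: avg1_def sum_divide_distrib[symmetric])
  qed
qed simp

lemma avg1_idem: "avg1 K v (avg1 K v f) = avg1 K v f"
  by (rule ext) (simp add: avg1_def)

interpretation avg1: comp_fun_idem "avg1 K"
  by standard (simp_all add: comp_def fun_eq_iff avg1_commute avg1_idem)

lemma avg_empty [simp]: "avg K {} f = f"
  by (simp add: avg_def)

lemma avg_insert: "finite V \<Longrightarrow> avg K (insert v V) f = avg1 K v (avg K V f)"
  by (simp add: avg_def avg1.fold_insert_idem)

lemma avg_Un: "finite U \<Longrightarrow> finite V \<Longrightarrow> avg K (U \<union> V) f = avg K U (avg K V f)"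
  by (induction U rule: finite_induct) (simp_all add: avg_insert)

lemma supportedD: "supported S f \<Longrightarrow> (\<And>v. v \<in> S \<Longrightarrow> \<phi> v = \<psi> v) \<Longrightarrow> f \<phi> = f \<psi>"
  by (auto simp: supported_def)

lemma supported_mono: "supported S f \<Longrightarrow> S \<subseteq> T \<Longrightarrow> supported T f"
  by (auto simp: supported_def)

lemma supported_mult: "supported S f \<Longrightarrow> supported S g \<Longrightarrow> supported S (\<lambda>\<phi>. f \<phi> * g \<phi>)"
  unfolding supported_def by metis

lemma supported_avg1:
  assumes "supported S f" shows "supported (S - {v}) (avg1 K v f)"
  unfolding supported_def
proof (intro allI impI)
  fix \<phi> \<psi> :: "'a \<Rightarrow> 'b" assume "\<forall>u\<in>S - {v}. \<phi> u = \<psi> u"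
  then have "f (\<phi>(v := x)) = f (\<psi>(v := x))" for x
    using assms unfolding supported_def by simp
  then show "avg1 K v f \<phi> = avg1 K v f \<psi>" by (simp add: avg1_def)
qed

lemma supported_avg: "finite V \<Longrightarrow> supported S f \<Longrightarrow> supported (S - V) (avg K V f)"
proof (induction V rule: finite_induct)
  case (insert v V)
  then show ?case using supported_avg1[of "S - V" "avg K V f" v K]
    by (simp add: avg_insert Diff_insert[of S v V])
qed simp

lemma avg_eval: "finite V \<Longrightarrow> supported V f \<Longrightarrow> avg K V f \<phi> = avg K V f \<psi>"
  using supported_avg[of V V f K] by (auto simp: supported_def)

lemma avg1_mult_idle:
  assumes "supported S f" "v \<notin> S"
  shows "avg1 K v (\<lambda>\<phi>. f \<phi> * g \<phi>) = (\<lambda>\<phi>. f \<phi> * avg1 K v g \<phi>)"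
proof
  fix \<phi>
  have "f (\<phi>(v := x)) = f \<phi>" for x
    by (rule supportedD[OF assms(1)]) (use assms(2) in auto)
  then show "avg1 K v (\<lambda>\<phi>. f \<phi> * g \<phi>) \<phi> = f \<phi> * avg1 K v g \<phi>"
    by (simp add: avg1_def sum_distrib_left)
qed

text \<open>Factors that do not see the averaged vertices act as scalars; the gluing formulas rest
  on this.\<close>

lemma avg_mult_idle:
  assumes "finite V" "supported S f" "S \<inter> V = {}"
  shows "avg K V (\<lambda>\<phi>. f \<phi> * g \<phi>) = (\<lambda>\<phi>. f \<phi> * avg K V g \<phi>)"
  using assms(1,3)
  by (induction V rule: finite_induct) (simp_all add: avg_insert avg1_mult_idle[OF assms(2)])

lemma avg_scale: "finite V \<Longrightarrow> avg K V (\<lambda>\<phi>. c * g \<phi>) \<phi> = c * avg K V g \<phi>"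
  using avg_mult_idle[of V "{}" "\<lambda>_. c" K g] by (simp add: supported_def)

lemma avg_sum:
  assumes "finite V"
  shows "avg K V (\<lambda>\<phi>. \<Sum>i\<in>I. f i \<phi>) \<phi> = (\<Sum>i\<in>I. avg K V (f i) \<phi>)"
  using assms
proof (induction V arbitrary: \<phi> rule: finite_induct)
  case (insert v V)
  have "avg K (insert v V) (\<lambda>\<phi>. \<Sum>i\<in>I. f i \<phi>) \<phi>
      = (\<Sum>x\<in>K. \<Sum>i\<in>I. avg K V (f i) (\<phi>(v := x))) / of_nat (card K)"
    unfolding avg_insert[OF insert.hyps(1)] avg1_def insert.IH ..
  also have "\<dots> = (\<Sum>i\<in>I. avg K (insert v V) (f i) \<phi>)"
    unfolding avg_insert[OF insert.hyps(1)] avg1_def sum_divide_distrib[symmetric]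
    by (subst sum.swap) (rule refl)
  finally show ?case .
qed simp

text \<open>Invariance and symmetry of matrices are only known for colours in \<open>K\<close>. It
  is enough to compare integrands on \<open>K\<close>-valued colourings, since averaging only
  inserts values from \<open>K\<close>.\<close>

lemma avg_cong:
  assumes "finite V" "\<And>\<phi>. range \<phi> \<subseteq> K \<Longrightarrow> f \<phi> = g \<phi>" "range \<phi> \<subseteq> K"
  shows "avg K V f \<phi> = avg K V g \<phi>"
  using assms(1,3)
proof (induction V arbitrary: \<phi> rule: finite_induct)
  case empty then show ?case using assms(2) by simp
next
  case (insert v V)
  have "avg K V f (\<phi>(v := x)) = avg K V g (\<phi>(v := x))" if "x \<in> K" for x
    by (rule insert.IH) (use insert.prems that in \<open>simp add: image_subset_iff\<close>)
  then show ?case using insert by (simp add: avg_insert avg1_def)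
qed

lemma avg_comp_bij:
  assumes "finite V" "bij_betw \<gamma> K K"
  shows "avg K V f (\<gamma> \<circ> \<phi>) = avg K V (\<lambda>\<psi>. f (\<gamma> \<circ> \<psi>)) \<phi>"
  using assms(1)
proof (induction V arbitrary: \<phi> rule: finite_induct)
  case (insert v V)
  have "(\<Sum>x\<in>K. avg K V f ((\<gamma> \<circ> \<phi>)(v := x))) = (\<Sum>x\<in>K. avg K V f ((\<gamma> \<circ> \<phi>)(v := \<gamma> x)))"
    using sum.reindex_bij_betw[OF assms(2), symmetric] by simp
  also have "\<dots> = (\<Sum>x\<in>K. avg K V f (\<gamma> \<circ> \<phi>(v := x)))"
    by (simp add: fun_upd_comp)
  finally show ?case using insert by (simp add: avg_insert avg1_def fun_upd_def comp_def)
qed simp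

lemma avg_rename:
  assumes "finite V" "inj_on m V" "supported V f"
  shows "avg K (m ` V) (\<lambda>\<phi>. f (\<phi> \<circ> m)) \<phi> = avg K V f (\<phi> \<circ> m)"
proof -
  have "avg K (m ` U) (\<lambda>\<phi>. f (\<phi> \<circ> m)) \<phi> = avg K U f (\<phi> \<circ> m)" if "U \<subseteq> V" for U \<phi>
    using finite_subset[OF that assms(1)] that
  proof (induction U arbitrary: \<phi> rule: finite_induct)
    case (insert v U)
    have "avg K U f (\<phi>(m v := x) \<circ> m) = avg K U f ((\<phi> \<circ> m)(v := x))" for x
    proof (rule supportedD[OF supported_mono[OF supported_avg[OF insert.hyps(1) assms(3)]]])
      fix u assume "u \<in> V"
      then show "(\<phi>(m v := x) \<circ> m) u = ((\<phi> \<circ> m)(v := x)) u"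
        using insert.prems inj_onD[OF assms(2), of u v] by auto
    qed blast
    then show ?case using insert by (simp add: avg_insert avg1_def fun_upd_def comp_def)
  qed simp
  then show ?thesis by simp
qed

text \<open>The link to sums over extensional maps, as in \<open>hom_count\<close>;
  \<open>override_on\<close> supplies the colours outside \<open>V\<close>.\<close>

lemma avg_PiE:
  fixes f :: "('v \<Rightarrow> 'c) \<Rightarrow> 'a::field_char_0"
  assumes "finite V" "finite K" "K \<noteq> {}"
  shows "of_nat (card K) ^ card V * avg K V f \<phi> = (\<Sum>\<psi>\<in>V \<rightarrow>\<^sub>E K. f (override_on \<phi> \<psi> V))"
  using assms(1)
proof (induction V arbitrary: \<phi> rule: finite_induct)
  case (insert v V)
  have K: "of_nat (card K) \<noteq> (0::'a)" using assms by simp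
  have "(\<Sum>\<psi>\<in>insert v V \<rightarrow>\<^sub>E K. f (override_on \<phi> \<psi> (insert v V)))
      = (\<Sum>(x, \<psi>)\<in>K \<times> (V \<rightarrow>\<^sub>E K). f (override_on \<phi> (\<psi>(v := x)) (insert v V)))"
    unfolding PiE_insert_eq
    by (subst sum.reindex[OF inj_combinator[OF insert.hyps(2)]]) (auto simp: case_prod_unfold)
  also have "\<dots> = (\<Sum>x\<in>K. \<Sum>\<psi>\<in>V \<rightarrow>\<^sub>E K. f (override_on (\<phi>(v := x)) \<psi> V))"
    unfolding sum.cartesian_product
    by (intro sum.cong refl) (auto intro!: arg_cong[of _ _ f] sum.cong ext simp: override_on_def insert.hyps(2) intro: PiE_mem)
  also have "\<dots> = (\<Sum>x\<in>K. of_nat (card K) ^ card V * avg K V f (\<phi>(v := x)))"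
    unfolding insert.IH ..
  also have "\<dots> = of_nat (card K) ^ card (insert v V) * avg K (insert v V) f \<phi>"
    unfolding avg_insert[OF insert.hyps(1)] avg1_def using insert.hyps K
    by (simp add: sum_distrib_left[symmetric])
  finally show ?case by simp
qed (simp add: override_on_def)

definition ewt :: "('e \<Rightarrow> 'v \<times> 'v) \<Rightarrow> ('e \<Rightarrow> 'c \<Rightarrow> 'c \<Rightarrow> 'a::field_char_0) \<Rightarrow> 'e set \<Rightarrow> ('v \<Rightarrow> 'c) \<Rightarrow> 'a" where
  "ewt p W E \<phi> = (\<Prod>e\<in>E. W e (\<phi> (fst (p e))) (\<phi> (snd (p e))))"

lemma supported_ewt: "supported (vset p E) (ewt p W E)"
  unfolding supported_def ewt_def by (auto intro!: prod.cong simp: vset_def)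

lemma ewt_Un: "finite C \<Longrightarrow> finite D \<Longrightarrow> C \<inter> D = {} \<Longrightarrow> ewt p W (C \<union> D) \<phi> = ewt p W C \<phi> * ewt p W D \<phi>"
  by (simp add: ewt_def prod.union_disjoint)

lemma ewt_insert: "finite C \<Longrightarrow> e \<notin> C \<Longrightarrow>
    ewt p W (insert e C) \<phi> = W e (\<phi> (fst (p e))) (\<phi> (snd (p e))) * ewt p W C \<phi>"
  by (simp add: ewt_def)

lemma ewt_cong: "(\<And>e. e \<in> C \<Longrightarrow> p e = q e) \<Longrightarrow> (\<And>e. e \<in> C \<Longrightarrow> W e = U e) \<Longrightarrow> ewt p W C = ewt q U C"
  unfolding ewt_def by (auto intro!: prod.cong)

section \<open>Invariant matrices and densities\<close>

locale colours =
  fixes K :: "'c set" and \<Gamma> :: "('c \<Rightarrow> 'c) set"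
  assumes finite_K: "finite K" and K_ne: "K \<noteq> {}"
    and bij: "\<gamma> \<in> \<Gamma> \<Longrightarrow> bij_betw \<gamma> K K"
    and generous: "x \<in> K \<Longrightarrow> y \<in> K \<Longrightarrow> \<exists>\<gamma>\<in>\<Gamma>. \<gamma> x = y \<and> \<gamma> y = x"
begin

definition \<phi>0 :: "'v \<Rightarrow> 'c" where "\<phi>0 = (\<lambda>_. SOME x. x \<in> K)"

lemma range_\<phi>0: "range \<phi>0 \<subseteq> K"
  unfolding \<phi>0_def using K_ne by (auto simp: some_in_eq)

lemma card_K: "of_nat (card K) \<noteq> (0::'a::field_char_0)"
  using finite_K K_ne by simp

definition inv_matrix :: "('c \<Rightarrow> 'c \<Rightarrow> 'a::field_char_0) \<Rightarrow> bool" where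
  "inv_matrix M \<longleftrightarrow> (\<forall>\<gamma>\<in>\<Gamma>. \<forall>x\<in>K. \<forall>y\<in>K. M (\<gamma> x) (\<gamma> y) = M x y)"

lemma inv_matrixD: "inv_matrix M \<Longrightarrow> \<gamma> \<in> \<Gamma> \<Longrightarrow> x \<in> K \<Longrightarrow> y \<in> K \<Longrightarrow> M (\<gamma> x) (\<gamma> y) = M x y"
  by (auto simp: inv_matrix_def)

text \<open>Here both halves of the swap enter; \<open>avg_ewt_one_vertex\<close> uses only that one
  colour can be moved to the other.\<close>

lemma inv_matrix_sym: "inv_matrix M \<Longrightarrow> x \<in> K \<Longrightarrow> y \<in> K \<Longrightarrow> M x y = M y x"
  using generous[of x y] inv_matrixD[of M] by metis

lemma \<Gamma>_eq_iff: "\<gamma> \<in> \<Gamma> \<Longrightarrow> x \<in> K \<Longrightarrow> y \<in> K \<Longrightarrow> \<gamma> x = \<gamma> y \<longleftrightarrow> x = y"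
  using bij bij_betw_imp_inj_on inj_on_eq_iff by metis

definition mmult :: "('c \<Rightarrow> 'c \<Rightarrow> 'a::field_char_0) \<Rightarrow> ('c \<Rightarrow> 'c \<Rightarrow> 'a) \<Rightarrow> 'c \<Rightarrow> 'c \<Rightarrow> 'a" where
  "mmult M N x y = (\<Sum>z\<in>K. M x z * N z y)"

lemma inv_matrix_mmult:
  assumes "inv_matrix M" "inv_matrix N" shows "inv_matrix (mmult M N)"
  unfolding inv_matrix_def
proof (intro ballI)
  fix \<gamma> x y assume *: "\<gamma> \<in> \<Gamma>" "x \<in> K" "y \<in> K"
  have "mmult M N (\<gamma> x) (\<gamma> y) = (\<Sum>z\<in>K. M (\<gamma> x) (\<gamma> z) * N (\<gamma> z) (\<gamma> y))"
    unfolding mmult_def using sum.reindex_bij_betw[OF bij[OF *(1)], symmetric] by simp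
  also have "\<dots> = mmult M N x y" unfolding mmult_def
    using * assms by (auto intro!: sum.cong simp: inv_matrixD)
  finally show "mmult M N (\<gamma> x) (\<gamma> y) = mmult M N x y" .
qed

text \<open>The product is invariant, hence symmetric like its factors, and transposing it reverses
  their order.\<close>

lemma mmult_commute:
  assumes "inv_matrix M" "inv_matrix N" "x \<in> K" "y \<in> K"
  shows "mmult M N x y = mmult N M x y"
proof -
  have "mmult M N x y = mmult M N y x"
    using inv_matrix_mmult inv_matrix_sym assms by metis
  also have "\<dots> = (\<Sum>z\<in>K. N x z * M z y)" unfolding mmult_def
    using assms inv_matrix_sym[of M y] inv_matrix_sym[of N x]
    by (intro sum.cong) (auto simp: mult.commute)
  finally show ?thesis by (simp add: mmult_def)
qed

definition scaled_id :: "'c \<Rightarrow> 'c \<Rightarrow> 'a::field_char_0" where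
  "scaled_id x y = (if x = y then of_nat (card K) else 0)"

lemma inv_matrix_scaled_id: "inv_matrix scaled_id"
  by (auto simp: inv_matrix_def scaled_id_def \<Gamma>_eq_iff)

lemma inv_matrix_scale: "inv_matrix M \<Longrightarrow> inv_matrix (\<lambda>x y. c * M x y)"
  by (auto simp: inv_matrix_def)

lemma inv_matrix_times: "inv_matrix M \<Longrightarrow> inv_matrix N \<Longrightarrow> inv_matrix (\<lambda>x y. M x y * N x y)"
  by (auto simp: inv_matrix_def)

text \<open>\<open>\<phi>0\<close> is a dummy: every vertex that the weight sees is
  averaged.\<close>

definition dens :: "('e \<Rightarrow> 'v \<times> 'v) \<Rightarrow> ('e \<Rightarrow> 'c \<Rightarrow> 'c \<Rightarrow> 'a::field_char_0) \<Rightarrow> 'e set \<Rightarrow> 'a" where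
  "dens p W E = avg K (vset p E) (ewt p W E) \<phi>0"

lemma avg_idle:
  fixes f :: "('v \<Rightarrow> 'c) \<Rightarrow> 'a::field_char_0"
  assumes "finite V" "supported S f" "S \<inter> V = {}"
  shows "avg K V f = f"
proof -
  have "avg1 K v (\<lambda>_. 1) = (\<lambda>_::'v \<Rightarrow> 'c. 1::'a)" for v
    using card_K by (simp add: avg1_def fun_eq_iff)
  with assms(1) have "avg K V (\<lambda>_. 1) = (\<lambda>_::'v \<Rightarrow> 'c. 1::'a)"
    by (induct V rule: finite_induct) (simp_all add: avg_insert)
  then show ?thesis using avg_mult_idle[OF assms, of K "\<lambda>_. 1"] by simp
qed

lemma avg_superset:
  assumes "finite V" "supported S f" "S \<subseteq> V"
  shows "avg K V f \<phi> = avg K S f \<psi>"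
proof -
  have fS: "finite S" using assms finite_subset by blast
  have "avg K V f = avg K (S \<union> (V - S)) f" using assms(3) by (simp add: Un_absorb1)
  also have "\<dots> = avg K S (avg K (V - S) f)" using assms(1) fS by (intro avg_Un) auto
  also have "avg K (V - S) f = f" using assms(1,2) by (intro avg_idle[of _ S]) auto
  finally show ?thesis using avg_eval[OF fS assms(2)] by metis
qed

lemma dens_eq:
  assumes "finite V" "vset p E \<subseteq> V"
  shows "avg K V (ewt p W E) \<phi> = dens p W E"
  unfolding dens_def by (rule avg_superset[OF assms(1) supported_ewt assms(2)])

lemma dens_empty [simp]: "dens p W {} = 1"
  by (simp add: dens_def ewt_def vset_def)

lemma ewt_comp:
  assumes "\<And>e. e \<in> E \<Longrightarrow> inv_matrix (W e)" "\<gamma> \<in> \<Gamma>" "range \<phi> \<subseteq> K"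
  shows "ewt p W E (\<gamma> \<circ> \<phi>) = ewt p W E \<phi>"
  unfolding ewt_def using assms by (auto intro!: prod.cong inv_matrixD)

lemma avg_ewt_comp:
  assumes "finite V" "\<And>e. e \<in> E \<Longrightarrow> inv_matrix (W e)" "\<gamma> \<in> \<Gamma>" "range \<phi> \<subseteq> K"
  shows "avg K V (ewt p W E) (\<gamma> \<circ> \<phi>) = avg K V (ewt p W E) \<phi>"
  unfolding avg_comp_bij[OF assms(1) bij[OF assms(3)]]
  using ewt_comp[OF assms(2,3)] by (intro avg_cong assms) auto

text \<open>The conditional average is a function of the colour of \<open>a\<close> alone. A
  permutation that moves this colour to another one preserves the value, so the function is constant
  and equals its own average.\<close>

lemma avg_ewt_one_vertex:
  assumes "finite E" "\<And>e. e \<in> E \<Longrightarrow> inv_matrix (W e)" "range \<phi> \<subseteq> K"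
  shows "avg K (vset p E - {a}) (ewt p W E) \<phi> = dens p W E"
proof -
  let ?X = "avg K (vset p E - {a}) (ewt p W E)"
  have fin: "finite (vset p E)" using assms(1) by simp
  have "supported (vset p E - (vset p E - {a})) ?X"
    using fin by (intro supported_avg supported_ewt) simp
  then have supp: "supported {a} ?X" by (rule supported_mono) blast
  have const: "?X (\<phi>(a := x)) = ?X \<phi>" if x: "x \<in> K" for x
  proof -
    obtain \<gamma> where \<gamma>: "\<gamma> \<in> \<Gamma>" "\<gamma> (\<phi> a) = x" using generous[of "\<phi> a" x] x assms(3) by blast
    have "?X (\<phi>(a := x)) = ?X (\<gamma> \<circ> \<phi>)" by (rule supportedD[OF supp]) (use \<gamma>(2) in simp)
    also have "\<dots> = ?X \<phi>" using fin assms \<gamma>(1) by (intro avg_ewt_comp) auto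
    finally show ?thesis .
  qed
  have "dens p W E = avg K (insert a (vset p E - {a})) (ewt p W E) \<phi>"
    using fin by (intro dens_eq[symmetric]) auto
  also have "\<dots> = avg1 K a ?X \<phi>" using fin by (subst avg_insert) auto
  also have "\<dots> = ?X \<phi>" using const card_K by (simp add: avg1_def)
  finally show ?thesis by simp
qed

lemma dens_glue1:
  assumes "finite C" "finite D" "C \<inter> D = {}" "vset p C \<inter> vset p D \<subseteq> {a}"
    and "\<And>e. e \<in> D \<Longrightarrow> inv_matrix (W e)"
  shows "dens p W (C \<union> D) = dens p W C * dens p W D"
proof -
  let ?V = "vset p C" and ?U = "vset p D - {a}"
  have fin: "finite ?V" "finite ?U" using assms by auto
  have "avg K ?U (\<lambda>\<phi>. ewt p W C \<phi> * ewt p W D \<phi>) = (\<lambda>\<phi>. ewt p W C \<phi> * avg K ?U (ewt p W D) \<phi>)"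
    using assms(4) fin(2) by (intro avg_mult_idle[of _ ?V] supported_ewt) auto
  \<comment> \<open>\<open>?U\<close> leaves out \<open>a\<close>, and \<open>a\<close> may lie
    outside \<open>?V\<close>, so it is inserted to be averaged in any case.\<close>
  moreover have "dens p W (C \<union> D) = avg K (insert a ?V \<union> ?U) (ewt p W (C \<union> D)) \<phi>0"
    using fin by (intro dens_eq[symmetric]) (auto simp: vset_Un)
  ultimately have "dens p W (C \<union> D)
      = avg K (insert a ?V) (\<lambda>\<phi>. ewt p W C \<phi> * avg K ?U (ewt p W D) \<phi>) \<phi>0"
    using fin ext[of "ewt p W (C \<union> D)", OF ewt_Un[OF assms(1-3)]]
    by (simp add: avg_Un del: Un_insert_left)
  also have "\<dots> = avg K (insert a ?V) (\<lambda>\<phi>. dens p W D * ewt p W C \<phi>) \<phi>0"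
    using fin assms by (intro avg_cong range_\<phi>0) (auto simp: avg_ewt_one_vertex)
  also have "\<dots> = dens p W D * dens p W C"
    using fin by (subst avg_scale) (auto intro: dens_eq)
  finally show ?thesis by simp
qed

text \<open>The joint distribution of the colours of \<open>a\<close> and \<open>b\<close>; here \<open>a = b\<close> is allowed.\<close>

definition joint :: "('e \<Rightarrow> 'v \<times> 'v) \<Rightarrow> ('e \<Rightarrow> 'c \<Rightarrow> 'c \<Rightarrow> 'a::field_char_0) \<Rightarrow> 'e set \<Rightarrow> 'v \<Rightarrow> 'v \<Rightarrow> 'c \<Rightarrow> 'c \<Rightarrow> 'a" where
  "joint p W C a b x y =
     avg K (vset p C \<union> {a, b}) (\<lambda>\<phi>. ewt p W C \<phi> * (of_bool (\<phi> a = x) * of_bool (\<phi> b = y))) \<phi>0"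

lemma supported_joint: "supported (vset p C \<union> {a, b}) (\<lambda>\<phi>. ewt p W C \<phi> * (of_bool (\<phi> a = x) * of_bool (\<phi> b = y)))"
  by (intro supported_mult supported_mono[OF supported_ewt]) (auto simp: supported_def)

lemma joint_eval:
  assumes "finite C"
  shows "avg K (vset p C \<union> {a, b}) (\<lambda>\<phi>. ewt p W C \<phi> * (of_bool (\<phi> a = x) * of_bool (\<phi> b = y))) \<phi> = joint p W C a b x y"
  unfolding joint_def using assms by (intro avg_eval supported_joint) auto

lemma inv_matrix_joint:
  fixes p :: "'e \<Rightarrow> 'v \<times> 'v"
  assumes "finite C" "\<And>e. e \<in> C \<Longrightarrow> inv_matrix (W e)"
  shows "inv_matrix (joint p W C a b)"
  unfolding inv_matrix_def
proof (intro ballI)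
  fix \<gamma> x y assume *: "\<gamma> \<in> \<Gamma>" "x \<in> K" "y \<in> K"
  let ?V = "vset p C \<union> {a, b}"
  let ?f = "\<lambda>x y \<phi>. ewt p W C \<phi> * (of_bool (\<phi> a = x) * of_bool (\<phi> b = y))"
  have fin: "finite ?V" using assms(1) by simp
  have "joint p W C a b (\<gamma> x) (\<gamma> y) = avg K ?V (?f (\<gamma> x) (\<gamma> y)) (\<gamma> \<circ> \<phi>0)"
    by (rule joint_eval[OF assms(1), symmetric])
  also have "\<dots> = avg K ?V (\<lambda>\<psi>. ?f (\<gamma> x) (\<gamma> y) (\<gamma> \<circ> \<psi>)) \<phi>0"
    by (rule avg_comp_bij[OF fin bij[OF *(1)]])
  also have "\<dots> = avg K ?V (?f x y) \<phi>0"
  proof (intro avg_cong fin range_\<phi>0)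
    fix \<phi> :: "'v \<Rightarrow> 'c" assume r: "range \<phi> \<subseteq> K"
    then have "\<phi> a \<in> K" "\<phi> b \<in> K" by auto
    then show "?f (\<gamma> x) (\<gamma> y) (\<gamma> \<circ> \<phi>) = ?f x y \<phi>"
      using * by (simp add: ewt_comp[OF assms(2) *(1) r] \<Gamma>_eq_iff)
  qed
  finally show "joint p W C a b (\<gamma> x) (\<gamma> y) = joint p W C a b x y" by (simp add: joint_def)
qed


lemma sum_of_bool:
  fixes \<phi> :: "'v \<Rightarrow> 'c"
  assumes "\<phi> a \<in> K" "\<phi> b \<in> K"
  shows "(\<Sum>x\<in>K. \<Sum>y\<in>K. of_bool (\<phi> a = x) * of_bool (\<phi> b = y) * g x y) = (g (\<phi> a) (\<phi> b) :: 'a::field_char_0)"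
proof -
  have "(\<Sum>x\<in>K. \<Sum>y\<in>K. of_bool (\<phi> a = x) * of_bool (\<phi> b = y) * g x y)
      = (\<Sum>x\<in>K. of_bool (\<phi> a = x) * (\<Sum>y\<in>K. of_bool (\<phi> b = y) * g x y))"
    by (simp add: sum_distrib_left mult.assoc)
  also have "\<dots> = (\<Sum>x\<in>K. if \<phi> a = x then (\<Sum>y\<in>K. if \<phi> b = y then g x y else 0) else 0)"
    by (intro sum.cong refl) (auto intro!: sum.cong)
  finally show ?thesis using assms finite_K by (simp add: sum.delta)
qed

text \<open>Integrates out the side \<open>C\<close> in front of a factor that sees it only through
  \<open>a\<close> and \<open>b\<close>: once the two colours are fixed to \<open>x\<close> and
  \<open>y\<close>, \<open>h x y\<close> is idle and leaves the average.\<close>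

lemma avg_ewt_times:
  fixes p :: "'e \<Rightarrow> 'v \<times> 'v"
  assumes "finite C" "range \<phi> \<subseteq> K" "\<And>x y. supported S (h x y)" "S \<inter> (vset p C \<union> {a, b}) = {}"
  shows "avg K (vset p C \<union> {a, b}) (\<lambda>\<phi>. ewt p W C \<phi> * h (\<phi> a) (\<phi> b) \<phi>) \<phi>
     = (\<Sum>x\<in>K. \<Sum>y\<in>K. h x y \<phi> * joint p W C a b x y)"
proof -
  let ?V = "vset p C \<union> {a, b}"
  let ?f = "\<lambda>x y \<phi>. ewt p W C \<phi> * (of_bool (\<phi> a = x) * of_bool (\<phi> b = y))"
  have fin: "finite ?V" using assms(1) by simp
  have "avg K ?V (\<lambda>\<phi>. ewt p W C \<phi> * h (\<phi> a) (\<phi> b) \<phi>) \<phi>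
     = avg K ?V (\<lambda>\<phi>. \<Sum>x\<in>K. \<Sum>y\<in>K. h x y \<phi> * ?f x y \<phi>) \<phi>"
  proof (intro avg_cong fin assms(2))
    fix \<phi> :: "'v \<Rightarrow> 'c" assume "range \<phi> \<subseteq> K"
    then have "\<phi> a \<in> K" "\<phi> b \<in> K" by auto
    from sum_of_bool[of \<phi>, OF this, of "\<lambda>x y. h x y \<phi>"]
    have "ewt p W C \<phi> * h (\<phi> a) (\<phi> b) \<phi> =
        ewt p W C \<phi> * (\<Sum>x\<in>K. \<Sum>y\<in>K. of_bool (\<phi> a = x) * of_bool (\<phi> b = y) * h x y \<phi>)"
      by simp
    then show "ewt p W C \<phi> * h (\<phi> a) (\<phi> b) \<phi> = (\<Sum>x\<in>K. \<Sum>y\<in>K. h x y \<phi> * ?f x y \<phi>)"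
      by (simp add: sum_distrib_left ac_simps)
  qed
  also have "\<dots> = (\<Sum>x\<in>K. \<Sum>y\<in>K. avg K ?V (\<lambda>\<phi>. h x y \<phi> * ?f x y \<phi>) \<phi>)"
    using fin by (simp add: avg_sum)
  also have "\<dots> = (\<Sum>x\<in>K. \<Sum>y\<in>K. h x y \<phi> * joint p W C a b x y)"
    unfolding avg_mult_idle[OF fin assms(3,4)] joint_eval[OF assms(1)] ..
  finally show ?thesis .
qed

text \<open>Read from right to left, a pairing with a joint distribution is the density of a graph
  with a virtual edge.\<close>

lemma dens_insert_edge:
  assumes "finite C" "e \<notin> C"
  shows "dens (p(e := (a, b))) (W(e := M)) (insert e C) = (\<Sum>x\<in>K. \<Sum>y\<in>K. M x y * joint p W C a b x y)"
proof -
  let ?p = "p(e := (a, b))" and ?W = "W(e := M)"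
  have "vset ?p (insert e C) = vset p C \<union> {a, b}" using assms(2) by (auto simp: vset_def split: if_splits)
  moreover have "ewt ?p ?W (insert e C) = (\<lambda>\<phi>. ewt p W C \<phi> * M (\<phi> a) (\<phi> b))"
  proof
    fix \<phi>
    have "ewt ?p ?W C = ewt p W C" using assms(2) by (intro ewt_cong) auto
    then show "ewt ?p ?W (insert e C) \<phi> = ewt p W C \<phi> * M (\<phi> a) (\<phi> b)"
      using assms by (simp add: ewt_insert)
  qed
  ultimately show ?thesis
    unfolding dens_def
    using avg_ewt_times[OF assms(1) range_\<phi>0, of "{}" "\<lambda>x y _. M x y" p a b W]
    by (simp add: supported_def)
qed

text \<open>Conditioning on the colours of \<open>a\<close> and \<open>b\<close>, which are independent and uniform for \<open>a \<noteq> b\<close>.\<close>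

lemma avg_ewt_two_vertices:
  fixes p :: "'e \<Rightarrow> 'v \<times> 'v" and W :: "'e \<Rightarrow> 'c \<Rightarrow> 'c \<Rightarrow> 'a::field_char_0"
  assumes "finite C" "a \<noteq> b" "range \<phi> \<subseteq> K"
  shows "avg K (vset p C - {a, b}) (ewt p W C) \<phi> = of_nat (card K) ^ 2 * joint p W C a b (\<phi> a) (\<phi> b)"
proof -
  let ?V = "vset p C - {a, b}"
  let ?X = "avg K ?V (ewt p W C)"
  let ?i = "\<lambda>\<psi>. of_bool (\<psi> a = \<phi> a) * of_bool (\<psi> b = \<phi> b) :: 'a"
  have fin: "finite ?V" using assms(1) by simp
  have "supported (vset p C - ?V) ?X" by (intro supported_avg fin supported_ewt)
  then have suppX: "supported {a, b} ?X" by (rule supported_mono) blast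
  have "supported {a, b} ?i" by (simp add: supported_def)
  then have "avg K ?V (\<lambda>\<psi>. ?i \<psi> * ewt p W C \<psi>) = (\<lambda>\<psi>. ?i \<psi> * ?X \<psi>)"
    by (intro avg_mult_idle fin) auto
  moreover have "{a, b} \<union> ?V = vset p C \<union> {a, b}" by blast
  ultimately have "joint p W C a b (\<phi> a) (\<phi> b) = avg K {a, b} (\<lambda>\<psi>. ?i \<psi> * ?X \<psi>) \<phi>"
    unfolding joint_eval[OF assms(1), of p a b W "\<phi> a" "\<phi> b" \<phi>, symmetric]
    using avg_Un[of "{a, b}" ?V K "\<lambda>\<psi>. ?i \<psi> * ewt p W C \<psi>"] fin by (simp add: mult.commute)
  also have "\<dots> = (\<Sum>x\<in>K. \<Sum>y\<in>K. of_bool (\<phi> a = x) * of_bool (\<phi> b = y) * ?X (\<phi>(a := x, b := y))) / of_nat (card K) ^ 2"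
    using assms(2) by (simp add: avg_insert avg1_def power2_eq_square eq_commute sum_divide_distrib[symmetric])
  also have "\<dots> = ?X (\<phi>(a := \<phi> a, b := \<phi> b)) / of_nat (card K) ^ 2"
    using assms(3) by (subst sum_of_bool) auto
  finally show ?thesis using card_K by (simp add: field_simps)
qed

text \<open>Each joint distribution contains the probability of the pair of colours, which should
  count only once. The factor \<open>card K ^ 2\<close> turns one of them into a conditional
  average.\<close>

lemma dens_glue2:
  assumes "finite C" "finite D" "C \<inter> D = {}" "vset p C \<inter> vset p D \<subseteq> {a, b}" "a \<noteq> b"
  shows "dens p W (C \<union> D) = of_nat (card K) ^ 2 * (\<Sum>x\<in>K. \<Sum>y\<in>K. joint p W C a b x y * joint p W D a b x y)"
proof -
  let ?V = "vset p C" and ?U = "vset p D - {a, b}"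
  let ?c = "of_nat (card K) ^ 2"
  have fin: "finite ?V" "finite ?U" using assms by auto
  have "avg K ?U (\<lambda>\<phi>. ewt p W C \<phi> * ewt p W D \<phi>) = (\<lambda>\<phi>. ewt p W C \<phi> * avg K ?U (ewt p W D) \<phi>)"
    using assms(4) fin(2) by (intro avg_mult_idle[of _ ?V] supported_ewt) auto
  moreover have "dens p W (C \<union> D) = avg K ((?V \<union> {a, b}) \<union> ?U) (ewt p W (C \<union> D)) \<phi>0"
    using fin by (intro dens_eq[symmetric]) (auto simp: vset_Un)
  moreover have "ewt p W (C \<union> D) = (\<lambda>\<phi>. ewt p W C \<phi> * ewt p W D \<phi>)"
    using ewt_Un[OF assms(1-3)] by blast
  ultimately have "dens p W (C \<union> D)
      = avg K (?V \<union> {a, b}) (\<lambda>\<phi>. ewt p W C \<phi> * avg K ?U (ewt p W D) \<phi>) \<phi>0"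
    using avg_Un[of "?V \<union> {a, b}" ?U K "\<lambda>\<phi>. ewt p W C \<phi> * ewt p W D \<phi>"] fin by (simp del: Un_insert_left Un_insert_right)
  also have "\<dots> = avg K (?V \<union> {a, b}) (\<lambda>\<phi>. ewt p W C \<phi> * (?c * joint p W D a b (\<phi> a) (\<phi> b))) \<phi>0"
    using fin assms by (intro avg_cong range_\<phi>0) (auto simp: avg_ewt_two_vertices)
  also have "\<dots> = (\<Sum>x\<in>K. \<Sum>y\<in>K. (?c * joint p W D a b x y) * joint p W C a b x y)"
    using avg_ewt_times[OF assms(1) range_\<phi>0, of "{}" "\<lambda>x y _. ?c * joint p W D a b x y" p a b W]
    by (simp add: supported_def)
  finally show ?thesis by (simp add: sum_distrib_left ac_simps)
qed

lemma dens_rename: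
  fixes p :: "'e \<Rightarrow> 'v \<times> 'v" and q :: "'e \<Rightarrow> 'w \<times> 'w"
  assumes "finite E" "inj_on m (vset p E)" "\<And>e. e \<in> E \<Longrightarrow> inv_matrix (W e)"
    and q: "\<And>e. e \<in> E \<Longrightarrow> q e = (m (fst (p e)), m (snd (p e))) \<or> q e = (m (snd (p e)), m (fst (p e)))"
  shows "dens q W E = dens p W E"
proof -
  have fin: "finite (vset p E)" using assms(1) by simp
  have q': "{fst (q e), snd (q e)} = m ` {fst (p e), snd (p e)}" if "e \<in> E" for e
    using q[OF that] by auto
  then have "vset q E = m ` vset p E"
    unfolding vset_def image_UN by (intro SUP_cong) auto
  moreover have "avg K (m ` vset p E) (ewt q W E) \<phi>0 = avg K (m ` vset p E) (\<lambda>\<phi>. ewt p W E (\<phi> \<circ> m)) \<phi>0"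
  proof (intro avg_cong range_\<phi>0)
    fix \<phi> :: "'w \<Rightarrow> 'c" assume "range \<phi> \<subseteq> K"
    then have \<phi>: "\<phi> v \<in> K" for v by auto
    show "ewt q W E \<phi> = ewt p W E (\<phi> \<circ> m)"
      unfolding ewt_def
    proof (intro prod.cong refl)
      fix e assume e: "e \<in> E"
      show "W e (\<phi> (fst (q e))) (\<phi> (snd (q e))) = W e ((\<phi> \<circ> m) (fst (p e))) ((\<phi> \<circ> m) (snd (p e)))"
        using q[OF e] inv_matrix_sym[OF assms(3)[OF e] \<phi> \<phi>] by (elim disjE) auto
    qed
  qed (use fin in simp)
  ultimately show ?thesis
    unfolding dens_def using avg_rename[OF fin assms(2) supported_ewt] avg_eval[OF fin supported_ewt] by metis
qed

text \<open>Loops have equal \<open>inc\<close> wherever they lie, hence the condition that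
  \<open>inc p e\<close> is nonempty.\<close>

lemma dens_parallel:
  assumes "finite E" "e \<in> E" "f \<in> E" "e \<noteq> f" "inc p e = inc p f" "inc p e \<noteq> {}" "inv_matrix (W f)"
  shows "dens p W E = dens p (W(e := \<lambda>x y. W e x y * W f x y)) (E - {f})"
proof -
  let ?W = "W(e := \<lambda>x y. W e x y * W f x y)"
  let ?C = "E - {e, f}"
  have E: "E = insert e (insert f ?C)" "E - {f} = insert e ?C" using assms(2-4) by auto
  have finC: "finite ?C" using assms(1) by simp
  have ends: "p f = p e \<or> p f = (snd (p e), fst (p e))"
  proof -
    obtain x y where xy: "p e = (x, y)" by (cases "p e")
    obtain u v where uv: "p f = (u, v)" by (cases "p f")
    have "x \<noteq> y" using assms(6) xy by (simp add: inc_empty_iff)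
    moreover have "u \<noteq> v" using assms(5,6) uv by (simp add: inc_empty_iff)
    ultimately have "{x, y} = {u, v}" using assms(5) xy uv by (auto simp: inc_def)
    then show ?thesis using xy uv by (auto simp: doubleton_eq_iff)
  qed
  have "vset p {e, f} = vset p {e}" using ends by (auto simp: vset_def)
  moreover have "E = {e, f} \<union> ?C" "E - {f} = {e} \<union> ?C" using assms(2-4) by auto
  ultimately have v: "vset p (E - {f}) = vset p E" by (metis vset_Un)
  have "ewt p W E \<phi> = ewt p ?W (E - {f}) \<phi>" if "range \<phi> \<subseteq> K" for \<phi>
  proof -
    have "\<phi> v \<in> K" for v using that by auto
    then have "W f (\<phi> (fst (p f))) (\<phi> (snd (p f))) = W f (\<phi> (fst (p e))) (\<phi> (snd (p e)))"
      using ends inv_matrix_sym[OF assms(7)] by auto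
    moreover have "ewt p W ?C = ewt p ?W ?C" by (rule ewt_cong) auto
    moreover have "ewt p W E \<phi> = W e (\<phi> (fst (p e))) (\<phi> (snd (p e))) * (W f (\<phi> (fst (p f))) (\<phi> (snd (p f))) * ewt p W ?C \<phi>)"
      using arg_cong[where f = "\<lambda>X. ewt p W X \<phi>", OF E(1)] finC assms(4) by (simp add: ewt_insert)
    ultimately show ?thesis using assms(4) finC unfolding E(2) by (simp add: ewt_insert)
  qed
  then show ?thesis unfolding dens_def v using assms(1) by (intro avg_cong range_\<phi>0) auto
qed

text \<open>Contracting \<open>f\<close> amounts to giving it the multiple of the identity matrix of mean value 1.\<close>

lemma dens_contract:
  fixes p :: "'e \<Rightarrow> 'v \<times> 'v"
  assumes "finite E" "f \<in> E" "fst (p f) \<noteq> snd (p f)"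
  shows "dens (contract p f) W (E - {f}) = dens p (W(f := scaled_id)) E"
proof -
  define s t where "s = fst (p f)" and "t = snd (p f)"
  let ?C = "E - {f}"
  define m where "m v = (if v = t then s else v)" for v
  let ?q = "contract p f"
  have q: "?q e = (m (fst (p e)), m (snd (p e)))" for e
    by (simp add: contract_def m_def s_def t_def)
  let ?V = "vset p E - {t}"
  have fin: "finite ?C" "finite ?V" using assms(1) by auto
  have stV: "s \<in> vset p E" "t \<in> vset p E" using assms(2) by (auto simp: s_def t_def vset_def)
  have "s \<noteq> t" using assms(3) by (simp add: s_def t_def)
  have m: "m t = s" "\<And>v. v \<noteq> t \<Longrightarrow> m v = v" by (auto simp: m_def)
  have "vset ?q ?C \<subseteq> ?V"
  proof
    fix v assume "v \<in> vset ?q ?C"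
    then obtain u where "u \<in> vset p ?C" "v = m u" by (auto simp: vset_def q)
    moreover have "vset p ?C \<subseteq> vset p E" by (rule vset_mono) blast
    ultimately show "v \<in> ?V" using stV m \<open>s \<noteq> t\<close> by (cases "u = t") auto
  qed
  then have "dens ?q W ?C = avg K ?V (ewt ?q W ?C) \<phi>0" using fin by (intro dens_eq[symmetric])
  also have "\<dots> = avg K ?V (avg1 K t (ewt p (W(f := scaled_id)) E)) \<phi>0"
  proof (intro avg_cong fin range_\<phi>0)
    fix \<phi> :: "'v \<Rightarrow> 'c" assume "range \<phi> \<subseteq> K"
    then have \<phi>: "\<phi> s \<in> K" by auto
    have *: "ewt p (W(f := scaled_id)) E \<psi> = scaled_id (\<psi> s) (\<psi> t) * ewt p W ?C \<psi>" for \<psi>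
    proof -
      have "ewt p (W(f := scaled_id)) ?C = ewt p W ?C" by (intro ewt_cong) auto
      then show ?thesis using ewt_insert[OF fin(1), of f p "W(f := scaled_id)" \<psi>] assms(2)
        by (simp add: insert_absorb s_def t_def)
    qed
    have "avg1 K t (ewt p (W(f := scaled_id)) E) \<phi>
        = (\<Sum>x\<in>K. if \<phi> s = x then of_nat (card K) * ewt p W ?C (\<phi>(t := x)) else 0) / of_nat (card K)"
      unfolding avg1_def * using \<open>s \<noteq> t\<close>
      by (intro arg_cong2[of _ _ _ _ "(/)"] sum.cong) (auto simp: scaled_id_def)
    also have "\<dots> = ewt p W ?C (\<phi>(t := \<phi> s))"
      using \<phi> finite_K card_K by simp
    also have "\<dots> = ewt ?q W ?C \<phi>"
      unfolding ewt_def by (intro prod.cong) (auto simp: q m_def)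
    finally show "ewt ?q W ?C \<phi> = avg1 K t (ewt p (W(f := scaled_id)) E) \<phi>" by simp
  qed
  also have "\<dots> = avg K (?V \<union> {t}) (ewt p (W(f := scaled_id)) E) \<phi>0"
    using fin by (subst avg_Un) (auto simp: avg_insert)
  also have "\<dots> = dens p (W(f := scaled_id)) E"
    using fin by (intro dens_eq) auto
  finally show ?thesis .
qed

end

section \<open>Densities depend only on the even sets\<close>

context colours
begin

lemma mmult_assoc: "mmult (mmult L M) N x y = mmult L (mmult M N) x y"
  unfolding mmult_def sum_distrib_left sum_distrib_right
  by (subst sum.swap) (simp add: mult.assoc)

lemma mmult_cong:
  "(\<And>z. z \<in> K \<Longrightarrow> L x z = L' x z) \<Longrightarrow> (\<And>z. z \<in> K \<Longrightarrow> M z y = M' z y) \<Longrightarrow> mmult L M x y = mmult L' M' x y"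
  unfolding mmult_def by (intro sum.cong) auto

text \<open>Deleting a cut of two edges leaves sides \<open>C\<close> and \<open>D\<close>, each of
  which acts only through the joint distribution of the ends of \<open>e\<close> and
  \<open>f\<close> on it; these two ends may coincide. This isolates the dependence on the matrices
  of \<open>e\<close> and \<open>f\<close>.\<close>

lemma dens_cut2:
  fixes p :: "'e \<Rightarrow> 'v \<times> 'v" and W :: "'e \<Rightarrow> 'c \<Rightarrow> 'c \<Rightarrow> 'a::field_char_0"
  assumes "finite E" "e \<in> E" "f \<in> E" "e \<noteq> f" "is_cut p E S {e, f}"
    and invW: "\<And>g. g \<in> E \<Longrightarrow> inv_matrix (W g)"
  shows "\<exists>TC TD. inv_matrix TC \<and> inv_matrix TD \<and>
    (\<forall>M N. inv_matrix M \<longrightarrow> inv_matrix N \<longrightarrow> dens p (W(e := M, f := N)) E =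
       (\<Sum>x\<in>K. \<Sum>y\<in>K. (\<Sum>x'\<in>K. \<Sum>y'\<in>K. (M x x' * N y y') * TD x' y') * TC x y))"
proof -
  define C D where "C = {g \<in> E. fst (p g) \<in> S \<and> snd (p g) \<in> S}"
    and "D = {g \<in> E. fst (p g) \<notin> S \<and> snd (p g) \<notin> S}"
  define s t where "s g = (if fst (p g) \<in> S then fst (p g) else snd (p g))"
    and "t g = (if fst (p g) \<in> S then snd (p g) else fst (p g))" for g
  have fin: "finite C" "finite D" using assms(1) by (simp_all add: C_def D_def)
  have cut: "(fst (p g) \<in> S) \<noteq> (snd (p g) \<in> S) \<longleftrightarrow> g = e \<or> g = f" if "g \<in> E" for g
    using assms(5) that by (auto simp: is_cut_def)
  have E: "E = insert e (insert f (C \<union> D))" "e \<notin> C \<union> D" "f \<notin> C \<union> D" "C \<inter> D = {}"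
    using cut assms(2,3) by (auto simp: C_def D_def)
  have st: "s g \<in> S" "t g \<notin> S" "p g = (s g, t g) \<or> p g = (t g, s g)" if "g = e \<or> g = f" for g
    using cut[of g] that assms(2,3) by (auto simp: s_def t_def prod_eq_iff)
  let ?C = "vset p C \<union> {s e, s f}" and ?D = "vset p D \<union> {t e, t f}"
  have CS: "?C \<subseteq> S" and DS: "?D \<inter> S = {}" using st by (auto simp: C_def D_def elim!: vsetE)
  have finV: "finite ?C" "finite ?D" using fin by auto
  define TC TD where "TC = joint p W C (s e) (s f)" and "TD = joint p W D (t e) (t f)"
  have "inv_matrix TC" "inv_matrix TD"
    unfolding TC_def TD_def using fin invW by (auto intro!: inv_matrix_joint simp: C_def D_def)
  moreover have "dens p (W(e := M, f := N)) E =
      (\<Sum>x\<in>K. \<Sum>y\<in>K. (\<Sum>x'\<in>K. \<Sum>y'\<in>K. (M x x' * N y y') * TD x' y') * TC x y)"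
    if MN: "inv_matrix M" "inv_matrix N" for M N
  proof -
    let ?W = "W(e := M, f := N)"
    define h where "h x y \<phi> = ewt p W D \<phi> * (M x (\<phi> (t e)) * N y (\<phi> (t f)))" for x y and \<phi> :: "'v \<Rightarrow> 'c"
    have supp_h: "supported ?D (h x y)" for x y
      unfolding h_def by (intro supported_mult supported_mono[OF supported_ewt]) (auto simp: supported_def)
    have ewt_h: "ewt p ?W E \<phi> = ewt p W C \<phi> * h (\<phi> (s e)) (\<phi> (s f)) \<phi>" if "range \<phi> \<subseteq> K" for \<phi>
    proof -
      have K: "\<phi> v \<in> K" for v using that by auto
      have "ewt p ?W C = ewt p W C" "ewt p ?W D = ewt p W D" using E(2,3) by (auto intro!: ewt_cong)
      moreover have "M (\<phi> (fst (p e))) (\<phi> (snd (p e))) = M (\<phi> (s e)) (\<phi> (t e))"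
        "N (\<phi> (fst (p f))) (\<phi> (snd (p f))) = N (\<phi> (s f)) (\<phi> (t f))"
        using st(3)[of e] st(3)[of f] inv_matrix_sym[OF MN(1) K K] inv_matrix_sym[OF MN(2) K K] by auto
      moreover have "ewt p ?W E \<phi> = ewt p ?W (insert e (insert f (C \<union> D))) \<phi>"
        by (rule arg_cong[where f = "\<lambda>X. ewt p ?W X \<phi>", OF E(1)])
      ultimately show ?thesis
        using fin E(2-4) assms(4) by (simp add: ewt_insert ewt_Un h_def ac_simps)
    qed
    have "vset p E \<subseteq> ?C \<union> ?D"
    proof
      fix v assume "v \<in> vset p E"
      then obtain g where g: "g \<in> E" "v = fst (p g) \<or> v = snd (p g)" by (rule vsetE)
      show "v \<in> ?C \<union> ?D"
      proof (cases "g = e \<or> g = f")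
        case True then show ?thesis using st(3)[OF True] g(2) by auto
      next
        case False
        then have "g \<in> C \<union> D" using g(1) E(1) by blast
        then have "v \<in> vset p (C \<union> D)" using g(2) by (rule vsetI)
        then show ?thesis by (auto simp: vset_Un)
      qed
    qed
    then have "dens p ?W E = avg K (?D \<union> ?C) (ewt p ?W E) \<phi>0"
      using finV by (intro dens_eq[symmetric]) auto
    also have "\<dots> = avg K ?D (avg K ?C (ewt p ?W E)) \<phi>0"
      by (rule arg_cong[OF avg_Un[OF finV(2,1)], of "\<lambda>g. g \<phi>0"])
    also have "\<dots> = avg K ?D (\<lambda>\<phi>. \<Sum>x\<in>K. \<Sum>y\<in>K. TC x y * h x y \<phi>) \<phi>0"
    proof (intro avg_cong finV range_\<phi>0)
      fix \<phi> :: "'v \<Rightarrow> 'c" assume \<phi>: "range \<phi> \<subseteq> K"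
      have "avg K ?C (ewt p ?W E) \<phi> = avg K ?C (\<lambda>\<phi>. ewt p W C \<phi> * h (\<phi> (s e)) (\<phi> (s f)) \<phi>) \<phi>"
        by (rule avg_cong[OF finV(1) ewt_h \<phi>])
      also have "\<dots> = (\<Sum>x\<in>K. \<Sum>y\<in>K. h x y \<phi> * joint p W C (s e) (s f) x y)"
        by (rule avg_ewt_times[OF fin(1) \<phi> supp_h]) (use CS DS in blast)
      finally show "avg K ?C (ewt p ?W E) \<phi> = (\<Sum>x\<in>K. \<Sum>y\<in>K. TC x y * h x y \<phi>)"
        by (simp add: TC_def mult.commute)
    qed
    also have "\<dots> = (\<Sum>x\<in>K. \<Sum>y\<in>K. TC x y * avg K ?D (h x y) \<phi>0)"
      unfolding avg_sum[OF finV(2)] avg_scale[OF finV(2)] ..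
    also have "\<dots> = (\<Sum>x\<in>K. \<Sum>y\<in>K. TC x y * (\<Sum>x'\<in>K. \<Sum>y'\<in>K. (M x x' * N y y') * TD x' y'))"
    proof (intro sum.cong refl arg_cong2[where f = "(*)"])
      fix x y
      show "avg K ?D (h x y) \<phi>0 = (\<Sum>x'\<in>K. \<Sum>y'\<in>K. (M x x' * N y y') * TD x' y')"
        unfolding h_def TD_def
        by (rule avg_ewt_times[OF fin(2) range_\<phi>0, of "{}" "\<lambda>x' y' _. M x x' * N y y'"])
          (auto simp: supported_def)
    qed
    finally show ?thesis by (simp add: mult.commute)
  qed
  ultimately show ?thesis by (intro exI[of _ TC] exI[of _ TD]) simp
qed

text \<open>Two edges in series compose like matrices wherever they lie: invariant matrices commute.\<close>

lemma dens_series: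
  fixes p :: "'e \<Rightarrow> 'v \<times> 'v" and W :: "'e \<Rightarrow> 'c \<Rightarrow> 'c \<Rightarrow> 'a::field_char_0"
  assumes "finite E" "e \<in> E" "f \<in> E" "e \<noteq> f"
    and series: "\<And>Z. Z \<subseteq> E \<Longrightarrow> bdry p Z = {} \<Longrightarrow> e \<in> Z \<longleftrightarrow> f \<in> Z"
    and invW: "\<And>g. g \<in> E \<Longrightarrow> inv_matrix (W g)"
  shows "dens p W E = dens (contract p f) (W(e := \<lambda>x y. inverse (of_nat (card K)) * mmult (W f) (W e) x y)) (E - {f})"
proof -
  have "even (card (Z \<inter> {e, f}))" if "Z \<subseteq> E" "bdry p Z = {}" for Z
  proof -
    have "Z \<inter> {e, f} = {} \<or> Z \<inter> {e, f} = {e, f}" using series[OF that] by blast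
    then show ?thesis using assms(4) by auto
  qed
  from orthogonal_is_cut[OF assms(1) _ this] obtain S where S: "is_cut p E S {e, f}"
    using assms(2,3) by blast
  then have "f \<in> {g \<in> E. (fst (p g) \<in> S) \<noteq> (snd (p g) \<in> S)}" unfolding is_cut_def by blast
  then have loop: "fst (p f) \<noteq> snd (p f)" by auto
  have "\<exists>TC TD. inv_matrix TC \<and> inv_matrix TD \<and>
    (\<forall>M N. inv_matrix M \<longrightarrow> inv_matrix N \<longrightarrow> dens p (W(e := M, f := N)) E =
       (\<Sum>x\<in>K. \<Sum>y\<in>K. (\<Sum>x'\<in>K. \<Sum>y'\<in>K. (M x x' * N y y') * TD x' y') * TC x y))"
    by (rule dens_cut2[OF assms(1-4) S]) (rule invW)
  then obtain TC TD :: "'c \<Rightarrow> 'c \<Rightarrow> 'a" where T: "inv_matrix TC" "inv_matrix TD"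
    and dens: "\<And>M N. inv_matrix M \<Longrightarrow> inv_matrix N \<Longrightarrow> dens p (W(e := M, f := N)) E =
       (\<Sum>x\<in>K. \<Sum>y\<in>K. (\<Sum>x'\<in>K. \<Sum>y'\<in>K. (M x x' * N y y') * TD x' y') * TC x y)"
    by (elim exE conjE) blast
  \<comment> \<open>By symmetry the sum is an entry of the product of \<open>N\<close>,
    \<open>TD\<close> and \<open>M\<close>. Commuting \<open>TD\<close> to the front shows that
    \<open>M\<close> and \<open>N\<close> matter only through their product.\<close>
  have quad: "(\<Sum>x'\<in>K. \<Sum>y'\<in>K. (M x x' * N y y') * TD x' y') = mmult TD (mmult N M) y x"
    if MN: "inv_matrix M" "inv_matrix N" and xy: "x \<in> K" "y \<in> K" for M N x y
  proof -
    have "(\<Sum>x'\<in>K. \<Sum>y'\<in>K. (M x x' * N y y') * TD x' y') = (\<Sum>x'\<in>K. \<Sum>y'\<in>K. N y y' * TD y' x' * M x' x)"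
      using inv_matrix_sym[OF MN(1) xy(1)] inv_matrix_sym[OF T(2)]
      by (intro sum.cong refl) (simp add: ac_simps)
    also have "\<dots> = mmult (mmult N TD) M y x"
      by (simp add: mmult_def sum_distrib_right)
    also have "\<dots> = mmult (mmult TD N) M y x"
      using mmult_commute[OF MN(2) T(2) xy(2)] by (intro mmult_cong[where L = "mmult N TD"]) auto
    finally show ?thesis by (simp add: mmult_assoc)
  qed
  \<comment> \<open>With \<open>scaled_id\<close> on \<open>f\<close>, this matrix on
    \<open>e\<close> keeps the product unchanged; the inverse cancels the factor inside
    \<open>scaled_id\<close>.\<close>
  define M' where "M' = (\<lambda>x y. inverse (of_nat (card K)) * mmult (W f) (W e) x y)"
  have inv: "inv_matrix (W e)" "inv_matrix (W f)" "inv_matrix M'"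
    unfolding M'_def using invW assms(2,3) by (auto intro!: inv_matrix_scale inv_matrix_mmult)
  have "mmult TD (mmult scaled_id M') y x = mmult TD (mmult (W f) (W e)) y x" if "x \<in> K" "y \<in> K" for x y
  proof (rule mmult_cong[OF refl])
    fix z assume "z \<in> K"
    have "mmult scaled_id M' z x = (\<Sum>u\<in>K. if z = u then of_nat (card K) * M' u x else 0)"
      unfolding mmult_def scaled_id_def by (intro sum.cong) auto
    also have "\<dots> = mmult (W f) (W e) z x"
      using \<open>z \<in> K\<close> finite_K card_K by (simp add: M'_def)
    finally show "mmult scaled_id M' z x = mmult (W f) (W e) z x" .
  qed
  then have "dens p (W(e := M', f := scaled_id)) E = dens p (W(e := W e, f := W f)) E"
    unfolding dens[OF inv(3) inv_matrix_scaled_id] dens[OF inv(1,2)]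
    by (intro sum.cong refl) (simp add: quad[OF inv(3) inv_matrix_scaled_id] quad[OF inv(1,2)])
  then show ?thesis
    using dens_contract[where p = p and f = f and W = "W(e := M')", OF assms(1,3) loop] by (simp add: M'_def)
qed

text \<open>The connected side \<open>C\<close> may meet its complement in many vertices, but each
  component of the complement meets \<open>C\<close> in at most one. Such components are split off
  one at a time, from \<open>E\<close> and from \<open>E - C\<close> alike.\<close>

lemma dens_sep1:
  assumes "finite E" "C \<subseteq> E" "sep1 p E C" "edge_connected p C"
    and "\<And>e. e \<in> E \<Longrightarrow> inv_matrix (W e)"
  shows "dens p W E = dens p W C * dens p W (E - C)"
  using assms
proof (induction "card E" arbitrary: E rule: less_induct)
  case less
  show ?case
  proof (cases "C = E")
    case True then show ?thesis by simp
  next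
    case False
    obtain D a where D: "D \<subseteq> E - C" "D \<noteq> {}" "vset p D \<inter> vset p (E - D) \<subseteq> {a}"
        "vset p D \<inter> vset p (E - C - D) = {}"
      using sep1_block[OF less.prems(1,2) False less.prems(3,4)] by (elim exE conjE)
    have fin: "finite D" "finite (E - D)" "finite (E - C - D)"
      using D(1) less.prems(1) finite_subset by blast+
    have "dens p W ((E - D) \<union> D) = dens p W (E - D) * dens p W D"
      using fin D less.prems(5) by (intro dens_glue1[of _ _ _ a]) auto
    moreover have "(E - D) \<union> D = E" using D(1) by blast
    ultimately have 1: "dens p W E = dens p W (E - D) * dens p W D" by simp
    have "dens p W ((E - C - D) \<union> D) = dens p W (E - C - D) * dens p W D"
      using fin D less.prems(5) by (intro dens_glue1[of _ _ _ a]) auto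
    moreover have "(E - C - D) \<union> D = E - C" using D(1) by blast
    ultimately have 2: "dens p W (E - C) = dens p W (E - C - D) * dens p W D" by simp
    have "E - D \<subset> E" using D(1,2) by blast
    then have "card (E - D) < card E" by (rule psubset_card_mono[OF less.prems(1)])
    then have "dens p W (E - D) = dens p W C * dens p W (E - D - C)"
      using D(1) less.prems sep1_mono[of p E C "E - D"] fin(2) by (intro less.hyps) auto
    moreover have "E - D - C = E - C - D" by blast
    ultimately show ?thesis using 1 2 by (simp add: ac_simps)
  qed
qed

theorem dens_eq_if_same_even:
  assumes "finite E" "same_even p q E" "\<And>e. e \<in> E \<Longrightarrow> inv_matrix (W e)"
  shows "dens p W E = dens q W E"
  using assms
proof (induction "card E" arbitrary: E p q W rule: less_induct)
  case less
  note fin = less.prems(1) and same = less.prems(2) and invW = less.prems(3)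
  note IH = less.hyps
  consider (small) "card E \<le> 1"
    | (sep1) C where "C \<subseteq> E" "C \<noteq> {}" "C \<noteq> E" "sep1 p E C"
    | (parallel) e f where "2 \<le> card E" "\<And>C. C \<subseteq> E \<Longrightarrow> C \<noteq> {} \<Longrightarrow> C \<noteq> E \<Longrightarrow> \<not> sep1 p E C"
        "e \<in> E" "f \<in> E" "e \<noteq> f" "inc p e = inc p f"
    | (series) e f where "2 \<le> card E" "\<And>C. C \<subseteq> E \<Longrightarrow> C \<noteq> {} \<Longrightarrow> C \<noteq> E \<Longrightarrow> \<not> sep1 p E C"
        "e \<in> E" "f \<in> E" "e \<noteq> f"
        "\<And>Z. Z \<subseteq> E \<Longrightarrow> bdry p Z = {} \<Longrightarrow> e \<in> Z \<longleftrightarrow> f \<in> Z"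
    | (sep2) C where "2 \<le> card E" "\<And>C. C \<subseteq> E \<Longrightarrow> C \<noteq> {} \<Longrightarrow> C \<noteq> E \<Longrightarrow> \<not> sep1 p E C"
        "\<And>e f. e \<in> E \<Longrightarrow> f \<in> E \<Longrightarrow> e \<noteq> f \<Longrightarrow> inc p e \<noteq> inc p f"
        "\<And>e f. e \<in> E \<Longrightarrow> f \<in> E \<Longrightarrow> e \<noteq> f \<Longrightarrow>
           \<exists>Z\<subseteq>E. bdry p Z = {} \<and> \<not> (e \<in> Z \<longleftrightarrow> f \<in> Z)"
        "C \<subseteq> E" "2 \<le> card C" "2 \<le> card (E - C)" "sep2 p E C"
    | (connected) "2 \<le> card E" "\<And>C. C \<subseteq> E \<Longrightarrow> C \<noteq> {} \<Longrightarrow> C \<noteq> E \<Longrightarrow> \<not> sep1 p E C"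
        "\<And>e f. e \<in> E \<Longrightarrow> f \<in> E \<Longrightarrow> e \<noteq> f \<Longrightarrow> inc p e \<noteq> inc p f"
        "\<And>C. C \<subseteq> E \<Longrightarrow> 2 \<le> card C \<Longrightarrow> 2 \<le> card (E - C) \<Longrightarrow> \<not> sep2 p E C"
  proof (cases "card E \<le> 1")
    case True then show thesis by (rule that(1))
  next
    case False
    then have c2: "2 \<le> card E" by simp
    show thesis
    proof (cases "\<exists>C\<subseteq>E. C \<noteq> {} \<and> C \<noteq> E \<and> sep1 p E C")
      case True then show thesis using that(2) by blast
    next
      case no1: False
      then have no1': "C \<subseteq> E \<Longrightarrow> C \<noteq> {} \<Longrightarrow> C \<noteq> E \<Longrightarrow> \<not> sep1 p E C" for C by blast
      show thesis
      proof (cases "\<exists>e\<in>E. \<exists>f\<in>E. e \<noteq> f \<and> inc p e = inc p f")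
        case True then show thesis using that(3)[OF c2 no1'] by blast
      next
        case no_par: False
        then have no_par': "e \<in> E \<Longrightarrow> f \<in> E \<Longrightarrow> e \<noteq> f \<Longrightarrow> inc p e \<noteq> inc p f" for e f by blast
        \<comment> \<open>Series pairs are sought only in the presence of a 2-separation. A triangle
          has series pairs but too few edges for two sides of two edges each, and it counts as
          3-connected.\<close>
        show thesis
        proof (cases "\<exists>C\<subseteq>E. 2 \<le> card C \<and> 2 \<le> card (E - C) \<and> sep2 p E C")
          case False then show thesis using that(6)[OF c2 no1' no_par'] by blast
        next
          case True
          show thesis
          proof (cases "\<exists>e\<in>E. \<exists>f\<in>E. e \<noteq> f \<and> (\<forall>Z\<subseteq>E. bdry p Z = {} \<longrightarrow> (e \<in> Z \<longleftrightarrow> f \<in> Z))")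
            case True then show thesis using that(4)[OF c2 no1'] by blast
          next
            case False
            then have "\<exists>Z\<subseteq>E. bdry p Z = {} \<and> \<not> (e \<in> Z \<longleftrightarrow> f \<in> Z)" if "e \<in> E" "f \<in> E" "e \<noteq> f" for e f
              using that by blast
            then show thesis using that(5)[OF c2 no1' no_par'] True by blast
          qed
        qed
      qed
    qed
  qed
  then show ?case
  proof cases
    case small
    show ?thesis
    proof (cases "E = {}")
      case False
      then obtain e where e: "E = {e}" using small fin by (metis card_le_Suc0_iff_eq One_nat_def is_singletonI' is_singletonE)
      have loop: "fst (p e) = snd (p e) \<longleftrightarrow> fst (q e) = snd (q e)"
        using same unfolding same_even_def e by (metis bdry_singleton inc_empty_iff subset_refl)
      define m where "m v = (if v = fst (p e) then fst (q e) else snd (q e))" for v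
      have "dens q W E = dens p W E"
        unfolding e
      proof (rule dens_rename)
        show "inj_on m (vset p {e})" using loop by (auto simp: inj_on_def vset_def m_def)
      qed (use loop invW e in \<open>auto simp: m_def prod_eq_iff\<close>)
      then show ?thesis ..
    qed simp
  next
    case sep1
    obtain D where D: "D \<subseteq> E" "D \<noteq> {} \<and> sep1 p E D" "\<And>D'. D' \<subset> D \<Longrightarrow> \<not> (D' \<noteq> {} \<and> sep1 p E D')"
      by (rule minimal_subset[OF fin sep1(1), of "\<lambda>X. X \<noteq> {} \<and> sep1 p E X"]) (use sep1 in auto)
    have DE: "D \<noteq> E" using D(3)[of C] sep1 by blast
    have conn: "edge_connected p D"
      by (rule edge_connected_if_minimal_sep1[OF fin D(1) DE]) (use D in auto)
    have sq: "sep1 q E D" using sep1_same_even[OF same] D(2) by blast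
    \<comment> \<open>\<open>sep1\<close> depends on even sets only, so \<open>D\<close> is minimal
      for \<open>q\<close> too.\<close>
    have conn': "edge_connected q D"
    proof (rule edge_connected_if_minimal_sep1[OF fin D(1) DE sq])
      fix D' assume "D' \<subset> D" "D' \<noteq> {}"
      then show "\<not> sep1 q E D'" using D(3) sep1_same_even[OF same_even_sym[OF same]] by blast
    qed
    have "card D < card E" using D(1) DE fin by (simp add: psubset_card_mono psubsetI)
    then have "dens p W D = dens q W D"
      using D(1) fin invW same_even_mono[OF same] finite_subset by (intro IH) auto
    moreover have "E - D \<subset> E" using D(1,2) by blast
    then have "card (E - D) < card E" by (rule psubset_card_mono[OF fin])
    then have "dens p W (E - D) = dens q W (E - D)"
      using fin invW same_even_mono[OF same] by (intro IH) auto
    ultimately show ?thesis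
      using dens_sep1[OF fin D(1) _ conn invW] dens_sep1[OF fin D(1) sq conn' invW] D(2) by simp
  next
    case parallel
    have no_sep: "\<not> sep1 p E {e}" using parallel(1) parallel(2)[of "{e}"] parallel(3) by (cases "E = {e}") auto
    have same': "same_even p p E" by (simp add: same_even_def)
    have ef: "{e, f} \<subseteq> E" using parallel by blast
    have "bdry p {e, f} = {}" using parallel(5,6) by (simp add: bdry_insert)
    then have "bdry q {e, f} = {}" using same ef by (simp add: same_even_def)
    then have q: "inc q e = inc q f" using parallel(5) by (auto simp: bdry_insert)
    let ?W = "W(e := \<lambda>x y. W e x y * W f x y)"
    have "dens p W E = dens p ?W (E - {f})"
      by (rule dens_parallel[where e = e and f = f and W = W, OF fin parallel(3-6) inc_nonempty_if_no_sep1[OF same' parallel(3) no_sep] invW[OF parallel(4)]])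
    moreover have "dens q W E = dens q ?W (E - {f})"
      by (rule dens_parallel[where e = e and f = f and W = W, OF fin parallel(3-5) q inc_nonempty_if_no_sep1[OF same parallel(3) no_sep] invW[OF parallel(4)]])
    moreover have "dens p ?W (E - {f}) = dens q ?W (E - {f})"
    proof (rule IH)
      show "card (E - {f}) < card E" using parallel(4) fin by (meson card_Diff1_less)
      show "same_even p q (E - {f})" by (rule same_even_mono[OF same]) blast
      show "inv_matrix (?W g)" if "g \<in> E - {f}" for g
        using that invW parallel(3,4) by (auto intro!: inv_matrix_times)
    qed (use fin in simp)
    ultimately show ?thesis by simp
  next
    case series
    have q: "e \<in> Z \<longleftrightarrow> f \<in> Z" if "Z \<subseteq> E" "bdry q Z = {}" for Z
      using series(6)[of Z] that same by (auto simp: same_even_def)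
    have loop: "fst (p f) \<noteq> snd (p f)" "fst (q f) \<noteq> snd (q f)"
      using series(6)[of "{f}"] q[of "{f}"] series(4,5) by (auto simp: inc_empty_iff)
    let ?W = "W(e := \<lambda>x y. inverse (of_nat (card K)) * mmult (W f) (W e) x y)"
    have "dens p W E = dens (contract p f) ?W (E - {f})"
      by (rule dens_series[OF fin series(3-6) invW])
    moreover have "dens q W E = dens (contract q f) ?W (E - {f})"
      by (rule dens_series[OF fin series(3-5) q invW])
    moreover have "dens (contract p f) ?W (E - {f}) = dens (contract q f) ?W (E - {f})"
    proof (rule IH)
      show "card (E - {f}) < card E" using series(4) fin by (meson card_Diff1_less)
      show "same_even (contract p f) (contract q f) (E - {f})"
        by (rule same_even_contract[OF fin series(4) same loop])
      show "inv_matrix (?W g)" if "g \<in> E - {f}" for g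
        using that invW series(3,4) by (auto intro!: inv_matrix_scale inv_matrix_mmult)
    qed (use fin in simp)
    ultimately show ?thesis by simp
  next
    case sep2
    let ?P = "\<lambda>D. 2 \<le> card D \<and> 2 \<le> card (E - D) \<and> sep2 p E D"
    obtain C where C: "C \<subseteq> E" "?P C" and min: "\<And>D. D \<subset> C \<Longrightarrow> \<not> ?P D"
      by (rule minimal_subset[OF fin sep2(5), of ?P]) (use sep2 in auto)
    have finC: "finite C" "finite (E - C)" using C(1) fin finite_subset by auto
    \<comment> \<open>A side \<open>{e, f}\<close> would be a parallel or a series pair. Without
      parallel edges and loops no nonempty subset of it is even. If the pair is not in series, an
      even set \<open>Y\<close> through exactly one of its edges and an even set \<open>Z\<close>
      through the other have nonempty traces, and so has their sum, against
      \<open>sep2\<close>.\<close>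
    have cC: "2 < card C"
    proof (rule ccontr)
      assume "\<not> 2 < card C"
      then have "card C = 2" using C(2) by simp
      then obtain e f where ef: "C = {e, f}" "e \<noteq> f" by (auto simp: card_2_iff)
      then have E: "e \<in> E" "f \<in> E" using C(1) by auto
      have through: "\<exists>Z\<subseteq>E. bdry p Z = {} \<and> g \<in> Z" if "g \<in> E" for g
      proof (rule ccontr)
        assume "\<not> ?thesis"
        then have "Z \<inter> {g} = {}" if "Z \<subseteq> E" "bdry p Z = {}" for Z using that by blast
        then have "sep1 p E {g}" by (simp add: sep1_def)
        then show False using sep2(1) sep2(2)[of "{g}"] that by (cases "E = {g}") auto
      qed
      have no_sep: "\<not> sep1 p E {g}" if "g \<in> E" for g
        using sep2(1) sep2(2)[of "{g}"] that by (cases "E = {g}") auto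
      have "same_even p p E" by (simp add: same_even_def)
      then have "inc p e \<noteq> {}" "inc p f \<noteq> {}"
        using inc_nonempty_if_no_sep1 E no_sep by metis+
      moreover have "bdry p {e, f} \<noteq> {}"
        using sep2(3)[OF E ef(2)] bdry_insert[of "{f}" e p] ef(2) by auto
      moreover have "Q = {e} \<or> Q = {f} \<or> Q = {e, f}" if "Q \<subseteq> {e, f}" "Q \<noteq> {}" for Q
        using that by auto
      ultimately have odd: "bdry p Q \<noteq> {}" if "Q \<subseteq> {e, f}" "Q \<noteq> {}" for Q
        using that bdry_singleton by metis
      obtain Y where Y: "Y \<subseteq> E" "bdry p Y = {}" "\<not> (e \<in> Y \<longleftrightarrow> f \<in> Y)" using sep2(4)[OF E ef(2)] by blast
      define g where "g = (if e \<in> Y then f else e)"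
      have g: "g \<in> E" "g \<in> C" "g \<notin> Y" using E Y(3) ef(1) by (auto simp: g_def)
      obtain Z where Z: "Z \<subseteq> E" "bdry p Z = {}" "g \<in> Z" using through[OF g(1)] by blast
      have "bdry p (Y \<inter> C) = {} \<or> bdry p (Z \<inter> C) = {} \<or> bdry p (sym_diff Y Z \<inter> C) = {}"
        using conjunct2[OF conjunct2[OF C(2)], unfolded sep2_def, rule_format, OF Y(1) Z(1) Y(2) Z(2)] .
      moreover have "Y \<inter> C \<noteq> {}" "Z \<inter> C \<noteq> {}" "sym_diff Y Z \<inter> C \<noteq> {}"
        using Y(3) Z(3) g ef(1) by auto
      ultimately show False using odd ef(1) by (metis inf_le2)
    qed
    have conn: "edge_connected p C"
      by (rule edge_connected_if_minimal_sep2[OF fin C(1)]) (use C(2) cC min in auto)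
    have sq: "sep2 q E C" using sep2_same_even[OF same] C(2) by blast
    have conn': "edge_connected q C"
    proof (rule edge_connected_if_minimal_sep2[OF fin C(1) sq _ cC])
      fix D assume D: "D \<subset> C" "2 \<le> card D" "2 \<le> card (E - D)"
      show "\<not> sep2 q E D" using min[OF D(1)] D(2,3) sep2_same_even[OF same_even_sym[OF same]] by blast
    qed (use C(2) in blast)
    have no1': "\<not> sep1 q E D" if "D \<subseteq> E" "D \<noteq> {}" "D \<noteq> E" for D
      using sep2(2)[OF that] sep1_same_even[OF same_even_sym[OF same]] by blast
    have CE: "C \<noteq> {}" "C \<noteq> E" using C(2) by auto
    have "\<exists>a b P Q. a \<noteq> b \<and> vset p C \<inter> vset p (E - C) = {a, b} \<and>
        P \<subseteq> C \<and> bdry p P = {a, b} \<and> Q \<subseteq> E - C \<and> bdry p Q = {a, b}"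
      by (rule sep2_attachments[OF fin C(1) CE _ conn]) (use C(2) in blast, rule sep2(2))
    then obtain a b P Q where ab: "a \<noteq> b" "vset p C \<inter> vset p (E - C) = {a, b}"
      "P \<subseteq> C" "bdry p P = {a, b}" "Q \<subseteq> E - C" "bdry p Q = {a, b}"
      by (elim exE conjE)
    have "\<exists>a b P Q. a \<noteq> b \<and> vset q C \<inter> vset q (E - C) = {a, b} \<and>
        P \<subseteq> C \<and> bdry q P = {a, b} \<and> Q \<subseteq> E - C \<and> bdry q Q = {a, b}"
      by (rule sep2_attachments[OF fin C(1) CE sq conn']) (rule no1')
    then obtain a' b' P' Q' where ab': "a' \<noteq> b'" "vset q C \<inter> vset q (E - C) = {a', b'}"
      "P' \<subseteq> C" "bdry q P' = {a', b'}" "Q' \<subseteq> E - C" "bdry q Q' = {a', b'}"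
      by (elim exE conjE)
    let ?D = "E - C"
    have D: "?D \<subseteq> E" "E - ?D = C" using C(1) by auto
    have vD: "vset p ?D \<inter> vset p (E - ?D) \<subseteq> {a, b}" "vset q ?D \<inter> vset q (E - ?D) \<subseteq> {a', b'}"
      unfolding D(2) using ab(2) ab'(2) by (simp_all add: inf_commute)
    have PD: "P \<subseteq> E - ?D" "P' \<subseteq> E - ?D" unfolding D(2) by (rule ab(3), rule ab'(3))
    note same' = same_even_sym[OF same]
    have halfC: "bdry p X = {a, b} \<longleftrightarrow> bdry q X = {a', b'}" if "X \<subseteq> C" for X
      using bdry_half[OF fin same C(1) equalityD1[OF ab'(2)] ab(5,6) that]
        bdry_half[OF fin same' C(1) equalityD1[OF ab(2)] ab'(5,6) that] by (rule iffI)
    have halfD: "bdry p X = {a, b} \<longleftrightarrow> bdry q X = {a', b'}" if "X \<subseteq> ?D" for X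
      using bdry_half[OF fin same D(1) vD(2) PD(1) ab(4) that]
        bdry_half[OF fin same' D(1) vD(1) PD(2) ab'(4) that] by (rule iffI)
    \<comment> \<open>An edge of each side lends its name to the virtual edge that replaces this
      side. As both sides have at least two edges, the reduced graphs have fewer edges than
      \<open>E\<close>.\<close>
    obtain e where e: "e \<in> ?D" using C(2) by (metis card.empty ex_in_conv not_numeral_le_zero)
    obtain f where f: "f \<in> C" using CE(1) by blast
    let ?c = "of_nat (card K) ^ 2"
    let ?J = "\<lambda>X x y. ?c * joint p W X a b x y" and ?J' = "\<lambda>X x y. ?c * joint q W X a' b' x y"
    have invJ: "inv_matrix (?J X)" "inv_matrix (?J' X)" if "X \<subseteq> E" for X
      using that fin finite_subset invW by (auto intro!: inv_matrix_scale inv_matrix_joint)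
    have E: "E = C \<union> ?D" using C(1) by blast
    have "dens p W E = dens p W (C \<union> ?D)" by (rule arg_cong[OF E])
    also have "\<dots> = ?c * (\<Sum>x\<in>K. \<Sum>y\<in>K. joint p W C a b x y * joint p W ?D a b x y)"
      using finC ab by (intro dens_glue2) auto
    also have "\<dots> = dens (p(e := (a, b))) (W(e := ?J ?D)) (insert e C)"
      using e finC(1) by (subst dens_insert_edge) (auto simp: sum_distrib_left ac_simps)
    also have "\<dots> = dens (q(e := (a', b'))) (W(e := ?J ?D)) (insert e C)"
    proof (rule IH)
      have "card (insert e C) = Suc (card C)" using finC(1) e by simp
      moreover have "2 \<le> card E - card C"
        using card_Diff_subset[OF finC(1) C(1)] C(2) by simp
      ultimately show "card (insert e C) < card E" by linarith
      show "same_even (p(e := (a, b))) (q(e := (a', b'))) (insert e C)"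
        by (rule same_even_virtual_edge[OF finC(1) same_even_mono[OF same C(1)] _ ab(1) ab'(1) halfC])
          (use e in blast)
      show "inv_matrix ((W(e := ?J ?D)) g)" if "g \<in> insert e C" for g
        using that invW C(1) invJ(1)[OF D(1)] by auto
    qed (use finC in simp)
    \<comment> \<open>Both densities pair the distribution of \<open>C\<close> in \<open>q\<close>
      with that of \<open>?D\<close> in \<open>p\<close>. The two sides are thus carried from
      \<open>p\<close> to \<open>q\<close> one after the other.\<close>
    also have "\<dots> = dens (p(f := (a, b))) (W(f := ?J' C)) (insert f ?D)"
      using e f finC by (subst (1 2) dens_insert_edge) (auto simp: ac_simps)
    also have "\<dots> = dens (q(f := (a', b'))) (W(f := ?J' C)) (insert f ?D)"
    proof (rule IH)
      have "card (insert f ?D) = Suc (card ?D)" using finC(2) f by simp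
      moreover have "card ?D = card E - card C" "card C \<le> card E"
        using card_Diff_subset[OF finC(1) C(1)] card_mono[OF fin C(1)] by auto
      ultimately show "card (insert f ?D) < card E" using cC by linarith
      show "same_even (p(f := (a, b))) (q(f := (a', b'))) (insert f ?D)"
        by (rule same_even_virtual_edge[OF finC(2) same_even_mono[OF same D(1)] _ ab(1) ab'(1) halfD])
          (use f in blast)
      show "inv_matrix ((W(f := ?J' C)) g)" if "g \<in> insert f ?D" for g
        using that invW invJ(2)[OF C(1)] by auto
    qed (use finC in simp)
    also have "\<dots> = ?c * (\<Sum>x\<in>K. \<Sum>y\<in>K. joint q W C a' b' x y * joint q W ?D a' b' x y)"
      using f finC(2) by (subst dens_insert_edge) (auto simp: sum_distrib_left ac_simps)
    also have "\<dots> = dens q W (C \<union> ?D)"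
      using finC ab' by (intro dens_glue2[symmetric]) auto
    also have "\<dots> = dens q W E" by (rule arg_cong[OF E[symmetric]])
    finally show ?thesis .
  next
    case connected
    interpret connected3 p E by standard (use fin connected in auto)
    obtain m where "inj_on m (vset p E)"
      "\<And>e. e \<in> E \<Longrightarrow> q e = (m (fst (p e)), m (snd (p e))) \<or> q e = (m (snd (p e)), m (fst (p e)))"
      using isomorphic_if_same_even[OF same connected(3)] by blast
    then show ?thesis using dens_rename[OF fin _ invW, where m = m and p = p and q = q] by simp
  qed
qed

end

section \<open>Circuits and even sets\<close>

lemma joins_inc: "joins F e a b \<Longrightarrow> inc (ends F) e = sym_diff {a} {b}"
  unfolding joins_def by (elim disjE) (auto simp: inc_def)

lemma inc_joins: "v \<in> inc (ends F) e \<Longrightarrow> \<exists>u. u \<noteq> v \<and> joins F e v u"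
  by (cases "ends F e") (auto simp: joins_def inc_def)

lemma cyclic_succ_inj:
  fixes i m k :: nat
  assumes "i < k" "m < k" "(i + 1) mod k = (m + 1) mod k" shows "i = m"
  using assms by (auto simp: mod_Suc split: if_splits)

lemma cyclic_succ_neq:
  fixes i k :: nat
  assumes "i < k" "2 \<le> k" shows "(i + 1) mod k \<noteq> i"
  using assms by (auto simp: mod_Suc)

text \<open>For length one the edge is a loop, which \<open>inc\<close> ignores; hence the bound on
  the length and the separate case in the lemmas that use this.\<close>

lemma cycle_star:
  assumes len: "length vs = length es" and k: "2 \<le> length es" "distinct vs"
    and joins: "\<And>i. i < length es \<Longrightarrow> joins F (es ! i) (vs ! i) (vs ! ((i + 1) mod length es))"
    and i: "i < length es"
  shows "{e \<in> set es. vs ! ((i + 1) mod length es) \<in> inc (ends F) e} = {es ! i, es ! ((i + 1) mod length es)}"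
proof -
  let ?k = "length es" and ?s = "\<lambda>i. (i + 1) mod length es"
  have s: "?s m < ?k" for m using k(1) by (intro mod_less_divisor) linarith
  have inc: "inc (ends F) (es ! m) = {vs ! m, vs ! ?s m}" if "m < ?k" for m
  proof -
    have "vs ! m \<noteq> vs ! ?s m"
      using cyclic_succ_neq[OF that k(1)] that s len k(2) by (metis nth_eq_iff_index_eq)
    then show ?thesis using joins_inc[OF joins[OF that]] by auto
  qed
  have "vs ! ?s i \<in> inc (ends F) (es ! m) \<longleftrightarrow> m = i \<or> m = ?s i" if m: "m < ?k" for m
  proof -
    have "vs ! ?s i = vs ! m \<longleftrightarrow> m = ?s i" "vs ! ?s i = vs ! ?s m \<longleftrightarrow> ?s i = ?s m"
      using m s len k(2) by (metis nth_eq_iff_index_eq)+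
    moreover have "?s i = ?s m \<longleftrightarrow> m = i" using cyclic_succ_inj[OF i m] by blast
    ultimately show ?thesis using inc[OF m] by auto
  qed
  then show ?thesis using i s[of i] by (auto simp: in_set_conv_nth)
qed

lemma cycle_even:
  assumes "is_cycle_edgeset F C" shows "bdry (ends F) C = {}"
proof -
  obtain vs es where c: "length vs = length es" "length es \<ge> 1" "distinct vs" "distinct es"
    "\<And>i. i < length es \<Longrightarrow> joins F (es ! i) (vs ! i) (vs ! ((i + 1) mod length es))" "C = set es"
    using assms unfolding is_cycle_edgeset_def by blast
  show ?thesis
  proof (cases "length es = 1")
    case True
    then obtain e where "es = [e]" by (auto simp: length_Suc_conv)
    then show ?thesis using c(5)[of 0] c(6) joins_inc by fastforce
  next
    case False
    then have k: "2 \<le> length es" using c(2) by linarith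
    have "even (card {e \<in> C. v \<in> inc (ends F) e})" for v
    proof (cases "\<exists>i<length es. v = vs ! ((i + 1) mod length es)")
      case True
      then obtain i where i: "i < length es" "v = vs ! ((i + 1) mod length es)" by blast
      have "(i + 1) mod length es < length es" using k by (intro mod_less_divisor) linarith
      then have "es ! i \<noteq> es ! ((i + 1) mod length es)"
        using cyclic_succ_neq[OF i(1) k] i(1) c(4) by (metis nth_eq_iff_index_eq)
      moreover have "{e \<in> set es. vs ! ((i + 1) mod length es) \<in> inc (ends F) e} = {es ! i, es ! ((i + 1) mod length es)}"
        by (rule cycle_star[OF c(1) k c(3) _ i(1)]) (rule c(5))
      ultimately show ?thesis unfolding i(2) c(6) by simp
    next
      case False
      have "v \<notin> inc (ends F) e" if eC: "e \<in> C" for e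
      proof
        assume v: "v \<in> inc (ends F) e"
        obtain m where m: "m < length es" "e = es ! m" using eC unfolding c(6) in_set_conv_nth by blast
        have "v = vs ! m \<or> v = vs ! ((m + 1) mod length es)"
          using v joins_inc[OF c(5)[OF m(1)]] m(2) by blast
        then have "v = vs ! m" using False m(1) by blast
        define i where "i = (if m = 0 then length es - 1 else m - 1)"
        have "i < length es" "(i + 1) mod length es = m" using m(1) k by (auto simp: i_def)
        then show False using False \<open>v = vs ! m\<close> by metis
      qed
      then have "{e \<in> C. v \<in> inc (ends F) e} = {}" by blast
      then show ?thesis by (metis card.empty even_zero)
    qed
    then show ?thesis by (auto simp: bdry_def)
  qed
qed

text \<open>An even subset that contains one edge of the cycle contains the next one, since the
  vertex between them meets no other edge of the cycle.\<close>

lemma cycle_minimal: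
  assumes "is_cycle_edgeset F C" "Z \<subseteq> C" "Z \<noteq> {}" "bdry (ends F) Z = {}"
  shows "Z = C"
proof -
  obtain vs es where c: "length vs = length es" "length es \<ge> 1" "distinct vs" "distinct es"
    "\<And>i. i < length es \<Longrightarrow> joins F (es ! i) (vs ! i) (vs ! ((i + 1) mod length es))" "C = set es"
    using assms unfolding is_cycle_edgeset_def by blast
  show ?thesis
  proof (cases "length es = 1")
    case True
    then obtain e where "es = [e]" by (auto simp: length_Suc_conv)
    then show ?thesis using assms(2,3) c(6) by auto
  next
    case False
    then have k: "2 \<le> length es" using c(2) by linarith
    let ?k = "length es"
    have step: "es ! ((i + 1) mod ?k) \<in> Z" if i: "i < ?k" "es ! i \<in> Z" for i
    proof (rule ccontr)
      assume n: "es ! ((i + 1) mod ?k) \<notin> Z"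
      let ?v = "vs ! ((i + 1) mod ?k)"
      have star: "{e \<in> set es. ?v \<in> inc (ends F) e} = {es ! i, es ! ((i + 1) mod ?k)}"
        by (rule cycle_star[OF c(1) k c(3) _ i(1)]) (rule c(5))
      have "{e \<in> Z. ?v \<in> inc (ends F) e} = {e \<in> set es. ?v \<in> inc (ends F) e} \<inter> Z"
        using assms(2) c(6) by blast
      also have "\<dots> = {es ! i}"
        unfolding star using n i(2) by blast
      finally have "?v \<in> bdry (ends F) Z" by (simp add: bdry_def)
      then show False using assms(4) by blast
    qed
    obtain i where i: "i < ?k" "es ! i \<in> Z"
      using assms(2,3) c(6) by (metis ex_in_conv in_set_conv_nth subsetD)
    have all: "es ! ((i + n) mod ?k) \<in> Z" for n
    proof (induction n)
      case 0 then show ?case using i by simp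
    next
      case (Suc n)
      have "(i + n) mod ?k < ?k" using k by (intro mod_less_divisor) linarith
      from step[OF this Suc] show ?case by (simp add: mod_Suc_eq)
    qed
    have "es ! m \<in> Z" if "m < ?k" for m
      using all[of "m + ?k - i"] that i(1) by simp
    then show ?thesis using assms(2) c(6) by (auto simp: in_set_conv_nth)
  qed
qed

text \<open>At the first vertex of a longest path there is a further edge, which closes a cycle.\<close>

lemma even_contains_cycle:
  assumes wf: "wf_mgraph F" and Z: "Z \<subseteq> edges F" "Z \<noteq> {}" "bdry (ends F) Z = {}"
  shows "\<exists>C\<subseteq>Z. is_cycle_edgeset F C"
proof (cases "\<exists>e\<in>Z. fst (ends F e) = snd (ends F e)")
  case True
  then obtain e where e: "e \<in> Z" "fst (ends F e) = snd (ends F e)" by blast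
  let ?v = "fst (ends F e)"
  have "joins F e ?v ?v" using e(2) by (simp add: joins_def prod_eq_iff)
  moreover have "?v \<in> verts F" "e \<in> edges F" using e(1) Z(1) wf by (auto simp: wf_mgraph_def)
  ultimately have "is_cycle_edgeset F {e}"
    unfolding is_cycle_edgeset_def by (intro exI[of _ "[?v]"] exI[of _ "[e]"]) simp
  then show ?thesis using e(1) by blast
next
  case False
  define path where "path vs es \<longleftrightarrow> length vs = Suc (length es) \<and> distinct vs \<and> set es \<subseteq> Z \<and>
     set vs \<subseteq> verts F \<and> (\<forall>i<length es. joins F (es ! i) (vs ! i) (vs ! Suc i))" for vs es
  have verts: "a \<in> verts F" "b \<in> verts F" if "e \<in> Z" "joins F e a b" for e a b
    using that Z(1) wf unfolding wf_mgraph_def joins_def by force+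
  have finV: "finite (verts F)" using wf by (simp add: wf_mgraph_def)
  obtain e where e: "e \<in> Z" using Z(2) by blast
  have "fst (ends F e) \<in> inc (ends F) e" using e False by (auto simp: inc_def)
  then obtain u where u: "u \<noteq> fst (ends F e)" "joins F e (fst (ends F e)) u" using inc_joins by metis
  have "path [fst (ends F e), u] [e]"
    using u e verts[OF e u(2)] by (auto simp: path_def)
  then have path1: "\<exists>vs es. path vs es \<and> length es = 1" by force
  have "length es \<le> card (verts F)" if "path vs es" for vs es
    using that card_mono[OF finV, of "set vs"] distinct_card[of vs] by (auto simp: path_def)
  then have "\<exists>k. (\<exists>vs es. path vs es \<and> length es = k) \<and> (\<forall>l. (\<exists>vs es. path vs es \<and> length es = l) \<longrightarrow> l \<le> k)"
    by (intro ex_has_greatest_nat[of "\<lambda>l. \<exists>vs es. path vs es \<and> length es = l" 1 "\<lambda>k. k" "Suc (card (verts F))", OF path1])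
      (auto simp: less_Suc_eq_le)
  then obtain k where k: "\<exists>vs es. path vs es \<and> length es = k" "k \<ge> 1"
    and max: "\<And>vs es. path vs es \<Longrightarrow> length es \<le> k"
    using path1 by blast
  obtain vs es where P: "path vs es" "length es = k" using k(1) by blast
  have len: "length vs = Suc k" and dist: "distinct vs" and sub: "set es \<subseteq> Z" "set vs \<subseteq> verts F"
    and joins: "\<And>i. i < k \<Longrightarrow> joins F (es ! i) (vs ! i) (vs ! Suc i)"
    using P by (auto simp: path_def)
  have neq: "vs ! i = vs ! j \<longleftrightarrow> i = j" if "i \<le> k" "j \<le> k" for i j
    using that dist len by (simp add: nth_eq_iff_index_eq)
  have ends_es: "inc (ends F) (es ! i) = {vs ! i, vs ! Suc i}" if "i < k" for i
    using joins_inc[OF joins[OF that]] neq[of i "Suc i"] that by auto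
  have e0: "es ! 0 \<in> Z" using sub(1) k(2) P(2) by (metis Suc_le_lessD One_nat_def nth_mem subsetD)
  let ?S = "{e \<in> Z. vs ! 0 \<in> inc (ends F) e}"
  have "even (card ?S)" using Z(3) by (auto simp: bdry_def)
  moreover have "es ! 0 \<in> ?S" using e0 ends_es[of 0] k(2) by simp
  ultimately have "?S \<noteq> {es ! 0}" by (metis card_1_singleton_iff odd_one One_nat_def)
  then obtain e1 where e1: "e1 \<in> Z" "vs ! 0 \<in> inc (ends F) e1" "e1 \<noteq> es ! 0"
    using \<open>es ! 0 \<in> ?S\<close> by blast
  obtain w where w: "w \<noteq> vs ! 0" "joins F e1 (vs ! 0) w" using inc_joins[OF e1(2)] by blast
  have "w \<in> set vs"
  proof (rule ccontr)
    assume "w \<notin> set vs"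
    have "joins F e1 w (vs ! 0)" using w(2) by (auto simp: joins_def)
    then have "joins F ((e1 # es) ! i) ((w # vs) ! i) ((w # vs) ! Suc i)" if "i < Suc k" for i
      using that joins by (cases i) auto
    then have "path (w # vs) (e1 # es)"
      using \<open>w \<notin> set vs\<close> len dist sub e1(1) verts[OF e1(1) w(2)] P(2) by (auto simp: path_def)
    then show False using max[of "w # vs" "e1 # es"] P(2) by simp
  qed
  then obtain j where j: "j \<le> k" "w = vs ! j" by (metis in_set_conv_nth len less_Suc_eq_le)
  have j1: "1 \<le> j" using w(1) j(2) by (cases j) auto
  \<comment> \<open>The path up to the vertex where \<open>e1\<close> returns, closed by
    \<open>e1\<close>; for \<open>j = 1\<close> this is a pair of parallel edges.\<close>
  let ?vs = "take (Suc j) vs" and ?es = "take j es @ [e1]"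
  have lens: "length ?vs = Suc j" "length ?es = Suc j" using len j(1) P(2) by auto
  have inj: "a = b" if "a < k" "b < k" "es ! a = es ! b" for a b
  proof -
    have "{vs ! a, vs ! Suc a} = {vs ! b, vs ! Suc b}" using ends_es that by metis
    then have "vs ! a = vs ! b \<or> vs ! a = vs ! Suc b \<and> vs ! Suc a = vs ! b"
      by (auto simp: doubleton_eq_iff)
    then show ?thesis using neq that by auto
  qed
  then have "distinct es" using P(2) by (auto simp: distinct_conv_nth)
  moreover have "e1 \<notin> set (take j es)"
  proof
    assume "e1 \<in> set (take j es)"
    then obtain a where a: "a < j" "e1 = es ! a" using P(2) j(1) by (auto simp: in_set_conv_nth)
    then have "vs ! 0 = vs ! a \<or> vs ! 0 = vs ! Suc a" using e1(2) ends_es[of a] j(1) by auto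
    then have "a = 0" using neq[of 0 a] neq[of 0 "Suc a"] a(1) j(1) by auto
    then show False using a(2) e1(3) by simp
  qed
  ultimately have "distinct ?es" by simp
  moreover have "joins F (?es ! i) (?vs ! i) (?vs ! ((i + 1) mod Suc j))" if i: "i < Suc j" for i
  proof (cases "i < j")
    case True
    then show ?thesis using joins[of i] j(1) P(2) by (simp add: nth_append)
  next
    case False
    then have "i = j" using i by simp
    moreover have "joins F e1 w (vs ! 0)" using w(2) by (auto simp: joins_def)
    ultimately show ?thesis using j P(2) by (simp add: nth_append)
  qed
  moreover have "set ?es \<subseteq> Z" using sub(1) e1(1) set_take_subset[of j es] by auto
  moreover have "set ?vs \<subseteq> verts F" using sub(2) set_take_subset[of "Suc j" vs] by blast
  moreover have "distinct ?vs" using dist by simp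
  ultimately have "is_cycle_edgeset F (set ?es)"
    unfolding is_cycle_edgeset_def using Z(1) lens
    by (intro exI[of _ ?vs] exI[of _ ?es]) auto
  then show ?thesis using \<open>set ?es \<subseteq> Z\<close> by blast
qed

lemma cycle_nonempty: "is_cycle_edgeset F C \<Longrightarrow> C \<noteq> {} \<and> C \<subseteq> edges F"
  unfolding is_cycle_edgeset_def by auto

lemma cycle_iff_minimal_even:
  assumes "wf_mgraph F" "C \<subseteq> edges F"
  shows "is_cycle_edgeset F C \<longleftrightarrow>
    C \<noteq> {} \<and> bdry (ends F) C = {} \<and> (\<forall>Z\<subseteq>C. Z \<noteq> {} \<longrightarrow> bdry (ends F) Z = {} \<longrightarrow> Z = C)"
proof
  assume "is_cycle_edgeset F C"
  then show "C \<noteq> {} \<and> bdry (ends F) C = {} \<and> (\<forall>Z\<subseteq>C. Z \<noteq> {} \<longrightarrow> bdry (ends F) Z = {} \<longrightarrow> Z = C)"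
    using cycle_even cycle_minimal cycle_nonempty by metis
next
  assume C: "C \<noteq> {} \<and> bdry (ends F) C = {} \<and> (\<forall>Z\<subseteq>C. Z \<noteq> {} \<longrightarrow> bdry (ends F) Z = {} \<longrightarrow> Z = C)"
  obtain Z where Z: "Z \<subseteq> C" "is_cycle_edgeset F Z"
    using even_contains_cycle[OF assms] C by blast
  then have "Z = C" using C cycle_even[OF Z(2)] cycle_nonempty[OF Z(2)] by blast
  then show "is_cycle_edgeset F C" using Z(2) by simp
qed

lemma cycle_matroid_iso_if_same_even:
  assumes "wf_mgraph F" "wf_mgraph F'" "edges F = edges F'" "same_even (ends F) (ends F') (edges F)"
  shows "cycle_matroid_iso F F'"
  unfolding cycle_matroid_iso_def
proof (intro exI[of _ id] conjI allI impI)
  fix C assume C: "C \<subseteq> edges F"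
  have "bdry (ends F) Z = {} \<longleftrightarrow> bdry (ends F') Z = {}" if "Z \<subseteq> C" for Z
    using assms(4) that C unfolding same_even_def by (meson order_trans)
  then show "is_cycle_edgeset F C \<longleftrightarrow> is_cycle_edgeset F' (id ` C)"
    using cycle_iff_minimal_even[OF assms(1) C] cycle_iff_minimal_even[OF assms(2)] C assms(3) by auto
qed (use assms(3) in simp)

text \<open>Sets that are even for both \<open>p\<close> and \<open>q\<close> are peeled off one by
  one; the rest stays even for \<open>p\<close>, so the hypothesis keeps providing the next one. In
  use these sets are cycles.\<close>

lemma bdry_if_contains_even:
  assumes "finite Z" "bdry p Z = {}"
    and "\<And>Y. Y \<subseteq> Z \<Longrightarrow> Y \<noteq> {} \<Longrightarrow> bdry p Y = {} \<Longrightarrow>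
      \<exists>C\<subseteq>Y. C \<noteq> {} \<and> bdry p C = {} \<and> bdry q C = {}"
  shows "bdry q Z = {}"
  using assms
proof (induction Z rule: finite_psubset_induct)
  case (psubset Z)
  show ?case
  proof (cases "Z = {}")
    case False
    obtain C where C: "C \<subseteq> Z" "C \<noteq> {}" "bdry p C = {}" "bdry q C = {}"
      using psubset.prems(2)[OF order_refl False psubset.prems(1)] by blast
    have fin: "finite C" "finite (Z - C)" using C(1) psubset.hyps finite_subset by auto
    have Z: "Z = C \<union> (Z - C)" "C \<inter> (Z - C) = {}" using C(1) by auto
    have "bdry p (Z - C) = {}"
      using bdry_split[OF psubset.hyps psubset.prems(1), of C] C(1,3) by (simp add: Int_absorb1)
    moreover have "Z - C \<subset> Z" using C(1,2) by blast
    ultimately have "bdry q (Z - C) = {}"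
      using psubset.prems(2) by (intro psubset.IH) (blast intro: order_trans)+
    then have "bdry q (C \<union> (Z - C)) = {}" by (simp only: bdry_Un_disjoint[OF fin Z(2)] C(4)) simp
    then show ?thesis using Z(1) by simp
  qed simp
qed

lemma bdry_image: "inj_on f Z \<Longrightarrow> bdry (p \<circ> f) Z = bdry p (f ` Z)"
proof -
  assume inj: "inj_on f Z"
  have "{e \<in> f ` Z. v \<in> inc p e} = f ` {e \<in> Z. v \<in> inc (p \<circ> f) e}" for v
    by (auto simp: inc_def)
  moreover have "card (f ` {e \<in> Z. v \<in> inc (p \<circ> f) e}) = card {e \<in> Z. v \<in> inc (p \<circ> f) e}" for v
    using inj by (intro card_image) (auto intro: inj_on_subset)
  ultimately show ?thesis by (simp add: bdry_def)
qed

lemma same_even_if_cycles: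
  assumes wf: "wf_mgraph F" "wf_mgraph F'" and f: "bij_betw f (edges F) (edges F')"
    and iso: "\<And>C. C \<subseteq> edges F \<Longrightarrow> is_cycle_edgeset F C \<longleftrightarrow> is_cycle_edgeset F' (f ` C)"
  shows "same_even (ends F) (ends F' \<circ> f) (edges F)"
  unfolding same_even_def
proof (intro allI impI iffI)
  have image: "bdry (ends F' \<circ> f) Z = bdry (ends F') (f ` Z)" if "Z \<subseteq> edges F" for Z
    using that f by (intro bdry_image) (auto simp: bij_betw_def intro: inj_on_subset)
  fix Z assume Z: "Z \<subseteq> edges F"
  then have fin: "finite Z" using wf(1) finite_subset by (auto simp: wf_mgraph_def)
  { assume even: "bdry (ends F) Z = {}"
    show "bdry (ends F' \<circ> f) Z = {}"
    proof (rule bdry_if_contains_even[OF fin even])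
      fix Y assume Y: "Y \<subseteq> Z" "Y \<noteq> {}" "bdry (ends F) Y = {}"
      then obtain C where C: "C \<subseteq> Y" "is_cycle_edgeset F C"
        using even_contains_cycle[OF wf(1)] Z by (meson order_trans)
      have CE: "C \<subseteq> edges F" using C(1) Y(1) Z by blast
      then have "bdry (ends F' \<circ> f) C = {}" using image iso C(2) cycle_even by metis
      then show "\<exists>C\<subseteq>Y. C \<noteq> {} \<and> bdry (ends F) C = {} \<and> bdry (ends F' \<circ> f) C = {}"
        using C cycle_even cycle_nonempty by metis
    qed }
  { assume even: "bdry (ends F' \<circ> f) Z = {}"
    show "bdry (ends F) Z = {}"
    proof (rule bdry_if_contains_even[OF fin even])
      fix Y assume Y: "Y \<subseteq> Z" "Y \<noteq> {}" "bdry (ends F' \<circ> f) Y = {}"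
      then have YE: "Y \<subseteq> edges F" using Z by blast
      then have "f ` Y \<subseteq> edges F'" using f by (auto simp: bij_betw_def)
      then obtain C' where C': "C' \<subseteq> f ` Y" "is_cycle_edgeset F' C'"
        using even_contains_cycle[OF wf(2)] Y image[OF YE] by (metis image_is_empty)
      obtain C where C: "C \<subseteq> Y" "C' = f ` C" using C'(1) by (meson subset_imageE)
      have CE: "C \<subseteq> edges F" using C(1) YE by blast
      then have "is_cycle_edgeset F C" using iso C'(2) C(2) by blast
      moreover have "bdry (ends F' \<circ> f) C = {}" using image[OF CE] C(2) cycle_even[OF C'(2)] by simp
      ultimately show "\<exists>C\<subseteq>Y. C \<noteq> {} \<and> bdry (ends F' \<circ> f) C = {} \<and> bdry (ends F) C = {}"
        using C(1) cycle_even cycle_nonempty by metis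
    qed }
qed

section \<open>Homomorphism densities and components\<close>

text \<open>Such a colouring is a free choice of one colour for each component.\<close>

lemma card_constant_colourings:
  assumes wf: "wf_mgraph F" and "finite K"
  shows "card {\<phi> \<in> verts F \<rightarrow>\<^sub>E K. \<forall>e\<in>edges F. \<phi> (fst (ends F e)) = \<phi> (snd (ends F e))} = card K ^ num_components F"
proof -
  let ?V = "verts F"
  define R where "R = (adj_rel F)\<^sup>* \<inter> (?V \<times> ?V)"
  have finV: "finite ?V" using wf by (simp add: wf_mgraph_def)
  have "sym (adj_rel F)" by (auto simp: sym_def adj_rel_def joins_def)
  then have symR: "sym R" unfolding R_def by (intro sym_Int sym_rtrancl) (auto simp: sym_def)
  have eq: "equiv ?V R"
    using symR by (auto simp: equiv_def refl_on_def trans_def R_def intro: rtrancl_trans)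
  have fin: "finite (?V // R)" using finV by (intro finite_quotient) (auto simp: R_def)
  let ?g = "\<lambda>\<psi>. \<lambda>v\<in>?V. \<psi> (R `` {v})"
  let ?S = "{\<phi> \<in> ?V \<rightarrow>\<^sub>E K. \<forall>e\<in>edges F. \<phi> (fst (ends F e)) = \<phi> (snd (ends F e))}"
  have const: "\<phi> a = \<phi> b" if \<phi>: "\<phi> \<in> ?S" and ab: "(a, b) \<in> R" for \<phi> a b
  proof -
    have "(a, b) \<in> (adj_rel F)\<^sup>*" using ab by (simp add: R_def)
    then show ?thesis
      by (induction rule: rtrancl_induct) (use \<phi> in \<open>force simp: adj_rel_def joins_def\<close>)+
  qed
  have "bij_betw ?g (?V // R \<rightarrow>\<^sub>E K) ?S"
  proof (rule bij_betw_imageI)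
    show "inj_on ?g (?V // R \<rightarrow>\<^sub>E K)"
    proof (rule inj_onI)
      fix \<psi> \<psi>' assume *: "\<psi> \<in> ?V // R \<rightarrow>\<^sub>E K" "\<psi>' \<in> ?V // R \<rightarrow>\<^sub>E K" "?g \<psi> = ?g \<psi>'"
      have "\<psi> X = \<psi>' X" if "X \<in> ?V // R" for X
      proof -
        obtain v where "v \<in> ?V" "X = R `` {v}" using \<open>X \<in> ?V // R\<close> by (rule quotientE)
        then show ?thesis using fun_cong[OF *(3), of v] by simp
      qed
      then show "\<psi> = \<psi>'" using *(1,2) by (intro PiE_ext) auto
    qed
    show "?g ` (?V // R \<rightarrow>\<^sub>E K) = ?S"
    proof (intro equalityI subsetI)
      fix \<phi> assume "\<phi> \<in> ?g ` (?V // R \<rightarrow>\<^sub>E K)"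
      then obtain \<psi> where \<psi>: "\<psi> \<in> ?V // R \<rightarrow>\<^sub>E K" "\<phi> = ?g \<psi>" by blast
      have "\<phi> (fst (ends F e)) = \<phi> (snd (ends F e))" if e: "e \<in> edges F" for e
      proof -
        have V: "fst (ends F e) \<in> ?V" "snd (ends F e) \<in> ?V" using e wf by (auto simp: wf_mgraph_def)
        have "(fst (ends F e), snd (ends F e)) \<in> adj_rel F" using e by (auto simp: adj_rel_def joins_def)
        then have "(fst (ends F e), snd (ends F e)) \<in> R" using V by (simp add: R_def mem_Times_iff r_into_rtrancl)
        then have "R `` {fst (ends F e)} = R `` {snd (ends F e)}" by (rule equiv_class_eq[OF eq])
        then show ?thesis using V \<psi>(2) by simp
      qed
      moreover have "\<phi> \<in> ?V \<rightarrow>\<^sub>E K"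
        using \<psi> by (auto intro!: quotientI PiE_mem[OF \<psi>(1)])
      ultimately show "\<phi> \<in> ?S" by blast
    next
      fix \<phi> assume \<phi>: "\<phi> \<in> ?S"
      define \<psi> where "\<psi> = (\<lambda>X\<in>?V // R. \<phi> (SOME v. v \<in> X))"
      have some: "(SOME w. w \<in> R `` {v}) \<in> R `` {v}" if "v \<in> ?V" for v
        using equiv_class_self[OF eq that] by (rule someI)
      have "\<phi> (SOME w. w \<in> R `` {v}) = \<phi> v" if "v \<in> ?V" for v
        using const[OF \<phi>] some[OF that] by (metis Image_singleton_iff)
      then have \<psi>: "\<psi> (R `` {v}) = \<phi> v" if "v \<in> ?V" for v
        using that by (simp add: \<psi>_def quotientI)
      have "\<psi> \<in> ?V // R \<rightarrow>\<^sub>E K"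
      proof (rule PiE_I)
        fix X assume "X \<in> ?V // R"
        then obtain v where "v \<in> ?V" "X = R `` {v}" by (rule quotientE)
        then show "\<psi> X \<in> K" using \<psi> \<phi> by auto
      qed (simp add: \<psi>_def)
      moreover have "\<phi> = ?g \<psi>"
        using \<phi> \<psi> by (auto simp: fun_eq_iff PiE_def extensional_def)
      ultimately show "\<phi> \<in> ?g ` (?V // R \<rightarrow>\<^sub>E K)" by blast
    qed
  qed
  then have "card ?S = card (?V // R \<rightarrow>\<^sub>E K)" by (simp add: bij_betw_same_card)
  also have "\<dots> = card K ^ num_components F"
    using fin assms(2) by (simp add: card_PiE num_components_def R_def)
  finally show ?thesis .
qed

context colours
begin

lemma dens_PiE:
  assumes "finite V" "vset p E \<subseteq> V"
  shows "(\<Sum>\<phi>\<in>V \<rightarrow>\<^sub>E K. ewt p W E \<phi>) = of_nat (card K) ^ card V * dens p W E"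
proof -
  have "of_nat (card K) ^ card V * dens p W E = of_nat (card K) ^ card V * avg K V (ewt p W E) \<phi>0"
    using dens_eq[OF assms, of W \<phi>0] by simp
  also have "\<dots> = (\<Sum>\<phi>\<in>V \<rightarrow>\<^sub>E K. ewt p W E (override_on \<phi>0 \<phi> V))"
    by (rule avg_PiE[OF assms(1) finite_K K_ne])
  also have "\<dots> = (\<Sum>\<phi>\<in>V \<rightarrow>\<^sub>E K. ewt p W E \<phi>)"
    using assms(2) by (intro sum.cong refl supportedD[OF supported_ewt]) auto
  finally show ?thesis by simp
qed

definition id_matrix :: "'c \<Rightarrow> 'c \<Rightarrow> 'a::field_char_0" where
  "id_matrix x y = of_bool (x = y)"

lemma inv_matrix_id: "inv_matrix id_matrix"
  by (auto simp: inv_matrix_def id_matrix_def \<Gamma>_eq_iff)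

lemma wf_vset: "wf_mgraph F \<Longrightarrow> finite (verts F) \<and> finite (edges F) \<and> vset (ends F) (edges F) \<subseteq> verts F"
  by (auto simp: wf_mgraph_def vset_def)

text \<open>The number of components is read off from the density for the identity matrix.\<close>

lemma dens_id_matrix:
  assumes "wf_mgraph F"
  shows "of_nat (card K) ^ card (verts F) * dens (ends F) (\<lambda>_. id_matrix) (edges F)
    = (of_nat (card K) ^ num_components F :: 'a::field_char_0)"
proof -
  let ?S = "{\<phi> \<in> verts F \<rightarrow>\<^sub>E K. \<forall>e\<in>edges F. \<phi> (fst (ends F e)) = \<phi> (snd (ends F e))}"
  have fin: "finite (verts F)" "finite (edges F)" using wf_vset[OF assms] by auto
  have finS: "finite (verts F \<rightarrow>\<^sub>E K)" using fin(1) finite_K by (simp add: finite_PiE)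
  have "of_nat (card K) ^ card (verts F) * dens (ends F) (\<lambda>_. id_matrix) (edges F)
      = (\<Sum>\<phi>\<in>verts F \<rightarrow>\<^sub>E K. ewt (ends F) (\<lambda>_. id_matrix) (edges F) \<phi> :: 'a)"
    using wf_vset[OF assms] by (intro dens_PiE[symmetric]) auto
  also have "\<dots> = (\<Sum>\<phi>\<in>verts F \<rightarrow>\<^sub>E K. if \<phi> \<in> ?S then 1 else 0)"
    using fin(2) by (intro sum.cong refl) (auto simp: ewt_def id_matrix_def)
  also have "\<dots> = of_nat (card ?S)"
    using finS by (simp add: sum.If_cases Int_def)
  finally show ?thesis using card_constant_colourings[OF assms finite_K] by simp
qed

end

lemma colours_symmetric_group:
  assumes "finite K" "K \<noteq> {}" shows "colours K {\<gamma>. bij_betw \<gamma> K K}"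
proof
  fix x y assume xy: "x \<in> K" "y \<in> K"
  let ?\<gamma> = "id(x := y, y := x)"
  have "bij_betw ?\<gamma> K K"
    using xy by (intro bij_betw_byWitness[of _ ?\<gamma>]) auto
  then show "\<exists>\<gamma>\<in>{\<gamma>. bij_betw \<gamma> K K}. \<gamma> x = y \<and> \<gamma> y = x" by (intro bexI[of _ ?\<gamma>]) auto
qed (use assms in auto)

text \<open>Two colours suffice to read off the exponent: \<open>dens_id_matrix\<close> expresses
  \<open>2 ^ num_components\<close> by a density that only depends on the even sets, and by the
  number of vertices.\<close>

lemma num_components_eq:
  assumes "wf_mgraph F" "wf_mgraph F'" "edges F = edges F'" "card (verts F) = card (verts F')"
    and "same_even (ends F) (ends F') (edges F)"
  shows "num_components F = num_components F'"
proof -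
  interpret colours "{0, 1::nat}" "{\<gamma>. bij_betw \<gamma> {0, 1} {0, 1}}"
    by (rule colours_symmetric_group) auto
  have "finite (edges F)" using assms(1) by (simp add: wf_mgraph_def)
  then have "dens (ends F) (\<lambda>_. id_matrix :: nat \<Rightarrow> nat \<Rightarrow> rat) (edges F) = dens (ends F') (\<lambda>_. id_matrix) (edges F)"
    using assms(5) inv_matrix_id by (intro dens_eq_if_same_even)
  then have "(2::rat) ^ num_components F = 2 ^ num_components F'"
    using dens_id_matrix[OF assms(1), where 'a = rat] dens_id_matrix[OF assms(2), where 'a = rat] assms(3,4) by simp
  then show ?thesis by simp
qed

lemma hom_count_dens:
  assumes "colours {0..<n} \<Gamma>" "wf_mgraph F"
  shows "hom_count F n B = of_nat n ^ card (verts F) * colours.dens {0..<n} (ends F) (\<lambda>_. B) (edges F)"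
proof -
  interpret colours "{0..<n}" \<Gamma> by (rule assms(1))
  show ?thesis
    using dens_PiE[of "verts F" "ends F" "edges F" "\<lambda>_. B"] wf_vset[OF assms(2)]
    by (simp add: hom_count_def ewt_def)
qed

lemma h_dens_invariant:
  fixes B :: "nat \<Rightarrow> nat \<Rightarrow> 'a::field_char_0"
  assumes "n \<ge> 1" "generously_transitive_aut n B"
    and wf: "wf_mgraph F" "wf_mgraph F'" and "cycle_matroid_iso F F'"
  shows "h_dens F n B = h_dens F' n B"
proof -
  interpret colours "{0..<n}" "{\<gamma>. is_automorphism n B \<gamma>}"
  proof
    fix x y assume "x \<in> {0..<n}" "y \<in> {0..<n}"
    then show "\<exists>\<gamma>\<in>{\<gamma>. is_automorphism n B \<gamma>}. \<gamma> x = y \<and> \<gamma> y = x"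
      using assms(2) by (auto simp: generously_transitive_aut_def)
  qed (use assms(1) in \<open>auto simp: is_automorphism_def\<close>)
  have invB: "inv_matrix B" unfolding inv_matrix_def by (auto simp: is_automorphism_def)
  obtain f where f: "bij_betw f (edges F) (edges F')"
    and iso: "\<And>C. C \<subseteq> edges F \<Longrightarrow> is_cycle_edgeset F C \<longleftrightarrow> is_cycle_edgeset F' (f ` C)"
    using assms(5) unfolding cycle_matroid_iso_def by blast
  have same: "same_even (ends F) (ends F' \<circ> f) (edges F)"
    by (rule same_even_if_cycles[OF wf f iso])
  have fin: "finite (edges F)" using wf(1) by (simp add: wf_mgraph_def)
  have eq: "dens (ends F) (\<lambda>_. M) (edges F) = dens (ends F') (\<lambda>_. M) (edges F')"
    if M: "inv_matrix M" for M :: "nat \<Rightarrow> nat \<Rightarrow> 'a"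
  proof -
    have "dens (ends F) (\<lambda>_. M) (edges F) = dens (ends F' \<circ> f) (\<lambda>_. M) (edges F)"
      using fin same M by (intro dens_eq_if_same_even)
    also have "\<dots> = dens (ends F') (\<lambda>_. M) (f ` edges F)"
    proof -
      have "vset (ends F' \<circ> f) (edges F) = vset (ends F') (f ` edges F)" by (auto simp: vset_def)
      moreover have "ewt (ends F' \<circ> f) (\<lambda>_. M) (edges F) = ewt (ends F') (\<lambda>_. M) (f ` edges F)"
        using bij_betw_imp_inj_on[OF f] by (intro ext) (simp add: ewt_def prod.reindex)
      ultimately show ?thesis by (simp add: dens_def)
    qed
    also have "f ` edges F = edges F'" using f by (simp add: bij_betw_def)
    finally show ?thesis .
  qed
  \<comment> \<open>The powers of \<open>n\<close> that count vertices cancel and leave a quotient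
    of two densities, each determined by the even sets.\<close>
  have "h_dens X n B = dens (ends X) (\<lambda>_. B) (edges X) / dens (ends X) (\<lambda>_. id_matrix) (edges X)"
    if X: "wf_mgraph X" for X
  proof -
    have n: "(of_nat n :: 'a) ^ card (verts X) \<noteq> 0" using assms(1) by simp
    have "h_dens X n B = of_nat n ^ card (verts X) * dens (ends X) (\<lambda>_. B) (edges X)
        / (of_nat n ^ card (verts X) * dens (ends X) (\<lambda>_. id_matrix) (edges X))"
      using hom_count_dens[OF colours_axioms X, of B] dens_id_matrix[OF X, where 'a = 'a] by (simp add: h_dens_def)
    then show ?thesis using n assms(1) by simp
  qed
  then show ?thesis using eq[OF invB] eq[OF inv_matrix_id] wf by simp
qed

section \<open>Whitney twists and swapping automorphisms\<close>

lemma bdry_transpose: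
  assumes "\<And>w. \<sigma> (\<sigma> w) = w" "\<And>e. e \<in> Z \<Longrightarrow> q e = (\<sigma> (fst (p e)), \<sigma> (snd (p e)))"
  shows "w \<in> bdry q Z \<longleftrightarrow> \<sigma> w \<in> bdry p Z"
proof -
  have "w = \<sigma> v \<longleftrightarrow> \<sigma> w = v" for v using assms(1) by metis
  then have "w \<in> inc q e \<longleftrightarrow> \<sigma> w \<in> inc p e" if "e \<in> Z" for e
    unfolding inc_def assms(2)[OF that] mem_Collect_eq fst_conv snd_conv by metis
  then have "{e \<in> Z. w \<in> inc q e} = {e \<in> Z. \<sigma> w \<in> inc p e}" by blast
  then show ?thesis by (simp add: bdry_def)
qed

text \<open>\<open>q\<close> arises by a Whitney twist of the side \<open>D\<close>. The trace of an
  even set on a side has boundary empty or \<open>{a, b}\<close>, and exchanging \<open>a\<close>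
  and \<open>b\<close> fixes both.\<close>

lemma same_even_twist:
  assumes fin: "finite C" "finite D" "C \<inter> D = {}" and V: "vset p C \<inter> vset p D \<subseteq> {a, b}"
    and \<sigma>: "\<sigma> = id(a := b, b := a)"
    and q: "\<And>e. e \<in> C \<Longrightarrow> q e = p e" "\<And>e. e \<in> D \<Longrightarrow> q e = (\<sigma> (fst (p e)), \<sigma> (snd (p e)))"
  shows "same_even p q (C \<union> D)"
  unfolding same_even_def
proof (intro allI impI)
  fix Z assume Z: "Z \<subseteq> C \<union> D"
  let ?Y = "Z \<inter> C" and ?X = "Z \<inter> D"
  have finZ: "finite ?Y" "finite ?X" using fin by auto
  have disj: "?Y \<inter> ?X = {}" using fin(3) by blast
  have ZE: "Z = ?Y \<union> ?X" using Z by blast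
  have \<sigma>\<sigma>: "\<sigma> (\<sigma> w) = w" for w by (simp add: \<sigma>)
  have qY: "bdry q ?Y = bdry p ?Y" by (intro bdry_cong) (simp add: q(1))
  have qX: "w \<in> bdry q ?X \<longleftrightarrow> \<sigma> w \<in> bdry p ?X" for w
    by (rule bdry_transpose[OF \<sigma>\<sigma>]) (simp add: q(2))
  have "bdry p Z = sym_diff (bdry p ?Y) (bdry p ?X)" "bdry q Z = sym_diff (bdry q ?Y) (bdry q ?X)"
    using bdry_Un_disjoint[OF finZ disj] ZE by metis+
  then have iff: "bdry p Z = {} \<longleftrightarrow> bdry p ?Y = bdry p ?X" "bdry q Z = {} \<longleftrightarrow> bdry p ?Y = bdry q ?X"
    using qY by auto
  have Y: "bdry p ?Y \<subseteq> vset p C" and X: "bdry p ?X \<subseteq> vset p D"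
    using bdry_subset_vset[of p ?Y] bdry_subset_vset[of p ?X] vset_mono[of ?Y C p] vset_mono[of ?X D p] by auto
  have ab: "T = {} \<or> T = {a, b}" if "T \<subseteq> {a, b}" "T = bdry p ?Y" for T
    using bdry_subset_pair[OF finZ(1), of p a b] that by blast
  show "bdry p Z = {} \<longleftrightarrow> bdry q Z = {}"
    unfolding iff
  proof
    assume eq: "bdry p ?Y = bdry p ?X"
    have "bdry p ?Y \<subseteq> {a, b}" using X Y V unfolding eq[symmetric] by (meson Int_greatest order_trans)
    then have "bdry p ?Y = {} \<or> bdry p ?Y = {a, b}" using ab by blast
    then have "w \<in> bdry p ?Y \<longleftrightarrow> \<sigma> w \<in> bdry p ?X" for w
      unfolding eq[symmetric] by (elim disjE) (auto simp: \<sigma>)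
    then show "bdry p ?Y = bdry q ?X" using qX by blast
  next
    assume eq: "bdry p ?Y = bdry q ?X"
    have "w \<in> {a, b}" if w: "w \<in> bdry p ?Y" for w
    proof (rule ccontr)
      assume n: "w \<notin> {a, b}"
      then have "\<sigma> w = w" by (simp add: \<sigma>)
      then have "w \<in> bdry p ?X" using w eq qX by metis
      then show False using n w X Y V by blast
    qed
    then have T: "bdry p ?Y = {} \<or> bdry p ?Y = {a, b}" using ab by blast
    have "w \<in> bdry p ?X \<longleftrightarrow> \<sigma> w \<in> bdry p ?Y" for w
      unfolding eq qX \<sigma>\<sigma> ..
    moreover have "\<sigma> w \<in> bdry p ?Y \<longleftrightarrow> w \<in> bdry p ?Y" for w
      using T by (elim disjE) (auto simp: \<sigma>)
    ultimately show "bdry p ?Y = bdry p ?X" by blast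
  qed
qed

context colours
begin

lemma avg_joint:
  assumes "finite V" "vset p C \<union> {a, b} \<subseteq> V"
  shows "avg K V (\<lambda>\<phi>. ewt p W C \<phi> * (of_bool (\<phi> a = x) * of_bool (\<phi> b = y))) \<phi> = joint p W C a b x y"
  unfolding joint_def by (rule avg_superset[OF assms(1) supported_joint assms(2)])

lemma joint_swap: "joint p W C b a x y = joint p W C a b y x"
  unfolding joint_def by (simp add: insert_commute mult.commute)

lemma joint_rename:
  assumes "finite C" "inj_on g C" "inj_on m (vset p C \<union> {a, b})"
    and q: "\<And>e. e \<in> C \<Longrightarrow> q (g e) = (m (fst (p e)), m (snd (p e)))"
  shows "joint q (\<lambda>_. M) (g ` C) (m a) (m b) x y = joint p (\<lambda>_. M) C a b x y"
proof -
  let ?V = "vset p C \<union> {a, b}"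
  have fin: "finite ?V" using assms(1) by simp
  have "vset q (g ` C) \<union> {m a, m b} = m ` ?V"
    using q by (auto simp: vset_def)
  moreover have "ewt q (\<lambda>_. M) (g ` C) \<phi> = ewt p (\<lambda>_. M) C (\<phi> \<circ> m)" for \<phi>
    using assms(2) by (simp add: ewt_def prod.reindex q)
  ultimately have "joint q (\<lambda>_. M) (g ` C) (m a) (m b) x y =
      avg K (m ` ?V) (\<lambda>\<phi>. ewt p (\<lambda>_. M) C (\<phi> \<circ> m) * (of_bool ((\<phi> \<circ> m) a = x) * of_bool ((\<phi> \<circ> m) b = y))) \<phi>0"
    by (simp add: joint_def)
  also have "\<dots> = joint p (\<lambda>_. M) C a b x y"
    unfolding avg_rename[OF fin assms(3) supported_joint] by (rule joint_eval[OF assms(1)])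
  finally show ?thesis .
qed

end

section \<open>Invariance under twists as a bilinear identity\<close>

locale cycle_invariant =
  fixes B :: "nat \<Rightarrow> nat \<Rightarrow> 'a::field_char_0" and n :: nat and u v :: nat
  assumes n: "n \<ge> 1" and uv: "u < n" "v < n" "u \<noteq> v"
    and invariant: "\<And>F F'. wf_mgraph F \<Longrightarrow> wf_mgraph F' \<Longrightarrow> cycle_matroid_iso F F' \<Longrightarrow>
          h_dens F n B = h_dens F' n B"
begin

abbreviation "K \<equiv> {0..<n}"

text \<open>No useful automorphism is known yet, so all permutations of \<open>K\<close> are taken.
  \<open>B\<close> need not be invariant under them; what is used about \<open>B\<close> are facts
  on averages, \<open>dens\<close> and \<open>joint\<close> that hold for arbitrary weights.\<close>

sublocale colours K "{\<gamma>. bij_betw \<gamma> K K}"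
  by (rule colours_symmetric_group) (use n in auto)

text \<open>The two sides are the densities of the graphs that arise by gluing \<open>(p, C)\<close> and \<open>(q, D)\<close>
  at \<open>u\<close> and \<open>v\<close> in the two possible ways, that is, of two graphs related by a Whitney twist.\<close>

lemma joint_twist:
  fixes p q :: "nat \<Rightarrow> nat \<times> nat"
  assumes fin: "finite C" "finite D"
  defines "X \<equiv> joint p (\<lambda>_. B) C u v" and "Y \<equiv> joint q (\<lambda>_. B) D u v"
  shows "(\<Sum>x\<in>K. \<Sum>y\<in>K. X x y * Y x y) = (\<Sum>x\<in>K. \<Sum>y\<in>K. X x y * Y y x)"
proof -
  let ?a = "2 * u" and ?b = "2 * v"
  define \<sigma> where "\<sigma> = id(?a := ?b, ?b := ?a)"
  \<comment> \<open>Vertices of \<open>p\<close> are doubled and those of \<open>q\<close> become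
    odd, except that \<open>u\<close> and \<open>v\<close> of both graphs are sent to
    \<open>2 * u\<close> and \<open>2 * v\<close>, where the graphs are glued. Parity likewise
    separates the edge names.\<close>
  define r where "r w = (if w = u \<or> w = v then 2 * w else Suc (2 * w))" for w
  let ?C = "(\<lambda>e. 2 * e) ` C" and ?D = "(\<lambda>e. Suc (2 * e)) ` D"
  define P where "P e = (if even e then map_prod ((*) 2) ((*) 2) (p (e div 2)) else map_prod r r (q (e div 2)))" for e
  define Q where "Q e = (if even e then P e else map_prod \<sigma> \<sigma> (P e))" for e
  have PC: "P (2 * e) = (2 * fst (p e), 2 * snd (p e))" "Q (2 * e) = (2 * fst (p e), 2 * snd (p e))" for e
    by (cases "p e"; simp add: P_def Q_def)+
  have PD: "P (Suc (2 * e)) = (r (fst (q e)), r (snd (q e)))"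
    "Q (Suc (2 * e)) = ((\<sigma> \<circ> r) (fst (q e)), (\<sigma> \<circ> r) (snd (q e)))" for e
    by (cases "q e"; simp add: P_def Q_def)+
  have r: "inj r" "inj (\<sigma> \<circ> r)" "r u = ?a" "r v = ?b" "(\<sigma> \<circ> r) u = ?b" "(\<sigma> \<circ> r) v = ?a"
  proof -
    have "r w div 2 = w" for w by (simp add: r_def)
    then show inj: "inj r" by (metis injI)
    have "\<sigma> (\<sigma> w) = w" for w by (simp add: \<sigma>_def)
    then have "inj \<sigma>" by (metis injI)
    then show "inj (\<sigma> \<circ> r)" using inj by (rule inj_compose)
  qed (simp_all add: r_def \<sigma>_def)
  have ab: "?a \<noteq> ?b" using uv(3) by simp
  have finCD: "finite ?C" "finite ?D" using fin by auto
  have disj: "?C \<inter> ?D = {}" by auto presburger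
  have vC: "vset P ?C \<subseteq> {w. even w}" "vset Q ?C \<subseteq> {w. even w}" by (auto simp: vset_def PC)
  have r_even: "even (r w) \<longleftrightarrow> w = u \<or> w = v" for w by (auto simp: r_def)
  have \<sigma>_even: "even (\<sigma> w) \<longleftrightarrow> even w" for w by (auto simp: \<sigma>_def)
  have vP: "vset P ?C \<inter> vset P ?D \<subseteq> {?a, ?b}"
    using vC(1) r_even r(3,4) by (fastforce simp: vset_def PD)
  have vQ: "vset Q ?C \<inter> vset Q ?D \<subseteq> {?a, ?b}"
    using vC(2) r_even r(5,6) \<sigma>_even by (fastforce simp: vset_def PD)
  define V where "V = vset P (?C \<union> ?D) \<union> vset Q (?C \<union> ?D)"
  define F where "F = \<lparr>verts = V, edges = ?C \<union> ?D, ends = P\<rparr>"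
  define F' where "F' = \<lparr>verts = V, edges = ?C \<union> ?D, ends = Q\<rparr>"
  have finV: "finite V" using finCD by (simp add: V_def)
  have wf: "wf_mgraph F" "wf_mgraph F'"
    using finV finCD by (auto simp: wf_mgraph_def F_def F'_def V_def intro: vsetI)
  have same: "same_even P Q (?C \<union> ?D)"
  proof (rule same_even_twist[OF finCD disj vP \<sigma>_def])
    show "Q e = P e" if "e \<in> ?C" for e using that by (auto simp: Q_def)
    show "Q e = (\<sigma> (fst (P e)), \<sigma> (snd (P e)))" if "e \<in> ?D" for e
      using that by (auto simp: Q_def map_prod_def case_prod_unfold)
  qed
  then have "cycle_matroid_iso F F'"
    by (intro cycle_matroid_iso_if_same_even wf) (simp_all add: F_def F'_def)
  then have "h_dens F n B = h_dens F' n B" by (rule invariant[OF wf])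
  moreover have "num_components F = num_components F'"
    using same by (intro num_components_eq wf) (simp_all add: F_def F'_def)
  ultimately have "hom_count F n B = hom_count F' n B"
    using n by (simp add: h_dens_def)
  then have "dens P (\<lambda>_. B) (?C \<union> ?D) = dens Q (\<lambda>_. B) (?C \<union> ?D)"
    using n hom_count_dens[OF colours_axioms wf(1), of B] hom_count_dens[OF colours_axioms wf(2), of B]
    by (simp add: F_def F'_def)
  moreover have "joint P (\<lambda>_. B) ?C ?a ?b = X" "joint Q (\<lambda>_. B) ?C ?a ?b = X"
    unfolding X_def fun_eq_iff
    by (intro allI joint_rename[OF fin(1)]; simp add: PC inj_on_def)+
  moreover have "joint P (\<lambda>_. B) ?D ?a ?b = Y"
    unfolding Y_def fun_eq_iff r(3,4)[symmetric]
    by (intro allI joint_rename[OF fin(2)] inj_on_subset[OF r(1)]) (simp_all add: PD inj_on_def)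
  moreover have "joint Q (\<lambda>_. B) ?D ?b ?a = Y"
    unfolding Y_def fun_eq_iff r(5,6)[symmetric]
    by (intro allI joint_rename[OF fin(2)] inj_on_subset[OF r(2)]) (simp_all add: PD inj_on_def)
  then have "joint Q (\<lambda>_. B) ?D ?a ?b x y = Y y x" for x y
    using joint_swap[of Q "\<lambda>_. B" ?D ?b ?a y x] by simp
  ultimately show ?thesis
    using dens_glue2[OF finCD disj vP ab, of "\<lambda>_. B"] dens_glue2[OF finCD disj vQ ab, of "\<lambda>_. B"] n
    by simp
qed

inductive_set labelled_span :: "(nat \<Rightarrow> nat \<Rightarrow> 'a) set" where
  joint: "finite C \<Longrightarrow> joint (p :: nat \<Rightarrow> nat \<times> nat) (\<lambda>_. B) (C :: nat set) u v \<in> labelled_span"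
| diagonal: "(\<And>x y. x \<in> K \<Longrightarrow> y \<in> K \<Longrightarrow> x \<noteq> y \<Longrightarrow> X x y = 0) \<Longrightarrow> X \<in> labelled_span"
| combine: "X \<in> labelled_span \<Longrightarrow> Y \<in> labelled_span \<Longrightarrow> (\<lambda>x y. X x y + c * Y x y) \<in> labelled_span"

definition twist_sym :: "(nat \<Rightarrow> nat \<Rightarrow> 'a) \<Rightarrow> (nat \<Rightarrow> nat \<Rightarrow> 'a) \<Rightarrow> bool" where
  "twist_sym X Y \<longleftrightarrow> (\<Sum>x\<in>K. \<Sum>y\<in>K. X x y * Y x y) = (\<Sum>x\<in>K. \<Sum>y\<in>K. X x y * Y y x)"

lemma twist_sym_diagonal:
  assumes "\<And>x y. x \<in> K \<Longrightarrow> y \<in> K \<Longrightarrow> x \<noteq> y \<Longrightarrow> X x y = 0"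
  shows "twist_sym X Y" "twist_sym Y X"
proof -
  have "X x y * Y x y = X x y * Y y x" "Y x y * X x y = Y x y * X y x" if "x \<in> K" "y \<in> K" for x y
    using assms[of x y] assms[of y x] that by (cases "x = y"; simp)+
  then show "twist_sym X Y" "twist_sym Y X" unfolding twist_sym_def by (intro sum.cong refl; simp)+
qed

lemma twist_sym_combine_left:
  assumes "twist_sym X Z" "twist_sym Y Z" shows "twist_sym (\<lambda>x y. X x y + c * Y x y) Z"
  using assms unfolding twist_sym_def
  by (simp add: distrib_right sum.distrib mult.assoc flip: sum_distrib_left)

lemma twist_sym_combine_right:
  assumes "twist_sym Z X" "twist_sym Z Y" shows "twist_sym Z (\<lambda>x y. X x y + c * Y x y)"
  using assms unfolding twist_sym_def
  by (simp add: distrib_left sum.distrib mult.left_commute[of _ c] flip: sum_distrib_left)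

lemma twist_sym_span: "X \<in> labelled_span \<Longrightarrow> Y \<in> labelled_span \<Longrightarrow> twist_sym X Y"
proof (induction X rule: labelled_span.induct)
  case (joint C p)
  from joint(2) show ?case
  proof (induction Y rule: labelled_span.induct)
    case (joint D q)
    then show ?case using joint_twist[OF \<open>finite C\<close>] by (simp add: twist_sym_def)
  qed (auto intro: twist_sym_diagonal twist_sym_combine_right)
qed (auto intro: twist_sym_diagonal twist_sym_combine_left)

section \<open>The indicator of the automorphisms as a combination of 2-labelled graphs\<close>

definition two_labelled :: "((nat \<Rightarrow> nat) \<Rightarrow> 'a) \<Rightarrow> nat \<Rightarrow> nat \<Rightarrow> 'a" where
  "two_labelled g x y = avg K K (\<lambda>\<phi>. g \<phi> * (of_bool (\<phi> u = x) * of_bool (\<phi> v = y))) \<phi>0"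

lemma two_labelled_combine: "two_labelled (\<lambda>\<phi>. f \<phi> + c * g \<phi>) x y = two_labelled f x y + c * two_labelled g x y"
proof -
  let ?i = "\<lambda>\<phi>. of_bool (\<phi> u = x) * of_bool (\<phi> v = y) :: 'a"
  have "two_labelled (\<lambda>\<phi>. f \<phi> + c * g \<phi>) x y
      = avg K K (\<lambda>\<phi>. \<Sum>b\<in>{True, False}. if b then f \<phi> * ?i \<phi> else c * (g \<phi> * ?i \<phi>)) \<phi>0"
    by (simp add: two_labelled_def algebra_simps)
  then show ?thesis by (subst (asm) avg_sum) (simp_all add: two_labelled_def avg_scale)
qed

text \<open>Averaging over the unlabelled vertex \<open>j\<close> selects one colour out of
  \<open>n\<close>, namely \<open>\<phi> i\<close>: up to this factor \<open>j\<close> is merged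
  into \<open>i\<close>.\<close>

lemma two_labelled_identify:
  assumes "i < n" "j < n" "i \<noteq> j" "j \<noteq> u" "j \<noteq> v"
  shows "two_labelled (\<lambda>\<phi>. of_bool (\<phi> i = \<phi> j) * g \<phi>) x y
    = inverse (of_nat n) * two_labelled (\<lambda>\<phi>. g (\<phi>(j := \<phi> i))) x y"
proof -
  let ?i = "\<lambda>\<phi>. of_bool (\<phi> u = x) * of_bool (\<phi> v = y) :: 'a"
  let ?f = "\<lambda>\<phi>. of_bool (\<phi> i = \<phi> j) * g \<phi> * ?i \<phi>"
  have K: "K = K \<union> {j}" using assms(2) by auto
  have "two_labelled (\<lambda>\<phi>. of_bool (\<phi> i = \<phi> j) * g \<phi>) x y = avg K (K \<union> {j}) ?f \<phi>0"
    using K by (simp add: two_labelled_def)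
  also have "\<dots> = avg K K (avg1 K j ?f) \<phi>0"
    by (subst avg_Un) (simp_all add: avg_insert)
  also have "\<dots> = avg K K (\<lambda>\<phi>. inverse (of_nat n) * (g (\<phi>(j := \<phi> i)) * ?i \<phi>)) \<phi>0"
  proof (intro avg_cong range_\<phi>0)
    fix \<phi> :: "nat \<Rightarrow> nat" assume "range \<phi> \<subseteq> K"
    then have \<phi>: "\<phi> i \<in> K" by blast
    have "avg1 K j ?f \<phi> = (\<Sum>x\<in>K. if \<phi> i = x then g (\<phi>(j := x)) * ?i \<phi> else 0) / of_nat n"
      unfolding avg1_def using assms(3-5)
      by (intro arg_cong2[of _ _ _ _ "(/)"] sum.cong) auto
    then show "avg1 K j ?f \<phi> = inverse (of_nat n) * (g (\<phi>(j := \<phi> i)) * ?i \<phi>)"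
      using \<phi> by (simp add: field_simps)
  qed simp
  finally show ?thesis by (simp add: avg_scale two_labelled_def)
qed

text \<open>A factor vanishes exactly when the map errs in one way: an entry of \<open>B\<close>
  takes the unwanted value \<open>c\<close>, or two colours collide.\<close>

definition factor :: "nat \<times> nat \<times> 'a option \<Rightarrow> (nat \<Rightarrow> nat) \<Rightarrow> 'a" where
  "factor t \<phi> = (case t of (i, j, Some c) \<Rightarrow> B (\<phi> i) (\<phi> j) - c | (i, j, None) \<Rightarrow> 1 - of_bool (\<phi> i = \<phi> j))"

definition factors :: "(nat \<times> nat \<times> 'a option) list \<Rightarrow> (nat \<Rightarrow> nat) \<Rightarrow> 'a" where
  "factors ts \<phi> = prod_list (map (\<lambda>t. factor t \<phi>) ts)"

text \<open>Merging \<open>j\<close> into \<open>i\<close> renames the indices in the remaining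
  factors as well as the edges, so the hypothesis is stated for all lists of the same
  length.\<close>

lemma labelled_span_identify:
  fixes p :: "nat \<Rightarrow> nat \<times> nat" and E :: "nat set"
  assumes IH: "\<And>ts' (p :: nat \<Rightarrow> nat \<times> nat) E. length ts' = length ts \<Longrightarrow> finite (E :: nat set) \<Longrightarrow> vset p E \<subseteq> K \<Longrightarrow>
      \<forall>(i, j, c)\<in>set ts'. i < n \<and> j < n \<Longrightarrow>
      two_labelled (\<lambda>\<phi>. ewt p (\<lambda>_. B) E \<phi> * factors ts' \<phi>) \<in> labelled_span"
    and ij: "i < n" "j < n" "i \<noteq> j" "j \<noteq> u" "j \<noteq> v"
    and E: "finite E" "vset p E \<subseteq> K" "\<forall>(i, j, c)\<in>set ts. i < n \<and> j < n"
  shows "two_labelled (\<lambda>\<phi>. of_bool (\<phi> i = \<phi> j) * (ewt p (\<lambda>_. B) E \<phi> * factors ts \<phi>)) \<in> labelled_span"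
proof -
  define r where "r = id(j := i)"
  let ?p = "map_prod r r \<circ> p" and ?ts = "map (\<lambda>(i, j, c). (r i, r j, c)) ts"
  have r: "(\<phi>(j := \<phi> i)) w = \<phi> (r w)" for \<phi> :: "nat \<Rightarrow> nat" and w by (simp add: r_def)
  have "ewt p (\<lambda>_. B) E (\<phi>(j := \<phi> i)) = ewt ?p (\<lambda>_. B) E \<phi>" for \<phi>
    unfolding ewt_def r by (simp add: map_prod_def case_prod_unfold)
  moreover have "factor t (\<phi>(j := \<phi> i)) = factor (case t of (i, j, c) \<Rightarrow> (r i, r j, c)) \<phi>" for t \<phi>
    unfolding factor_def r by (auto split: prod.splits option.splits)
  then have "factors ts (\<phi>(j := \<phi> i)) = factors ?ts \<phi>" for \<phi>
    by (simp add: factors_def comp_def)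
  ultimately have "(\<lambda>\<phi>. ewt p (\<lambda>_. B) E (\<phi>(j := \<phi> i)) * factors ts (\<phi>(j := \<phi> i)))
      = (\<lambda>\<phi>. ewt ?p (\<lambda>_. B) E \<phi> * factors ?ts \<phi>)"
    by (intro ext) (simp only:)
  from two_labelled_identify[OF ij, of "\<lambda>\<phi>. ewt p (\<lambda>_. B) E \<phi> * factors ts \<phi>", unfolded this]
  have eq: "two_labelled (\<lambda>\<phi>. of_bool (\<phi> i = \<phi> j) * (ewt p (\<lambda>_. B) E \<phi> * factors ts \<phi>)) =
      (\<lambda>x y. 0 + inverse (of_nat n) * two_labelled (\<lambda>\<phi>. ewt ?p (\<lambda>_. B) E \<phi> * factors ?ts \<phi>) x y)"
    by (intro ext) simp
  have rK: "r w < n" if "w < n" for w using that ij(1) by (simp add: r_def)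
  have "vset ?p E \<subseteq> K"
  proof
    fix w assume "w \<in> vset ?p E"
    then obtain w' where w': "w' \<in> vset p E" "w = r w'" by (auto simp: vset_def)
    then have "w' < n" using E(2) by auto
    then show "w \<in> K" using rK w'(2) by simp
  qed
  moreover have "\<forall>(i, j, c)\<in>set ?ts. i < n \<and> j < n" using E(3) rK by auto
  ultimately have "two_labelled (\<lambda>\<phi>. ewt ?p (\<lambda>_. B) E \<phi> * factors ?ts \<phi>) \<in> labelled_span"
    using E(1) by (intro IH) auto
  moreover have "(\<lambda>_ _. 0) \<in> labelled_span" by (rule labelled_span.diagonal) simp
  ultimately show ?thesis unfolding eq by (intro labelled_span.combine)
qed

text \<open>The product is multiplied out one factor at a time.
  \<open>B (\<phi> i) (\<phi> j)\<close> is a new edge; an identification merges an unlabelled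
  vertex into another one or, if \<open>i\<close> and \<open>j\<close> are the two labels, leaves a
  diagonal matrix.\<close>

lemma two_labelled_factors_in_span:
  fixes p :: "nat \<Rightarrow> nat \<times> nat" and E :: "nat set"
  assumes "finite E" "vset p E \<subseteq> K" "\<forall>(i, j, c)\<in>set ts. i < n \<and> j < n"
  shows "two_labelled (\<lambda>\<phi>. ewt p (\<lambda>_. B) E \<phi> * factors ts \<phi>) \<in> labelled_span"
  using assms
proof (induction "length ts" arbitrary: ts p E)
  case 0
  then have "two_labelled (\<lambda>\<phi>. ewt p (\<lambda>_. B) E \<phi> * factors ts \<phi>) = joint p (\<lambda>_. B) E u v"
    using uv avg_joint[of K p E u v "\<lambda>_. B"] by (simp add: two_labelled_def factors_def fun_eq_iff)
  then show ?case using labelled_span.joint[OF 0(2)] by simp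
next
  case (Suc m)
  then obtain i j c ts' where ts: "ts = (i, j, c) # ts'" by (metis length_Suc_conv prod_cases3)
  have ij: "i < n" "j < n" and ts': "\<forall>(i, j, c)\<in>set ts'. i < n \<and> j < n" and len: "m = length ts'"
    using Suc.prems(3) Suc.hyps(2) ts by auto
  have IH: "two_labelled (\<lambda>\<phi>. ewt p (\<lambda>_. B) E \<phi> * factors ts'' \<phi>) \<in> labelled_span"
    if "length ts'' = length ts'" "finite E" "vset p E \<subseteq> K" "\<forall>(i, j, c)\<in>set ts''. i < n \<and> j < n"
    for ts'' E and p :: "nat \<Rightarrow> nat \<times> nat"
    using Suc.hyps(1)[of ts'' E p] that len by simp
  let ?G = "\<lambda>\<phi>. ewt p (\<lambda>_. B) E \<phi> * factors ts' \<phi>"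
  have G: "two_labelled ?G \<in> labelled_span" using IH[OF refl Suc.prems(1,2) ts'] .
  show ?case
  proof (cases c)
    case (Some d)
    obtain e where e: "e \<notin> E" using Suc.prems(1) ex_new_if_finite infinite_UNIV_nat by blast
    let ?p = "p(e := (i, j))"
    have "ewt ?p (\<lambda>_. B) E = ewt p (\<lambda>_. B) E" using e by (intro ewt_cong) auto
    then have "ewt p (\<lambda>_. B) E \<phi> * factors ts \<phi> =
        ewt ?p (\<lambda>_. B) (insert e E) \<phi> * factors ts' \<phi> + (- d) * ?G \<phi>" for \<phi>
      using e Suc.prems(1) by (simp add: ewt_insert ts factors_def factor_def Some algebra_simps)
    then have "two_labelled (\<lambda>\<phi>. ewt p (\<lambda>_. B) E \<phi> * factors ts \<phi>) = (\<lambda>x y.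
        two_labelled (\<lambda>\<phi>. ewt ?p (\<lambda>_. B) (insert e E) \<phi> * factors ts' \<phi>) x y + (- d) * two_labelled ?G x y)"
      using two_labelled_combine[where c = "- d" and g = ?G] by (simp add: fun_eq_iff)
    moreover have "vset ?p (insert e E) \<subseteq> K"
      using Suc.prems(2) ij e by (auto simp: vset_def split: if_splits)
    then have "two_labelled (\<lambda>\<phi>. ewt ?p (\<lambda>_. B) (insert e E) \<phi> * factors ts' \<phi>) \<in> labelled_span"
      using Suc.prems(1) ts' by (intro IH) auto
    then have "(\<lambda>x y. two_labelled (\<lambda>\<phi>. ewt ?p (\<lambda>_. B) (insert e E) \<phi> * factors ts' \<phi>) x y + (- d) * two_labelled ?G x y) \<in> labelled_span"
      using G by (rule labelled_span.combine)
    ultimately show ?thesis by (simp only:)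
  next
    case None
    let ?H = "\<lambda>\<phi>. of_bool (\<phi> i = \<phi> j) * ?G \<phi>"
    have "ewt p (\<lambda>_. B) E \<phi> * factors ts \<phi> = ?G \<phi> + (- 1) * ?H \<phi>" for \<phi>
      by (simp add: ts factors_def factor_def None algebra_simps)
    then have eq: "two_labelled (\<lambda>\<phi>. ewt p (\<lambda>_. B) E \<phi> * factors ts \<phi>) =
        (\<lambda>x y. two_labelled ?G x y + (- 1) * two_labelled ?H x y)"
      using two_labelled_combine[where c = "- 1" and g = ?H and f = ?G] by (simp add: fun_eq_iff)
    have "two_labelled ?H \<in> labelled_span"
    proof -
      consider "i = j" | "i \<noteq> j" "j \<noteq> u" "j \<noteq> v" | "i \<noteq> j" "i \<noteq> u" "i \<noteq> v" | "{i, j} = {u, v}" "i \<noteq> j"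
        by auto
      then show ?thesis
      proof cases
        case 1
        then show ?thesis using G by simp
      next
        case 2
        then show ?thesis using labelled_span_identify[OF IH ij _ _ _ Suc.prems(1,2) ts'] by blast
      next
        case 3
        then have "two_labelled (\<lambda>\<phi>. of_bool (\<phi> j = \<phi> i) * ?G \<phi>) \<in> labelled_span"
          using labelled_span_identify[OF IH ij(2,1) _ _ _ Suc.prems(1,2) ts'] by blast
        then show ?thesis by (simp add: eq_commute)
      next
        case 4
        have "two_labelled ?H x y = 0" if "x \<noteq> y" for x y
        proof -
          have "?H \<phi> * (of_bool (\<phi> u = x) * of_bool (\<phi> v = y)) = 0 * 0" for \<phi>
            using 4 that by (auto simp: doubleton_eq_iff)
          then have "two_labelled ?H x y = avg K K (\<lambda>\<phi>. 0 * 0) \<phi>0"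
            unfolding two_labelled_def by (intro arg_cong[where f = "\<lambda>f. avg K K f \<phi>0"] ext)
          also have "\<dots> = 0 * avg K K (\<lambda>\<phi>. 0) \<phi>0" by (rule avg_scale[OF finite_K])
          finally show ?thesis by (simp only: mult_zero_left)
        qed
        then show ?thesis by (intro labelled_span.diagonal) auto
      qed
    qed
    then show ?thesis unfolding eq by (rule labelled_span.combine[OF G])
  qed
qed

text \<open>\<open>B\<close> has finitely many entries on \<open>K\<close>, so a finite list can
  forbid every wrong value and every collision; the product then vanishes at all other maps. An
  automorphism gives each factor the nonzero value that the identity gives it.\<close>

lemma automorphism_factors:
  obtains ts :: "(nat \<times> nat \<times> 'a option) list" and \<kappa> where "\<forall>(i, j, c)\<in>set ts. i < n \<and> j < n" "\<kappa> \<noteq> 0"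
    "\<And>\<phi>. (\<And>i. i < n \<Longrightarrow> \<phi> i < n) \<Longrightarrow> factors ts \<phi> = (if is_automorphism n B \<phi> then \<kappa> else 0)"
proof -
  let ?T1 = "\<lambda>i j. {(i, j, Some c) | c. c \<in> case_prod B ` (K \<times> K) - {B i j}}"
  define T where "T = (\<Union>(i, j)\<in>K \<times> K. ?T1 i j) \<union> (\<Union>(i, j)\<in>{(i, j) \<in> K \<times> K. i \<noteq> j}. {(i, j, None)})"
  have "finite (?T1 i j)" for i j
  proof -
    have "?T1 i j = (\<lambda>c. (i, j, Some c)) ` (case_prod B ` (K \<times> K) - {B i j})" by blast
    then show ?thesis by simp
  qed
  moreover have "finite {(i, j) \<in> K \<times> K. i \<noteq> j}"
    by (rule finite_subset[of _ "K \<times> K"]) auto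
  ultimately have "finite T" unfolding T_def by (intro finite_UnI finite_UN_I) auto
  then obtain ts where ts: "set ts = T" using finite_list by blast
  define \<kappa> where "\<kappa> = factors ts id"
  have zero_iff: "factors ts \<phi> = 0 \<longleftrightarrow> (\<exists>t\<in>T. factor t \<phi> = 0)" for \<phi>
    by (auto simp: factors_def prod_list_zero_iff ts[symmetric])
  have nonzero: "factor t \<phi> = factor t id \<and> factor t id \<noteq> 0" if t: "t \<in> T" and \<phi>: "is_automorphism n B \<phi>" for t \<phi>
  proof -
    have inj: "inj_on \<phi> K" and B: "\<And>i j. i < n \<Longrightarrow> j < n \<Longrightarrow> B (\<phi> i) (\<phi> j) = B i j"
      using \<phi> by (auto simp: is_automorphism_def bij_betw_def)
    from t consider i j c where "t = (i, j, Some c)" "i < n" "j < n" "c \<noteq> B i j"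
      | i j where "t = (i, j, None)" "i < n" "j < n" "i \<noteq> j"
      unfolding T_def by auto
    then show ?thesis
    proof cases
      case 1 then show ?thesis by (simp add: factor_def B)
    next
      case 2
      then have "\<phi> i \<noteq> \<phi> j" using inj_onD[OF inj, of i j] by auto
      then show ?thesis using 2 by (simp add: factor_def)
    qed
  qed
  have id: "is_automorphism n B id" by (simp add: is_automorphism_def)
  have "\<kappa> \<noteq> 0" unfolding \<kappa>_def zero_iff using nonzero[OF _ id] by blast
  moreover have "factors ts \<phi> = (if is_automorphism n B \<phi> then \<kappa> else 0)" if \<phi>: "\<And>i. i < n \<Longrightarrow> \<phi> i < n" for \<phi>
  proof (cases "is_automorphism n B \<phi>")
    case True
    then have "factors ts \<phi> = \<kappa>"
      unfolding factors_def \<kappa>_def using nonzero ts by (intro arg_cong[of _ _ prod_list] map_cong) auto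
    then show ?thesis using True by simp
  next
    case False
    have "\<exists>t\<in>T. factor t \<phi> = 0"
    proof (rule ccontr)
      assume neg: "\<not> ?thesis"
      have "inj_on \<phi> K"
      proof (rule inj_onI, rule ccontr)
        fix i j assume ij: "i \<in> K" "j \<in> K" "\<phi> i = \<phi> j" "i \<noteq> j"
        then have "(i, j, None) \<in> T" by (auto simp: T_def)
        then show False using neg ij(3) by (force simp: factor_def)
      qed
      moreover have "\<phi> ` K \<subseteq> K" using \<phi> by auto
      ultimately have "bij_betw \<phi> K K" by (simp add: bij_betw_def endo_inj_surj)
      moreover have "B (\<phi> i) (\<phi> j) = B i j" if ij: "i < n" "j < n" for i j
      proof (rule ccontr)
        assume "B (\<phi> i) (\<phi> j) \<noteq> B i j"
        moreover have "B (\<phi> i) (\<phi> j) \<in> case_prod B ` (K \<times> K)" using \<phi> ij by force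
        ultimately have "(i, j, Some (B (\<phi> i) (\<phi> j))) \<in> T" using ij by (auto simp: T_def)
        then show False using neg by (force simp: factor_def)
      qed
      ultimately show False using False by (simp add: is_automorphism_def)
    qed
    then show ?thesis using False zero_iff by simp
  qed
  moreover have "\<forall>(i, j, c)\<in>set ts. i < n \<and> j < n" unfolding ts T_def by auto
  ultimately show thesis using that by blast
qed

lemma exists_swapping_automorphism: "\<exists>\<gamma>. is_automorphism n B \<gamma> \<and> \<gamma> u = v \<and> \<gamma> v = u"
proof -
  obtain ts :: "(nat \<times> nat \<times> 'a option) list" and \<kappa> where ts: "\<forall>(i, j, c)\<in>set ts. i < n \<and> j < n" "\<kappa> \<noteq> 0"
    "\<And>\<phi>. (\<And>i. i < n \<Longrightarrow> \<phi> i < n) \<Longrightarrow> factors ts \<phi> = (if is_automorphism n B \<phi> then \<kappa> else 0)"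
    by (rule automorphism_factors) blast
  define A where "A x y = {\<phi> \<in> K \<rightarrow>\<^sub>E K. is_automorphism n B \<phi> \<and> \<phi> u = x \<and> \<phi> v = y}" for x y
  define N where "N x y = card (A x y)" for x y
  have finA: "finite (K \<rightarrow>\<^sub>E K)" by (simp add: finite_PiE)
  \<comment> \<open>The number of maps from \<open>K\<close> to \<open>K\<close>, which turns the
    average into a sum.\<close>
  let ?c = "of_nat n ^ n :: 'a"
  define X where "X = two_labelled (\<lambda>\<phi>. ewt (\<lambda>_ :: nat. (0, 0)) (\<lambda>_. B) {} \<phi> * factors ts \<phi>)"
  have X: "?c * X x y = \<kappa> * of_nat (N x y)" for x y
  proof -
    have "?c * X x y = (\<Sum>\<phi>\<in>K \<rightarrow>\<^sub>E K. factors ts (override_on \<phi>0 \<phi> K) * (of_bool (\<phi> u = x) * of_bool (\<phi> v = y)))"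
      unfolding X_def two_labelled_def
      using avg_PiE[OF finite_K finite_K K_ne,
          of "\<lambda>\<phi>. factors ts \<phi> * (of_bool (\<phi> u = x) * of_bool (\<phi> v = y))" \<phi>0] uv
      by (simp add: ewt_def)
    also have "\<dots> = (\<Sum>\<phi>\<in>K \<rightarrow>\<^sub>E K. if \<phi> \<in> A x y then \<kappa> else 0)"
    proof (intro sum.cong refl)
      fix \<phi> assume \<phi>: "\<phi> \<in> K \<rightarrow>\<^sub>E K"
      let ?\<phi> = "override_on \<phi>0 \<phi> K"
      have "is_automorphism n B ?\<phi> \<longleftrightarrow> is_automorphism n B \<phi>"
        unfolding is_automorphism_def using bij_betw_cong[of K ?\<phi> \<phi> K] by simp
      moreover have "?\<phi> i < n" if "i < n" for i using PiE_mem[OF \<phi>, of i] that by simp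
      ultimately show "factors ts ?\<phi> * (of_bool (\<phi> u = x) * of_bool (\<phi> v = y)) = (if \<phi> \<in> A x y then \<kappa> else 0)"
        using \<phi> ts(3)[of ?\<phi>] by (simp add: A_def)
    qed
    also have "\<dots> = \<kappa> * of_nat (card {\<phi> \<in> K \<rightarrow>\<^sub>E K. \<phi> \<in> A x y})"
      using finA by (simp add: sum.If_cases Int_def)
    also have "{\<phi> \<in> K \<rightarrow>\<^sub>E K. \<phi> \<in> A x y} = A x y" by (auto simp: A_def)
    finally show ?thesis by (simp add: N_def)
  qed
  have "X \<in> labelled_span" unfolding X_def using ts(1) by (intro two_labelled_factors_in_span) (auto simp: vset_def)
  then have "(\<Sum>x\<in>K. \<Sum>y\<in>K. X x y * X x y) = (\<Sum>x\<in>K. \<Sum>y\<in>K. X x y * X y x)"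
    using twist_sym_span by (simp add: twist_sym_def)
  then have "?c * (?c * (\<Sum>x\<in>K. \<Sum>y\<in>K. X x y * X x y)) = ?c * (?c * (\<Sum>x\<in>K. \<Sum>y\<in>K. X x y * X y x))"
    by (simp only:)
  moreover have "?c * (?c * (\<Sum>x\<in>K. \<Sum>y\<in>K. X x y * Y x y))
      = (\<Sum>x\<in>K. \<Sum>y\<in>K. (?c * X x y) * (?c * Y x y))" for Y
    unfolding sum_distrib_left by (intro sum.cong refl) (simp only: ac_simps)
  ultimately have "(\<Sum>x\<in>K. \<Sum>y\<in>K. (?c * X x y) * (?c * X x y)) = (\<Sum>x\<in>K. \<Sum>y\<in>K. (?c * X x y) * (?c * X y x))"
    by metis
  then have "(\<Sum>x\<in>K. \<Sum>y\<in>K. (\<kappa> * of_nat (N x y)) * (\<kappa> * of_nat (N x y)))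
      = (\<Sum>x\<in>K. \<Sum>y\<in>K. (\<kappa> * of_nat (N x y)) * (\<kappa> * of_nat (N y x)))"
    unfolding X .
  moreover have "(\<Sum>x\<in>K. \<Sum>y\<in>K. (\<kappa> * of_nat (N x y)) * (\<kappa> * of_nat (M x y)))
      = \<kappa> * (\<kappa> * of_nat (\<Sum>x\<in>K. \<Sum>y\<in>K. N x y * M x y))" for M
    unfolding of_nat_sum of_nat_mult sum_distrib_left by (intro sum.cong refl) (simp only: ac_simps)
  ultimately have "\<kappa> * (\<kappa> * of_nat (\<Sum>x\<in>K. \<Sum>y\<in>K. N x y * N x y)) = \<kappa> * (\<kappa> * of_nat (\<Sum>x\<in>K. \<Sum>y\<in>K. N x y * N y x))"
    by metis
  then have "of_nat (\<Sum>x\<in>K. \<Sum>y\<in>K. N x y * N x y) = (of_nat (\<Sum>x\<in>K. \<Sum>y\<in>K. N x y * N y x) :: 'a)"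
    using ts(2) by simp
  then have NN: "(\<Sum>x\<in>K. \<Sum>y\<in>K. N x y * N x y) = (\<Sum>x\<in>K. \<Sum>y\<in>K. N x y * N y x)"
    unfolding of_nat_eq_iff .
  \<comment> \<open>The field need not be ordered; once \<open>\<kappa>\<close> is cancelled the
    identity concerns counts, and positivity of squares is used in the integers.\<close>
  have "(int k - int l)\<^sup>2 = int (k * k) + int (l * l) - 2 * int (k * l)" for k l
    by (simp add: power2_eq_square algebra_simps)
  then have "(\<Sum>x\<in>K. \<Sum>y\<in>K. (int (N x y) - int (N y x))\<^sup>2)
      = (\<Sum>x\<in>K. \<Sum>y\<in>K. int (N x y * N x y)) + (\<Sum>x\<in>K. \<Sum>y\<in>K. int (N y x * N y x)) - 2 * (\<Sum>x\<in>K. \<Sum>y\<in>K. int (N x y * N y x))"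
    by (simp only: sum.distrib sum_subtractf sum_distrib_left)
  also have "(\<Sum>x\<in>K. \<Sum>y\<in>K. int (N y x * N y x)) = (\<Sum>x\<in>K. \<Sum>y\<in>K. int (N x y * N x y))"
    by (rule sum.swap)
  also have "(\<Sum>x\<in>K. \<Sum>y\<in>K. int (N x y * N x y)) = (\<Sum>x\<in>K. \<Sum>y\<in>K. int (N x y * N y x))"
    using arg_cong[OF NN, of int] by simp
  finally have "(\<Sum>x\<in>K. \<Sum>y\<in>K. (int (N x y) - int (N y x))\<^sup>2) = 0" by simp
  then have "(\<Sum>y\<in>K. (int (N u y) - int (N y u))\<^sup>2) = 0"
    using uv(1) by (simp add: sum_nonneg_eq_0_iff sum_nonneg)
  then have "N u v = N v u"
    using uv(2) by (simp add: sum_nonneg_eq_0_iff)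
  \<comment> \<open>\<open>A\<close> consists of extensional maps, so the identity enters restricted
    to \<open>K\<close>.\<close>
  moreover have "restrict id K \<in> A u v"
    using uv by (auto simp: A_def is_automorphism_def intro!: bij_betw_imageI inj_onI)
  moreover have "finite (A u v)" by (rule finite_subset[OF _ finA]) (auto simp: A_def)
  ultimately have "N v u \<noteq> 0" unfolding N_def by (metis card_0_eq empty_iff)
  then have "A v u \<noteq> {}" unfolding N_def by (metis card.empty)
  then show ?thesis by (auto simp: A_def)
qed

end

section \<open>Equivalence of matroid invariance and generous transitivity\<close>

theorem theorem1p1:
  fixes B :: "nat \<Rightarrow> nat \<Rightarrow> 'a::field_char_0" and n :: nat
  assumes "n \<ge> 1"
    and "\<forall>i<n. \<forall>j<n. B i j = B j i"
  shows "(\<forall>F F'. wf_mgraph F \<longrightarrow> wf_mgraph F' \<longrightarrow> cycle_matroid_iso F F' \<longrightarrow>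
             h_dens F n B = h_dens F' n B)
         \<longleftrightarrow> generously_transitive_aut n B"
proof
  assume inv: "\<forall>F F'. wf_mgraph F \<longrightarrow> wf_mgraph F' \<longrightarrow> cycle_matroid_iso F F' \<longrightarrow>
             h_dens F n B = h_dens F' n B"
  show "generously_transitive_aut n B"
    unfolding generously_transitive_aut_def
  proof (intro allI impI)
    fix u v assume uv: "u < n" "v < n"
    show "\<exists>\<gamma>. is_automorphism n B \<gamma> \<and> \<gamma> u = v \<and> \<gamma> v = u"
    proof (cases "u = v")
      case True
      then show ?thesis by (intro exI[of _ id]) (simp add: is_automorphism_def)
    next
      case False
      then interpret cycle_invariant B n u v
        using assms(1) uv inv by unfold_locales blast+
      show ?thesis by (rule exists_swapping_automorphism)
    qed
  qed
next
  assume "generously_transitive_aut n B"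
  then show "\<forall>F F'. wf_mgraph F \<longrightarrow> wf_mgraph F' \<longrightarrow> cycle_matroid_iso F F' \<longrightarrow>
             h_dens F n B = h_dens F' n B"
    using h_dens_invariant[OF assms(1)] by blast
qed

end
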